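(* Let $\mathcal X,\mathcal Y,\tilde{\mathcal X},\tilde{\mathcal Y}$ be finite sets, let $p(x)$ be a pmf on $\mathcal X$, let $p(y|x)$ and $p(\tilde y|\tilde x)$ be discrete memoryless channels from $\mathcal X$ to $\mathcal Y$ and from $\tilde{\mathcal X}$ to $\tilde{\mathcal Y}$ respectively, and let $R\ge 0$. If $(p(x),p(y|x))$ is in the admissible region of the channel-rate pair $(p(\tilde y|\tilde x),R)$ for the asymptotic average-case model, then for all non-negative reals $\beta,\gamma,\theta$, $$I(X;Y)+\min_{U:\,X-U-Y}\big[\beta I(U;XY)+\gamma I(U;X)+\theta I(U;Y)\big]$$ $$\le\ \max_{p(\tilde x)}\Big[I(\tilde X;\tilde Y)+\min_{\tilde U:\,\tilde X-\tilde U-\tilde Y}\big[\beta I(\tilde U;\tilde X\tilde Y)+\gamma I(\tilde U;\tilde X)+\theta I(\tilde U;\tilde Y)\big]\Big]+(\beta+\gamma+2\theta)R .$$ Here $(X,Y)\sim p(x)p(y|x)$, the maximum is over pmfs $p(\tilde x)$ on $\tilde{\mathcal X}$ with $(\tilde X,\tilde Y)\sim p(\tilde x)p(\tilde y|\tilde x)$, and the minima are over auxiliary random variables $U$ (resp. $\tilde U$) jointly distributed with $(X,Y)$ (resp. $(\tilde X,\tilde Y)$) forming the indicated Markov chains. Furthermore, in computing these minima one may restrict to $|\mathcal U|\le|\mathcal X|\cdot|\mathcal Y|$ and $|\tilde{\mathcal U}|\le|\tilde{\mathcal X}|\cdot|\tilde{\mathcal Y}|$, where $\mathcal U$ and $\tilde{\mathcal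 U}$ are the alphabets of $U$ and $\tilde U$.
   Context: All random variables take values in finite sets. Logarithms are base 2. Average-case channel simulation: the goal is to simulate memoryless copies of $p(y|x)$ using memoryless copies of $p(\tilde y|\tilde x)$. $X^n$ is i.i.d. with pmf $p(x)$. The shared randomness $\omega$ is independent of $X^n$ and uniformly distributed on $[1:2^{nR}]=\{1,\dots,2^{nR}\}$ (with $2^{nR}$ understood as an integer, e.g. rounded down). A simulation code of length $n$ consists of a stochastic encoder $q^{\mathrm{enc}}(\tilde x^n|x^n,\omega)$ and a stochastic decoder $q^{\mathrm{dec}}(y^n|\tilde y^n,\omega)$. It induces the distribution $$q(\tilde x^n,\tilde y^n,y^n|\omega,x^n)=q^{\mathrm{enc}}(\tilde x^n|x^n,\omega)\Big(\prod_{i=1}^n p(\tilde y_i|\tilde x_i)\Big)q^{\mathrm{dec}}(y^n|\tilde y^n,\omega),$$ and $q(x^n,y^n)$ denotes the resulting marginal on $(X^n,Y^n)$. It is an $(n,R,\epsilon)$ average-case simulation code if $\big\|q(x^n,y^n)-\prod_{i=1}^n p(x_i)p(y_i|x_i)\big\|_1\le\epsilon$, where $\|\cdot\|_1$ is the total variation distance. The pair $(p(x),p(y|x))$ is in the admissible region of $(p(\tilde y|\tilde x),R)$ for the asymptotic average-case model if there is a sequence of $(n,R,\epsilon_n)$ average-case simulation codes with $\lim_{n\to\infty}\epsilon_n=0$. $X-U-Y$ means that $X$ and $Y$ are conditionally independent given $U$. *)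

theory Defs
  imports "HOL-Probability.Probability"
begin

text \<open>
  Random variables range over finite types; a channel is a function into \<^typ>\<open>'b pmf\<close>. A sequence
  of length \<open>n\<close> is a function on \<^typ>\<open>nat\<close> that is \<^term>\<open>undefined\<close> outside \<open>{..<n}\<close>, matching the
  default value chosen in the products \<^const>\<open>Pi_pmf\<close> below.
\<close>

type_synonym ('a, 'b) channel = "'a \<Rightarrow> 'b pmf"

definition seqs :: "nat \<Rightarrow> (nat \<Rightarrow> 'a) set" where
  "seqs n = ({..<n} \<rightarrow>\<^sub>E UNIV)"

definition iid :: "nat \<Rightarrow> 'a pmf \<Rightarrow> (nat \<Rightarrow> 'a) pmf" where
  "iid n p = Pi_pmf {..<n} undefined (\<lambda>_. p)"

definition memoryless :: "nat \<Rightarrow> ('a, 'b) channel \<Rightarrow> (nat \<Rightarrow> 'a, nat \<Rightarrow> 'b) channel" where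
  "memoryless n W x = Pi_pmf {..<n} undefined (\<lambda>i. W (x i))"

definition joint :: "'a pmf \<Rightarrow> ('a, 'b) channel \<Rightarrow> ('a \<times> 'b) pmf" where
  "joint p W = do { x \<leftarrow> p; y \<leftarrow> W x; return_pmf (x, y) }"

definition shared_randomness :: "nat \<Rightarrow> real \<Rightarrow> nat pmf" where
  "shared_randomness n R = pmf_of_set {1..nat \<lfloor>2 powr (real n * R)\<rfloor>}"

text \<open>The marginal of the induced distribution on \<open>(X\<^sup>n, Y\<^sup>n)\<close>.\<close>

definition simulated ::
  "nat \<Rightarrow> real \<Rightarrow> 'x pmf \<Rightarrow> ('xt, 'yt) channel
    \<Rightarrow> ((nat \<Rightarrow> 'x) \<Rightarrow> nat \<Rightarrow> (nat \<Rightarrow> 'xt) pmf)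
    \<Rightarrow> ((nat \<Rightarrow> 'yt) \<Rightarrow> nat \<Rightarrow> (nat \<Rightarrow> 'y) pmf)
    \<Rightarrow> ((nat \<Rightarrow> 'x) \<times> (nat \<Rightarrow> 'y)) pmf" where
  "simulated n R p Wt enc dec = do {
     x \<leftarrow> iid n p;
     w \<leftarrow> shared_randomness n R;
     xt \<leftarrow> enc x w;
     yt \<leftarrow> memoryless n Wt xt;
     y \<leftarrow> dec yt w;
     return_pmf (x, y)
   }"

definition tv_dist :: "'a pmf \<Rightarrow> 'a pmf \<Rightarrow> real" where
  "tv_dist P Q = (1/2) * (\<Sum>\<^sub>\<infinity>z. \<bar>pmf P z - pmf Q z\<bar>)"

definition simulation_code ::
  "nat \<Rightarrow> real \<Rightarrow> real \<Rightarrow> 'x pmf \<Rightarrow> ('x, 'y) channel \<Rightarrow> ('xt, 'yt) channel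
    \<Rightarrow> ((nat \<Rightarrow> 'x) \<Rightarrow> nat \<Rightarrow> (nat \<Rightarrow> 'xt) pmf)
    \<Rightarrow> ((nat \<Rightarrow> 'yt) \<Rightarrow> nat \<Rightarrow> (nat \<Rightarrow> 'y) pmf) \<Rightarrow> bool" where
  "simulation_code n R \<epsilon> p W Wt enc dec \<longleftrightarrow>
     (\<forall>x w. set_pmf (enc x w) \<subseteq> seqs n) \<and>
     (\<forall>yt w. set_pmf (dec yt w) \<subseteq> seqs n) \<and>
     tv_dist (simulated n R p Wt enc dec) (joint (iid n p) (memoryless n W)) \<le> \<epsilon>"

definition admissible ::
  "'x pmf \<Rightarrow> ('x, 'y) channel \<Rightarrow> ('xt, 'yt) channel \<Rightarrow> real \<Rightarrow> bool" where
  "admissible p W Wt R \<longleftrightarrow>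
     (\<exists>\<epsilon>. \<epsilon> \<longlonglongrightarrow> 0 \<and> (\<forall>n\<ge>1. \<exists>enc dec. simulation_code n R (\<epsilon> n) p W Wt enc dec))"

definition mutual_info :: "'o pmf \<Rightarrow> ('o \<Rightarrow> 'a) \<Rightarrow> ('o \<Rightarrow> 'b) \<Rightarrow> real" where
  "mutual_info P A B =
     prob_space.mutual_information (measure_pmf P) 2 (count_space UNIV) (count_space UNIV) A B"

text \<open>
  The conditional probability \<^const>\<open>cond_prob\<close> given a null event is \<open>0\<close>, so that only the values
  of \<open>U\<close> having positive probability matter.
\<close>

definition markov_chain :: "'o pmf \<Rightarrow> ('o \<Rightarrow> 'a) \<Rightarrow> ('o \<Rightarrow> 'u) \<Rightarrow> ('o \<Rightarrow> 'b) \<Rightarrow> bool" where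
  "markov_chain P A U B \<longleftrightarrow>
     (\<forall>a b u. \<P>(s in measure_pmf P. A s = a \<and> B s = b \<bar> U s = u) =
        \<P>(s in measure_pmf P. A s = a \<bar> U s = u) * \<P>(s in measure_pmf P. B s = b \<bar> U s = u))"

text \<open>
  The auxiliary variable \<open>U\<close> has an arbitrary finite alphabet, taken without loss of generality to
  be a set of natural numbers. It is given by the joint distribution of \<open>((X, Y), U)\<close>.
\<close>

definition auxiliaries :: "('a \<times> 'b) pmf \<Rightarrow> (('a \<times> 'b) \<times> nat) pmf set" where
  "auxiliaries J =
     {V. map_pmf fst V = J \<and> finite (set_pmf (map_pmf snd V)) \<and>
         markov_chain V (fst \<circ> fst) snd (snd \<circ> fst)}"

definition aux_cost :: "real \<Rightarrow> real \<Rightarrow> real \<Rightarrow> (('a \<times> 'b) \<times> nat) pmf \<Rightarrow> real" where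
  "aux_cost \<beta> \<gamma> \<theta> V =
     \<beta> * mutual_info V snd fst + \<gamma> * mutual_info V snd (fst \<circ> fst)
       + \<theta> * mutual_info V snd (snd \<circ> fst)"

definition info_functional :: "real \<Rightarrow> real \<Rightarrow> real \<Rightarrow> ('a \<times> 'b) pmf \<Rightarrow> real" where
  "info_functional \<beta> \<gamma> \<theta> J =
     mutual_info J fst snd + (INF V\<in>auxiliaries J. aux_cost \<beta> \<gamma> \<theta> V)"

definition min_attained_within :: "nat \<Rightarrow> real \<Rightarrow> real \<Rightarrow> real \<Rightarrow> ('a \<times> 'b) pmf \<Rightarrow> bool" where
  "min_attained_within k \<beta> \<gamma> \<theta> J \<longleftrightarrow>
     (\<exists>V. is_arg_min (aux_cost \<beta> \<gamma> \<theta>) (\<lambda>V. V \<in> auxiliaries J) V \<and>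
          card (set_pmf (map_pmf snd V)) \<le> k)"

end

theory Submission
  imports Defs
begin

text \<open>
  Every inequality is a linear combination of submodularity of entropy and of the entropy
  equalities that come from conditional independence, on one finitely supported law.

  An auxiliary variable of a channel amounts to an extension of the channel whose transition
  probabilities factor as \<open>f(x, u) g(y, u)\<close>, which does not involve the input law. An extension that
  is optimal for one input law therefore bounds the functional at all input laws, so that the
  functional is upper semicontinuous and its maximum exists. Moreover, such extensions can be used
  memorylessly inside a code: take \<open>V\<^sub>i\<close> optimal for the law of the \<open>i\<close>-th channel input. Then
  \<open>U = (V\<^sup>n, \<omega>)\<close> separates \<open>X\<^sup>n\<close> from \<open>Y\<^sup>n\<close>, and each information quantity of \<open>(U, X\<^sup>n, Y\<^sup>n)\<close> is at
  most that of \<open>V\<^sup>n\<close> with the channel input and output, plus \<open>H(\<omega>) \<le> n R\<close> when \<open>Y\<^sup>n\<close> is involved.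
  The simulated law is nearly i.i.d., so its entropy deficit is \<open>o(n)\<close> and the left-hand side splits
  over letters; the letter laws approach \<open>p(x) p(y|x)\<close>, where the functional is lower
  semicontinuous by compactness, for which the bound on the alphabet of \<open>U\<close> is needed.
\<close>

subsection \<open>Entropy and conditional independence\<close>

text \<open>No time-sharing variable and no concavity in the input law occur. On the simulated side
  one block variable \<open>U\<close> is the auxiliary of every letter pair at once, since a Markov
  chain survives projection to coordinates; on the channel side each use is compared with the
  supremum at its own input law. The constant comes from counting where the shared randomness
  \<omega> is paid for. It costs H(\<omega>) once in I(U;XY) and once in I(U;Y), and nothing in
  I(U;X), because \<omega> is independent of X^n. This gives (\<beta> + \<theta>) R, which is at
  most the claimed (\<beta> + \<gamma> + 2 \<theta>) R. The simulation error is counted the same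
  way: X^n is exactly i.i.d., so only the \<beta> and \<theta> terms pay for the entropy deficit.
  For the deficit to be o(n) the alphabet of the block, which is exponential in n, may enter only
  through its logarithm times the total variation distance; an additive constant independent of n is
  harmless.\<close>

definition ent :: "'a pmf \<Rightarrow> real" where
  "ent p = (\<Sum>x\<in>set_pmf p. - pmf p x * log 2 (pmf p x))"

definition rv_ent :: "'o pmf \<Rightarrow> ('o \<Rightarrow> 'a) \<Rightarrow> real" where
  "rv_ent P A = ent (map_pmf A P)"

definition rv_mi :: "'o pmf \<Rightarrow> ('o \<Rightarrow> 'a) \<Rightarrow> ('o \<Rightarrow> 'b) \<Rightarrow> real" where
  "rv_mi P A B = rv_ent P A + rv_ent P B - rv_ent P (\<lambda>s. (A s, B s))"

text \<open>The defining identity is multiplied out: it is trivial at null values of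
  \<open>C\<close>, and being polynomial in the probabilities it passes to pointwise limits.\<close>

definition cond_indep :: "'o pmf \<Rightarrow> ('o \<Rightarrow> 'a) \<Rightarrow> ('o \<Rightarrow> 'b) \<Rightarrow> ('o \<Rightarrow> 'c) \<Rightarrow> bool" where
  "cond_indep P A B C \<longleftrightarrow>
     (\<forall>a b c. pmf (map_pmf (\<lambda>s. (A s, B s, C s)) P) (a, b, c) * pmf (map_pmf C P) c =
        pmf (map_pmf (\<lambda>s. (A s, C s)) P) (a, c) * pmf (map_pmf (\<lambda>s. (B s, C s)) P) (b, c))"

lemma ent_superset:
  assumes "finite S" "set_pmf p \<subseteq> S"
  shows "ent p = (\<Sum>x\<in>S. - pmf p x * log 2 (pmf p x))"
  unfolding ent_def
  by (rule sum.mono_neutral_left) (use assms in \<open>auto simp: set_pmf_iff\<close>)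

lemma pmf_map_sum:
  assumes "finite (set_pmf P)"
  shows "pmf (map_pmf A P) a = (\<Sum>s | s \<in> set_pmf P \<and> A s = a. pmf P s)"
proof -
  have "pmf (map_pmf A P) a = measure (measure_pmf P) (A -` {a})"
    by (simp add: pmf_map)
  also have "\<dots> = measure (measure_pmf P) (A -` {a} \<inter> set_pmf P)"
    by (simp add: measure_Int_set_pmf)
  also have "\<dots> = (\<Sum>s \<in> A -` {a} \<inter> set_pmf P. pmf P s)"
    by (rule measure_measure_pmf_finite) (use assms in auto)
  also have "A -` {a} \<inter> set_pmf P = {s. s \<in> set_pmf P \<and> A s = a}" by auto
  finally show ?thesis .
qed

lemma pmf_map_pos:
  assumes "s \<in> set_pmf P"
  shows "pmf (map_pmf A P) (A s) > 0"
  using assms by (auto intro!: pmf_positive)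

lemma sum_group_pmf:
  assumes "finite (set_pmf P)"
  shows "(\<Sum>a\<in>A ` set_pmf P. pmf (map_pmf A P) a * g a) = (\<Sum>s\<in>set_pmf P. pmf P s * g (A s))"
proof -
  have "(\<Sum>s\<in>set_pmf P. pmf P s * g (A s))
      = (\<Sum>a\<in>A ` set_pmf P. \<Sum>s | s \<in> set_pmf P \<and> A s = a. pmf P s * g (A s))"
    by (rule sum.image_gen) (use assms in auto)
  also have "\<dots> = (\<Sum>a\<in>A ` set_pmf P. pmf (map_pmf A P) a * g a)"
    by (rule sum.cong) (auto simp: pmf_map_sum[OF assms] sum_distrib_right intro!: sum.cong)
  finally show ?thesis by simp
qed

text \<open>Summing over outcomes instead of values of \<open>A\<close> gives the entropies of
  different variables one common index set, so that combinations of them can be compared term by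
  term.\<close>

lemma rv_ent_expand:
  assumes "finite (set_pmf P)"
  shows "rv_ent P A = (\<Sum>s\<in>set_pmf P. pmf P s * - log 2 (pmf (map_pmf A P) (A s)))"
  unfolding rv_ent_def ent_def
  using sum_group_pmf[OF assms, of A "\<lambda>a. - log 2 (pmf (map_pmf A P) a)"]
  by (simp add: algebra_simps)

text \<open>Entropy sees only the partition of the support that the variable induces. This justifies
  every re-bracketing of tuples below.\<close>

lemma rv_ent_cong:
  assumes "finite (set_pmf P)"
    and eq: "\<And>s t. s \<in> set_pmf P \<Longrightarrow> t \<in> set_pmf P \<Longrightarrow> A s = A t \<longleftrightarrow> B s = B t"
  shows "rv_ent P A = rv_ent P B"
proof -
  have "pmf (map_pmf A P) (A s) = pmf (map_pmf B P) (B s)" if "s \<in> set_pmf P" for s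
    unfolding pmf_map_sum[OF assms(1)] using that eq by (intro sum.cong) auto
  thus ?thesis unfolding rv_ent_expand[OF assms(1)] by (intro sum.cong) auto
qed

lemma rv_mi_cong:
  assumes "finite (set_pmf P)"
    and "\<And>s t. s \<in> set_pmf P \<Longrightarrow> t \<in> set_pmf P \<Longrightarrow> A s = A t \<longleftrightarrow> A' s = A' t"
    and "\<And>s t. s \<in> set_pmf P \<Longrightarrow> t \<in> set_pmf P \<Longrightarrow> B s = B t \<longleftrightarrow> B' s = B' t"
  shows "rv_mi P A B = rv_mi P A' B'"
proof -
  have "rv_ent P A = rv_ent P A'" "rv_ent P B = rv_ent P B'"
    "rv_ent P (\<lambda>s. (A s, B s)) = rv_ent P (\<lambda>s. (A' s, B' s))"
    by (rule rv_ent_cong[OF assms(1)]; use assms(2,3) in auto)+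
  thus ?thesis unfolding rv_mi_def by simp
qed

lemma rv_ent_map_pmf: "rv_ent (map_pmf f P) A = rv_ent P (\<lambda>s. A (f s))"
  unfolding rv_ent_def by (simp add: map_pmf_comp)

lemma rv_mi_map_pmf: "rv_mi (map_pmf f P) A B = rv_mi P (\<lambda>s. A (f s)) (\<lambda>s. B (f s))"
  unfolding rv_mi_def by (simp add: rv_ent_map_pmf)

lemma pmf_map_marginal:
  assumes "finite (set_pmf P)" "finite S" "B ` set_pmf P \<subseteq> S"
  shows "(\<Sum>b\<in>S. pmf (map_pmf (\<lambda>s. (B s, C s)) P) (b, c)) = pmf (map_pmf C P) c"
proof -
  have "pmf (map_pmf C P) c = (\<Sum>s | s \<in> set_pmf P \<and> C s = c. pmf P s)"
    by (rule pmf_map_sum[OF assms(1)])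
  also have "\<dots> = (\<Sum>b\<in>S. \<Sum>s | s \<in> {s. s \<in> set_pmf P \<and> C s = c} \<and> B s = b. pmf P s)"
    by (rule sum.group[symmetric]) (use assms in auto)
  also have "\<dots> = (\<Sum>b\<in>S. pmf (map_pmf (\<lambda>s. (B s, C s)) P) (b, c))"
    unfolding pmf_map_sum[OF assms(1)] by (intro sum.cong) auto
  finally show ?thesis by simp
qed

lemma log2_le_linear: "t > 0 \<Longrightarrow> log 2 t \<le> (t - 1) / ln 2"
  unfolding log_def by (intro divide_right_mono ln_le_minus_one) auto

text \<open>This is I(A;B|C) \<ge> 0 by Gibbs' inequality: \<open>r\<close> is the ratio of the
  conditionally independent law to the true one, log r \<le> (r - 1) / ln 2, and the mean of
  \<open>r\<close> is at most 1.\<close>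

lemma rv_ent_submodular:
  assumes fin: "finite (set_pmf P)"
  shows "rv_ent P (\<lambda>s. (A s, B s, C s)) + rv_ent P C
    \<le> rv_ent P (\<lambda>s. (A s, C s)) + rv_ent P (\<lambda>s. (B s, C s))"
proof -
  let ?S = "set_pmf P" and ?T = "\<lambda>s. (A s, B s, C s)"
  let ?Pac = "\<lambda>a c. pmf (map_pmf (\<lambda>s. (A s, C s)) P) (a, c)"
  let ?Pbc = "\<lambda>b c. pmf (map_pmf (\<lambda>s. (B s, C s)) P) (b, c)"
  let ?Pc = "\<lambda>c. pmf (map_pmf C P) c"
  let ?P = "\<lambda>a b c. pmf (map_pmf ?T P) (a, b, c)"
  define r where "r = (\<lambda>(a, b, c). ?Pac a c * ?Pbc b c / (?P a b c * ?Pc c))"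
  have pos: "?P (A s) (B s) (C s) > 0" "?Pac (A s) (C s) > 0" "?Pbc (B s) (C s) > 0" "?Pc (C s) > 0"
    if "s \<in> ?S" for s
    using pmf_map_pos[OF that, of ?T] pmf_map_pos[OF that, of "\<lambda>s. (A s, C s)"]
      pmf_map_pos[OF that, of "\<lambda>s. (B s, C s)"] pmf_map_pos[OF that, of C] by auto
  have "(\<Sum>s\<in>?S. pmf P s * r (?T s)) = (\<Sum>t\<in>?T ` ?S. pmf (map_pmf ?T P) t * r t)"
    by (rule sum_group_pmf[OF fin, symmetric])
  also have "\<dots> = (\<Sum>(a, b, c)\<in>?T ` ?S. ?Pac a c * ?Pbc b c / ?Pc c)"
  proof (intro sum.cong refl)
    fix t assume "t \<in> ?T ` ?S"
    then obtain s where s: "s \<in> ?S" "t = ?T s" by blast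
    show "pmf (map_pmf ?T P) t * r t = (case t of (a, b, c) \<Rightarrow> ?Pac a c * ?Pbc b c / ?Pc c)"
      using pos(1)[OF s(1)] by (simp add: s(2) r_def)
  qed
  \<comment> \<open>The support of the triple is enlarged to a full product, on which the sums over
    \<open>a\<close> and \<open>b\<close> separate.\<close>
  also have "\<dots> \<le> (\<Sum>(a, b, c)\<in>A ` ?S \<times> B ` ?S \<times> C ` ?S. ?Pac a c * ?Pbc b c / ?Pc c)"
    by (rule sum_mono2) (use fin in auto)
  also have "\<dots> = (\<Sum>a\<in>A ` ?S. \<Sum>b\<in>B ` ?S. \<Sum>c\<in>C ` ?S. ?Pac a c * ?Pbc b c / ?Pc c)"
    by (simp add: sum.cartesian_product)
  also have "\<dots> = (\<Sum>a\<in>A ` ?S. \<Sum>c\<in>C ` ?S. \<Sum>b\<in>B ` ?S. ?Pac a c * ?Pbc b c / ?Pc c)"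
    by (intro sum.cong refl sum.swap)
  also have "\<dots> = (\<Sum>c\<in>C ` ?S. \<Sum>a\<in>A ` ?S. \<Sum>b\<in>B ` ?S. ?Pac a c * ?Pbc b c / ?Pc c)"
    by (rule sum.swap)
  also have "\<dots> = (\<Sum>c\<in>C ` ?S. (\<Sum>a\<in>A ` ?S. ?Pac a c) * (\<Sum>b\<in>B ` ?S. ?Pbc b c) / ?Pc c)"
    by (simp add: sum_product sum_divide_distrib)
  also have "\<dots> = (\<Sum>c\<in>C ` ?S. ?Pc c)"
    using fin by (intro sum.cong refl) (auto simp: pmf_map_marginal)
  also have "\<dots> = 1"
    using fin by (intro sum_pmf_eq_1) auto
  finally have le1: "(\<Sum>s\<in>?S. pmf P s * r (?T s)) \<le> 1" .
  have "rv_ent P ?T + rv_ent P C - rv_ent P (\<lambda>s. (A s, C s)) - rv_ent P (\<lambda>s. (B s, C s))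
     = (\<Sum>s\<in>?S. pmf P s * log 2 (r (?T s)))"
    unfolding rv_ent_expand[OF fin] sum.distrib[symmetric] sum_subtractf[symmetric]
  proof (intro sum.cong refl)
    fix s assume s: "s \<in> ?S"
    show "pmf P s * - log 2 (pmf (map_pmf ?T P) (?T s)) + pmf P s * - log 2 (?Pc (C s))
        - pmf P s * - log 2 (?Pac (A s) (C s)) - pmf P s * - log 2 (?Pbc (B s) (C s))
        = pmf P s * log 2 (r (?T s))"
      using pos[OF s] by (simp add: r_def log_mult_pos log_divide_pos algebra_simps)
  qed
  also have "\<dots> \<le> (\<Sum>s\<in>?S. pmf P s * ((r (?T s) - 1) / ln 2))"
    by (intro sum_mono mult_left_mono log2_le_linear) (use pos in \<open>auto simp: r_def\<close>)
  also have "\<dots> = ((\<Sum>s\<in>?S. pmf P s * r (?T s)) - (\<Sum>s\<in>?S. pmf P s)) / ln 2"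
    by (simp add: sum_subtractf sum_divide_distrib algebra_simps diff_divide_distrib)
  also have "(\<Sum>s\<in>?S. pmf P s) = 1" using fin by (intro sum_pmf_eq_1) auto
  also have "((\<Sum>s\<in>?S. pmf P s * r (?T s)) - 1) / ln 2 \<le> 0"
    using le1 by (simp add: divide_le_0_iff)
  finally show ?thesis by linarith
qed

text \<open>The equality case of submodularity: the logarithms of both sides already agree at each
  outcome of positive probability.\<close>

lemma cond_indep_rv_ent:
  assumes fin: "finite (set_pmf P)" and ci: "cond_indep P A B C"
  shows "rv_ent P (\<lambda>s. (A s, B s, C s)) + rv_ent P C
    = rv_ent P (\<lambda>s. (A s, C s)) + rv_ent P (\<lambda>s. (B s, C s))"
  unfolding rv_ent_expand[OF fin] sum.distrib[symmetric]
proof (intro sum.cong refl)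
  fix s assume s: "s \<in> set_pmf P"
  let ?T = "\<lambda>s. (A s, B s, C s)"
  have pos: "pmf (map_pmf ?T P) (?T s) > 0" "pmf (map_pmf (\<lambda>s. (A s, C s)) P) (A s, C s) > 0"
    "pmf (map_pmf (\<lambda>s. (B s, C s)) P) (B s, C s) > 0" "pmf (map_pmf C P) (C s) > 0"
    using pmf_map_pos[OF s, of ?T] pmf_map_pos[OF s, of "\<lambda>s. (A s, C s)"]
      pmf_map_pos[OF s, of "\<lambda>s. (B s, C s)"] pmf_map_pos[OF s, of C] by auto
  have "log 2 (pmf (map_pmf ?T P) (?T s) * pmf (map_pmf C P) (C s)) =
    log 2 (pmf (map_pmf (\<lambda>s. (A s, C s)) P) (A s, C s) * pmf (map_pmf (\<lambda>s. (B s, C s)) P) (B s, C s))"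
    using ci unfolding cond_indep_def by simp
  hence "log 2 (pmf (map_pmf ?T P) (?T s)) + log 2 (pmf (map_pmf C P) (C s)) =
    log 2 (pmf (map_pmf (\<lambda>s. (A s, C s)) P) (A s, C s)) +
    log 2 (pmf (map_pmf (\<lambda>s. (B s, C s)) P) (B s, C s))"
    using pos by (simp add: log_mult_pos)
  thus "pmf P s * - log 2 (pmf (map_pmf ?T P) (?T s)) + pmf P s * - log 2 (pmf (map_pmf C P) (C s))
    = pmf P s * - log 2 (pmf (map_pmf (\<lambda>s. (A s, C s)) P) (A s, C s)) +
      pmf P s * - log 2 (pmf (map_pmf (\<lambda>s. (B s, C s)) P) (B s, C s))"
    unfolding distrib_left[symmetric] by (simp add: minus_add_distrib[symmetric] del: minus_add_distrib)
qed

section \<open>Conditional independence from factorizations\<close>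

lemma cond_indep_factor:
  assumes fin: "finite (set_pmf P)"
    and fac: "\<And>a b c. pmf (map_pmf (\<lambda>s. (A s, B s, C s)) P) (a, b, c) = f a c * g b c"
  shows "cond_indep P A B C"
  unfolding cond_indep_def
proof (intro allI)
  fix a b c
  let ?T = "\<lambda>s. (A s, B s, C s)"
  \<comment> \<open>The factors may be unnormalised: summing out gives the marginals
    \<open>?F * g\<close>, \<open>f * ?G\<close> and \<open>?F * ?G\<close>, and the identity
    becomes commutativity.\<close>
  let ?F = "\<Sum>a\<in>A ` set_pmf P. f a c" and ?G = "\<Sum>b\<in>B ` set_pmf P. g b c"
  have bc: "pmf (map_pmf (\<lambda>s. (B s, C s)) P) (b, c) = ?F * g b c" for b
    using pmf_map_marginal[OF fin _ subset_refl, of A "\<lambda>s. (B s, C s)" "(b, c)"] fin fac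
    by (simp add: sum_distrib_right)
  have "pmf (map_pmf (\<lambda>s. (B s, A s, C s)) P) (b', a, c) = pmf (map_pmf ?T P) (a, b', c)" for b'
    unfolding pmf_map_sum[OF fin] by (intro sum.cong) auto
  hence ac: "pmf (map_pmf (\<lambda>s. (A s, C s)) P) (a, c) = f a c * ?G"
    using pmf_map_marginal[OF fin _ subset_refl, of B "\<lambda>s. (A s, C s)" "(a, c)"] fin fac
    by (simp add: sum_distrib_left)
  have "pmf (map_pmf C P) c = ?F * ?G"
    using pmf_map_marginal[OF fin _ subset_refl, of B C c] fin bc
    by (simp add: sum_distrib_left)
  thus "pmf (map_pmf ?T P) (a, b, c) * pmf (map_pmf C P) c =
        pmf (map_pmf (\<lambda>s. (A s, C s)) P) (a, c) * pmf (map_pmf (\<lambda>s. (B s, C s)) P) (b, c)"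
    unfolding bc ac fac by (simp add: algebra_simps)
qed

lemma pmf_map_fst_sum:
  assumes fin: "finite (set_pmf P)"
  shows "pmf (map_pmf (\<lambda>s. (f (A s), C s)) P) (a, c)
    = (\<Sum>a' | a' \<in> A ` set_pmf P \<and> f a' = a. pmf (map_pmf (\<lambda>s. (A s, C s)) P) (a', c))"
proof -
  have "pmf (map_pmf (\<lambda>s. (f (A s), C s)) P) (a, c)
     = (\<Sum>s | s \<in> set_pmf P \<and> f (A s) = a \<and> C s = c. pmf P s)"
    unfolding pmf_map_sum[OF fin] by simp
  also have "\<dots> = (\<Sum>a'\<in>{a' \<in> A ` set_pmf P. f a' = a}.
      \<Sum>s | s \<in> {s. s \<in> set_pmf P \<and> f (A s) = a \<and> C s = c} \<and> A s = a'. pmf P s)"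
    by (rule sum.group[symmetric]) (use fin in auto)
  also have "\<dots> = (\<Sum>a' | a' \<in> A ` set_pmf P \<and> f a' = a. pmf (map_pmf (\<lambda>s. (A s, C s)) P) (a', c))"
    unfolding pmf_map_sum[OF fin] by (intro sum.cong) auto
  finally show ?thesis .
qed

lemma cond_indep_commute:
  assumes "cond_indep P A B C"
  shows "cond_indep P B A C"
proof -
  have *: "pmf (map_pmf (\<lambda>s. (B s, A s, C s)) P) (b, a, c) = pmf (map_pmf (\<lambda>s. (A s, B s, C s)) P) (a, b, c)"
    for a b c
    unfolding pmf_map by (rule arg_cong[where f="measure (measure_pmf P)"]) auto
  show ?thesis using assms unfolding cond_indep_def * by (simp add: mult.commute)
qed

text \<open>The defining identity is linear in the law of \<open>A\<close>, so it can be summed over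
  the fibres of \<open>f\<close>.\<close>

lemma cond_indep_map_left:
  assumes fin: "finite (set_pmf P)" and ci: "cond_indep P A B C"
  shows "cond_indep P (\<lambda>s. f (A s)) B C"
  unfolding cond_indep_def
proof (intro allI)
  fix a b c
  have "pmf (map_pmf (\<lambda>s. (f (A s), B s, C s)) P) (a, b, c) * pmf (map_pmf C P) c =
     (\<Sum>a' | a' \<in> A ` set_pmf P \<and> f a' = a.
        pmf (map_pmf (\<lambda>s. (A s, B s, C s)) P) (a', b, c) * pmf (map_pmf C P) c)"
    using pmf_map_fst_sum[OF fin, of f A "\<lambda>s. (B s, C s)" a "(b, c)"] by (simp add: sum_distrib_right)
  also have "\<dots> = pmf (map_pmf (\<lambda>s. (f (A s), C s)) P) (a, c) * pmf (map_pmf (\<lambda>s. (B s, C s)) P) (b, c)"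
    using ci unfolding cond_indep_def pmf_map_fst_sum[OF fin, of f A C a c] by (simp add: sum_distrib_right)
  finally show "pmf (map_pmf (\<lambda>s. (f (A s), B s, C s)) P) (a, b, c) * pmf (map_pmf C P) c = \<dots>" .
qed

lemma cond_indep_map:
  assumes "finite (set_pmf P)" "cond_indep P A B C"
  shows "cond_indep P (\<lambda>s. f (A s)) (\<lambda>s. g (B s)) C"
proof -
  have "cond_indep P B (\<lambda>s. f (A s)) C"
    by (rule cond_indep_commute[OF cond_indep_map_left[OF assms]])
  from cond_indep_commute[OF cond_indep_map_left[OF assms(1) this]] show ?thesis .
qed

section \<open>Inequalities for mutual information\<close>

lemma rv_ent_const: "rv_ent P (\<lambda>_. c) = 0"
  unfolding rv_ent_def ent_def by (simp add: map_pmf_const)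

lemma rv_mi_nonneg:
  assumes fin: "finite (set_pmf P)"
  shows "rv_mi P A B \<ge> 0"
proof -
  have "rv_ent P (\<lambda>s. (A s, B s, ())) = rv_ent P (\<lambda>s. (A s, B s))"
    "rv_ent P (\<lambda>s. (A s, ())) = rv_ent P A" "rv_ent P (\<lambda>s. (B s, ())) = rv_ent P B"
    by (rule rv_ent_cong[OF fin]; auto)+
  thus ?thesis using rv_ent_submodular[OF fin, of A B "\<lambda>_. ()"]
    unfolding rv_mi_def rv_ent_const by simp
qed

lemma rv_mi_commute:
  assumes fin: "finite (set_pmf P)"
  shows "rv_mi P A B = rv_mi P B A"
  unfolding rv_mi_def using rv_ent_cong[OF fin, of "\<lambda>s. (A s, B s)" "\<lambda>s. (B s, A s)"] by auto

text \<open>For the chain A - C - B the difference of the two sides is I(A;C|B): the entropy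
  equality conditions on \<open>C\<close>, submodularity on \<open>B\<close>.\<close>

lemma rv_mi_data_processing:
  assumes fin: "finite (set_pmf P)" and ci: "cond_indep P A B C"
  shows "rv_mi P A B \<le> rv_mi P A C"
proof -
  have "rv_ent P (\<lambda>s. (A s, C s, B s)) = rv_ent P (\<lambda>s. (A s, B s, C s))"
    "rv_ent P (\<lambda>s. (C s, B s)) = rv_ent P (\<lambda>s. (B s, C s))"
    by (rule rv_ent_cong[OF fin]; auto)+
  thus ?thesis using cond_indep_rv_ent[OF assms] rv_ent_submodular[OF fin, of A C B]
    unfolding rv_mi_def by simp
qed

lemma rv_ent_le_pair:
  assumes fin: "finite (set_pmf P)"
  shows "rv_ent P A \<le> rv_ent P (\<lambda>s. (A s, B s))"
  unfolding rv_ent_expand[OF fin]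
proof (intro sum_mono mult_left_mono)
  fix s assume s: "s \<in> set_pmf P"
  have "pmf (map_pmf (\<lambda>s. (A s, B s)) P) (A s, B s) \<le> pmf (map_pmf A P) (A s)"
    unfolding pmf_map_sum[OF fin] by (intro sum_mono2) (use fin in auto)
  moreover have "pmf (map_pmf (\<lambda>s. (A s, B s)) P) (A s, B s) > 0"
    using pmf_map_pos[OF s, of "\<lambda>s. (A s, B s)"] by simp
  ultimately show "- log 2 (pmf (map_pmf A P) (A s)) \<le> - log 2 (pmf (map_pmf (\<lambda>s. (A s, B s)) P) (A s, B s))"
    by simp
qed auto

subsection \<open>Memoryless channels\<close>

lemma pmf_joint: "pmf (joint p W) (x, y) = pmf p x * pmf (W x) y"
proof -
  have "joint p W = bind_pmf p (\<lambda>x. map_pmf (Pair x) (W x))"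
    by (simp add: joint_def map_pmf_def)
  also have "pmf \<dots> (x, y) = measure_pmf.expectation p (\<lambda>x'. pmf (map_pmf (Pair x') (W x')) (x, y))"
    by (simp add: pmf_bind)
  also have "(\<lambda>x'. pmf (map_pmf (Pair x') (W x')) (x, y)) = (\<lambda>x'. indicator {x} x' * pmf (W x) y)"
  proof
    fix x'
    show "pmf (map_pmf (Pair x') (W x')) (x, y) = indicator {x} x' * pmf (W x) y"
    proof (cases "x' = x")
      case True
      thus ?thesis using pmf_map_inj'[of "Pair x" "W x" y] by (simp add: inj_on_def)
    next
      case False
      hence "(x, y) \<notin> set_pmf (map_pmf (Pair x') (W x'))" by auto
      hence "pmf (map_pmf (Pair x') (W x')) (x, y) = 0" by (simp only: set_pmf_iff not_not)
      thus ?thesis using False by simp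
    qed
  qed
  also have "measure_pmf.expectation p \<dots> = pmf p x * pmf (W x) y"
    by (simp add: measure_pmf_single)
  finally show ?thesis .
qed

lemma set_joint: "set_pmf (joint p W) = (SIGMA x:set_pmf p. set_pmf (W x))"
  by (auto simp: set_pmf_iff pmf_joint)

lemma map_fst_joint: "map_pmf fst (joint p W) = p"
  by (simp add: joint_def map_pmf_def bind_assoc_pmf bind_return_pmf bind_return_pmf')

lemma finite_set_joint:
  assumes "finite (set_pmf p)" "\<And>x. finite (set_pmf (W x))"
  shows "finite (set_pmf (joint p W))"
  using assms by (auto simp: set_joint)

lemma map_joint:
  "map_pmf (\<lambda>(x, y). (f x, g y)) (joint p (\<lambda>x. W (f x))) = joint (map_pmf f p) (\<lambda>x. map_pmf g (W x))"
  by (simp add: joint_def map_pmf_def bind_assoc_pmf bind_return_pmf)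

lemma ent_joint:
  assumes "finite (set_pmf p)" "\<And>x. finite (set_pmf (W x))"
  shows "ent (joint p W) = ent p + (\<Sum>x\<in>set_pmf p. pmf p x * ent (W x))"
proof -
  have "ent (joint p W) = (\<Sum>x\<in>set_pmf p. \<Sum>y\<in>set_pmf (W x).
      - (pmf p x * pmf (W x) y) * log 2 (pmf p x * pmf (W x) y))"
    unfolding ent_def set_joint using assms by (subst sum.Sigma) (auto simp: pmf_joint intro!: sum.cong)
  also have "\<dots> = (\<Sum>x\<in>set_pmf p. - pmf p x * log 2 (pmf p x) * (\<Sum>y\<in>set_pmf (W x). pmf (W x) y)
      + pmf p x * ent (W x))"
  proof (intro sum.cong refl)
    fix x assume x: "x \<in> set_pmf p"
    have "(\<Sum>y\<in>set_pmf (W x). - (pmf p x * pmf (W x) y) * log 2 (pmf p x * pmf (W x) y)) =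
      (\<Sum>y\<in>set_pmf (W x). - pmf p x * log 2 (pmf p x) * pmf (W x) y
         + pmf p x * (- pmf (W x) y * log 2 (pmf (W x) y)))"
    proof (intro sum.cong refl)
      fix y assume y: "y \<in> set_pmf (W x)"
      have "log 2 (pmf p x * pmf (W x) y) = log 2 (pmf p x) + log 2 (pmf (W x) y)"
        using x y by (intro log_mult_pos) (auto intro: pmf_positive)
      thus "- (pmf p x * pmf (W x) y) * log 2 (pmf p x * pmf (W x) y) =
        - pmf p x * log 2 (pmf p x) * pmf (W x) y + pmf p x * (- pmf (W x) y * log 2 (pmf (W x) y))"
        by (simp add: algebra_simps)
    qed
    thus "(\<Sum>y\<in>set_pmf (W x). - (pmf p x * pmf (W x) y) * log 2 (pmf p x * pmf (W x) y)) =
      - pmf p x * log 2 (pmf p x) * (\<Sum>y\<in>set_pmf (W x). pmf (W x) y) + pmf p x * ent (W x)"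
      by (simp only: sum.distrib sum_distrib_left ent_def)
  qed
  also have "\<dots> = ent p + (\<Sum>x\<in>set_pmf p. pmf p x * ent (W x))"
  proof -
    have "(\<Sum>y\<in>set_pmf (W x). pmf (W x) y) = 1" for x
      using assms by (intro sum_pmf_eq_1) auto
    thus ?thesis by (simp only: ent_def[of p] sum.distrib mult_1_right)
  qed
  finally show ?thesis .
qed

text \<open>Averaging over \<open>p\<close> rather than over the image of \<open>f\<close> lets all
  coordinates of a sequence share a single outer sum.\<close>

lemma ent_joint_eq_sum:
  assumes "finite (set_pmf p)" "\<And>x. finite (set_pmf (W x))"
  shows "ent (joint (map_pmf f p) W) - ent (map_pmf f p) = (\<Sum>x\<in>set_pmf p. pmf p x * ent (W (f x)))"
  using assms sum_group_pmf[OF assms(1), of f "\<lambda>x. ent (W x)"] by (subst ent_joint) auto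

lemma ent_map_inj:
  assumes "finite (set_pmf p)" "inj_on f (set_pmf p)"
  shows "ent (map_pmf f p) = ent p"
  using rv_ent_cong[OF assms(1), of f id] assms(2) by (auto simp: rv_ent_def inj_on_def)

lemma finite_set_Pi_pmf:
  assumes "finite A" "\<And>i. finite (set_pmf (K i))"
  shows "finite (set_pmf (Pi_pmf A d K))"
  by (rule finite_subset[OF set_Pi_pmf_subset']) (use assms in \<open>auto intro!: finite_PiE_dflt\<close>)

lemma ent_Pi_pmf:
  assumes "finite A" "\<And>i. finite (set_pmf (K i))"
  shows "ent (Pi_pmf A d K) = (\<Sum>i\<in>A. ent (K i))"
  using assms(1)
proof (induction A)
  case empty
  show ?case by (simp add: ent_def)
next
  case (insert i A)
  have fin: "finite (set_pmf (Pi_pmf A d K))" using insert assms by (intro finite_set_Pi_pmf) auto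
  have "ent (Pi_pmf (insert i A) d K) = ent (joint (K i) (\<lambda>_. Pi_pmf A d K))"
    unfolding Pi_pmf_insert[OF insert.hyps(1,2)]
  proof (subst ent_map_inj)
    show "inj_on (\<lambda>(y, f). f(i := y)) (set_pmf (pair_pmf (K i) (Pi_pmf A d K)))"
    proof (rule inj_onI, clarsimp)
      fix a f b g assume *: "f \<in> set_pmf (Pi_pmf A d K)" "g \<in> set_pmf (Pi_pmf A d K)" "f(i := a) = g(i := b)"
      \<comment> \<open>Outside \<open>A\<close> both functions take the default, so the value
        overwritten at \<open>i\<close> is known and the update can be undone.\<close>
      have "f i = d" "g i = d"
        using *(1,2) set_Pi_pmf_subset[OF insert.hyps(1), of d K] insert.hyps(2) by blast+
      thus "a = b \<and> f = g" using *(3) by (metis fun_upd_same fun_upd_triv fun_upd_upd)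
    qed
  qed (use fin assms in \<open>auto simp: joint_def pair_pmf_def\<close>)
  also have "\<dots> = (\<Sum>i\<in>insert i A. ent (K i))"
  proof (subst ent_joint)
    have "(\<Sum>x\<in>set_pmf (K i). pmf (K i) x) = 1" using assms by (intro sum_pmf_eq_1) auto
    thus "ent (K i) + (\<Sum>x\<in>set_pmf (K i). pmf (K i) x * ent (Pi_pmf A d K)) = (\<Sum>i\<in>insert i A. ent (K i))"
      using insert by (simp add: sum_distrib_right[symmetric])
  qed (use fin assms in auto)
  finally show ?case .
qed

lemma map_memoryless_component:
  fixes n :: nat
  assumes P: "map_pmf (\<lambda>s. (B s, Z s)) P = joint \<pi> (\<lambda>b. Pi_pmf {..<n} d (\<lambda>i. K i (b i)))" and i: "i < n"
  shows "map_pmf (\<lambda>s. (B s i, Z s i)) P = joint (map_pmf (\<lambda>b. b i) \<pi>) (K i)"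
proof -
  let ?Kn = "\<lambda>b. Pi_pmf {..<n} d (\<lambda>i. K i (b i))"
  have "map_pmf (\<lambda>s. (B s i, Z s i)) P = map_pmf (\<lambda>(b, z). (b i, z i)) (joint \<pi> ?Kn)"
    unfolding P[symmetric] by (simp add: map_pmf_comp)
  also have "\<dots> = bind_pmf \<pi> (\<lambda>b. map_pmf (Pair (b i)) (map_pmf (\<lambda>z. z i) (?Kn b)))"
    by (simp add: joint_def map_pmf_def bind_assoc_pmf bind_return_pmf)
  also have "\<dots> = bind_pmf \<pi> (\<lambda>b. map_pmf (Pair (b i)) (K i (b i)))"
    using i by (subst Pi_pmf_component) auto
  also have "\<dots> = joint (map_pmf (\<lambda>b. b i) \<pi>) (K i)"
    by (simp add: joint_def map_pmf_def bind_assoc_pmf bind_return_pmf)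
  finally show ?thesis .
qed

text \<open>H(Z|B) splits over letters for any input law \<open>\<pi>\<close>, however dependent its
  letters: given the inputs the outputs are independent, and the entropy at place \<open>i\<close>
  involves only input letter \<open>i\<close>.\<close>

lemma rv_ent_memoryless:
  fixes n :: nat
  assumes fin: "finite (set_pmf \<pi>)" "\<And>i x. finite (set_pmf (K i x))"
    and P: "map_pmf (\<lambda>s. (B s, Z s)) P = joint \<pi> (\<lambda>b. Pi_pmf {..<n} d (\<lambda>i. K i (b i)))"
  shows "rv_ent P (\<lambda>s. (B s, Z s)) - rv_ent P B =
    (\<Sum>i<n. rv_ent P (\<lambda>s. (B s i, Z s i)) - rv_ent P (\<lambda>s. B s i))"
proof -
  let ?Kn = "\<lambda>b. Pi_pmf {..<n} d (\<lambda>i. K i (b i))"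
  have B: "map_pmf B P = \<pi>"
    using arg_cong[OF P, of "map_pmf fst"] by (simp add: map_pmf_comp map_fst_joint)
  have "rv_ent P (\<lambda>s. (B s, Z s)) - rv_ent P B = (\<Sum>b\<in>set_pmf \<pi>. pmf \<pi> b * ent (?Kn b))"
    unfolding rv_ent_def P B using fin by (subst ent_joint) (auto intro: finite_set_Pi_pmf)
  also have "\<dots> = (\<Sum>i<n. \<Sum>b\<in>set_pmf \<pi>. pmf \<pi> b * ent (K i (b i)))"
    using fin by (simp add: ent_Pi_pmf sum_distrib_left sum.swap[of _ "set_pmf \<pi>"])
  also have "\<dots> = (\<Sum>i<n. rv_ent P (\<lambda>s. (B s i, Z s i)) - rv_ent P (\<lambda>s. B s i))"
  proof (intro sum.cong refl)
    fix i assume i: "i \<in> {..<n}"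
    have BZ: "map_pmf (\<lambda>s. (B s i, Z s i)) P = joint (map_pmf (\<lambda>b. b i) \<pi>) (K i)"
      using map_memoryless_component[OF P] i by simp
    have Bi: "map_pmf (\<lambda>s. B s i) P = map_pmf (\<lambda>b. b i) \<pi>"
      unfolding B[symmetric] by (simp add: map_pmf_comp)
    show "(\<Sum>b\<in>set_pmf \<pi>. pmf \<pi> b * ent (K i (b i))) = rv_ent P (\<lambda>s. (B s i, Z s i)) - rv_ent P (\<lambda>s. B s i)"
      unfolding rv_ent_def BZ Bi using fin by (subst ent_joint_eq_sum) auto
  qed
  finally show ?thesis .
qed

section \<open>Subadditivity over the letters of a sequence\<close>

lemma rv_ent_cond_subadditive_list:
  assumes fin: "finite (set_pmf P)"
  shows "rv_ent P (\<lambda>s. (map (Z s) [0..<n], C s)) - rv_ent P C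
    \<le> (\<Sum>i<n. rv_ent P (\<lambda>s. (Z s i, C s)) - rv_ent P C)"
proof (induction n)
  case 0
  have "rv_ent P (\<lambda>s. (map (Z s) [0..<0], C s)) = rv_ent P C" by (rule rv_ent_cong[OF fin]) auto
  thus ?case by simp
next
  case (Suc n)
  have "rv_ent P (\<lambda>s. (map (Z s) [0..<Suc n], C s)) = rv_ent P (\<lambda>s. (map (Z s) [0..<n], Z s n, C s))"
    by (rule rv_ent_cong[OF fin]) auto
  \<comment> \<open>Conditioning on the earlier letters is dropped: the entropy of letter
    \<open>n\<close> given these and \<open>C\<close> is at most that given \<open>C\<close>
    alone.\<close>
  thus ?case using rv_ent_submodular[OF fin, of "\<lambda>s. map (Z s) [0..<n]" "\<lambda>s. Z s n" C] Suc by simp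
qed

text \<open>A constant tail makes a function on the naturals equivalent, on the support, to the list
  of its first \<open>n\<close> letters, where induction on \<open>n\<close> is possible.\<close>

definition seq_rv :: "'o pmf \<Rightarrow> nat \<Rightarrow> ('o \<Rightarrow> nat \<Rightarrow> 'a) \<Rightarrow> bool" where
  "seq_rv P n Z \<longleftrightarrow> (\<exists>d. \<forall>s\<in>set_pmf P. \<forall>i\<ge>n. Z s i = d)"

lemma seq_rv_eq_iff:
  assumes "seq_rv P n Z" "s \<in> set_pmf P" "t \<in> set_pmf P"
  shows "Z s = Z t \<longleftrightarrow> (\<forall>i<n. Z s i = Z t i)"
proof -
  obtain d where d: "\<And>i. n \<le> i \<Longrightarrow> Z s i = d" "\<And>i. n \<le> i \<Longrightarrow> Z t i = d"
    using assms unfolding seq_rv_def by blast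
  have "Z s i = Z t i" if "\<forall>i<n. Z s i = Z t i" for i
    using that d[of i] by (cases "i < n") auto
  thus ?thesis by (auto simp: fun_eq_iff)
qed

lemma rv_ent_cond_subadditive:
  assumes fin: "finite (set_pmf P)" and Z: "seq_rv P n Z"
  shows "rv_ent P (\<lambda>s. (Z s, C s)) - rv_ent P C \<le> (\<Sum>i<n. rv_ent P (\<lambda>s. (Z s i, C s)) - rv_ent P C)"
proof -
  have "rv_ent P (\<lambda>s. (Z s, C s)) = rv_ent P (\<lambda>s. (map (Z s) [0..<n], C s))"
    by (rule rv_ent_cong[OF fin]) (auto simp: seq_rv_eq_iff[OF Z])
  thus ?thesis using rv_ent_cond_subadditive_list[OF fin, of Z n C] by simp
qed

lemma rv_ent_subadditive:
  assumes fin: "finite (set_pmf P)" and Z: "seq_rv P n Z"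
  shows "rv_ent P Z \<le> (\<Sum>i<n. rv_ent P (\<lambda>s. Z s i))"
proof -
  have "rv_ent P (\<lambda>s. (Z s i, ())) = rv_ent P (\<lambda>s. Z s i)" for i
    by (rule rv_ent_cong[OF fin]) auto
  moreover have "rv_ent P (\<lambda>s. (Z s, ())) = rv_ent P Z"
    by (rule rv_ent_cong[OF fin]) auto
  ultimately show ?thesis
    using rv_ent_cond_subadditive[OF assms, of "\<lambda>_. ()"] by (simp add: rv_ent_const)
qed

text \<open>I(U;Z) = H(Z) - H(Z|U) with H(Z|U) subadditive. Superadditivity of I(U;Z) would need
  H(Z) to be additive, and the bracket on the right is its failure.\<close>

lemma rv_mi_seq_ge:
  assumes fin: "finite (set_pmf P)" and Z: "seq_rv P n Z"
  shows "(\<Sum>i<n. rv_mi P U (\<lambda>s. Z s i)) \<le> rv_mi P U Z + ((\<Sum>i<n. rv_ent P (\<lambda>s. Z s i)) - rv_ent P Z)"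
proof -
  have "rv_ent P (\<lambda>s. (U s, Z s)) = rv_ent P (\<lambda>s. (Z s, U s))"
    by (rule rv_ent_cong[OF fin]) auto
  moreover have "rv_ent P (\<lambda>s. (U s, Z s i)) = rv_ent P (\<lambda>s. (Z s i, U s))" for i
    by (rule rv_ent_cong[OF fin]) auto
  ultimately show ?thesis
    using rv_ent_cond_subadditive[OF assms, of U] unfolding rv_mi_def
    by (simp add: sum_subtractf sum.distrib)
qed

text \<open>Given the inputs \<open>B\<close> all conditional entropies split exactly, while the
  entropies of \<open>C\<close> and \<open>U\<close> are subadditive; this gives the first three
  bounds. The last information quantity does not involve \<open>B\<close> and needs the
  factorization \<open>fac\<close>, through the Markov chain of each letter.\<close>

lemma rv_mi_memoryless:
  fixes n :: nat
  assumes finP: "finite (set_pmf P)" and fin: "finite (set_pmf \<pi>)" "\<And>i x. finite (set_pmf (K i x))"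
    and P: "map_pmf (\<lambda>s. (B s, \<lambda>i. (C s i, U s i))) P
      = joint \<pi> (\<lambda>b. Pi_pmf {..<n} (c0, u0) (\<lambda>i. K i (b i)))"
    and fac: "\<And>i x c u. pmf (K i x) (c, u) = f i x u * g i c u"
  shows "rv_mi P B C \<le> (\<Sum>i<n. rv_mi P (\<lambda>s. B s i) (\<lambda>s. C s i))"
    and "rv_mi P U (\<lambda>s. (B s, C s)) \<le> (\<Sum>i<n. rv_mi P (\<lambda>s. U s i) (\<lambda>s. (B s i, C s i)))"
    and "rv_mi P U B \<le> (\<Sum>i<n. rv_mi P (\<lambda>s. U s i) (\<lambda>s. B s i))"
    and "rv_mi P U C \<le> (\<Sum>i<n. rv_mi P (\<lambda>s. U s i) (\<lambda>s. C s i))"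
proof -
  let ?Z = "\<lambda>s i. (C s i, U s i)"
  let ?Kn = "\<lambda>b. Pi_pmf {..<n} (c0, u0) (\<lambda>i. K i (b i))"
  have mapP: "map_pmf (\<lambda>s. (B s, \<lambda>i. h (C s i, U s i))) P
      = joint \<pi> (\<lambda>b. Pi_pmf {..<n} (h (c0, u0)) (\<lambda>i. map_pmf h (K i (b i))))" for h :: "_ \<Rightarrow> 'h"
  proof -
    have "map_pmf (\<lambda>s. (B s, \<lambda>i. h (C s i, U s i))) P = map_pmf (\<lambda>(b, z). (b, h \<circ> z)) (joint \<pi> ?Kn)"
      unfolding P[symmetric] by (simp add: map_pmf_comp comp_def)
    also have "\<dots> = joint \<pi> (\<lambda>b. map_pmf (\<lambda>z. h \<circ> z) (?Kn b))"
      by (simp add: joint_def map_pmf_def bind_assoc_pmf bind_return_pmf)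
    also have "\<dots> = joint \<pi> (\<lambda>b. Pi_pmf {..<n} (h (c0, u0)) (\<lambda>i. map_pmf h (K i (b i))))"
      by (subst Pi_pmf_map) auto
    finally show ?thesis .
  qed
  have Zdflt: "?Z s i = (c0, u0)" if "s \<in> set_pmf P" "i \<ge> n" for s i
  proof -
    have "(B s, ?Z s) \<in> set_pmf (map_pmf (\<lambda>s. (B s, ?Z s)) P)" using that by auto
    hence "?Z s \<in> set_pmf (?Kn (B s))" unfolding P set_joint by auto
    thus ?thesis using set_Pi_pmf_subset[of "{..<n}" "(c0, u0)" "\<lambda>i. K i (B s i)"] that(2)
      by (auto dest!: subsetD)
  qed
  have seqC: "seq_rv P n C" and seqU: "seq_rv P n U"
    using Zdflt unfolding seq_rv_def by auto
  have BZ: "rv_ent P (\<lambda>s. (B s, ?Z s)) - rv_ent P B =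
    (\<Sum>i<n. rv_ent P (\<lambda>s. (B s i, ?Z s i)) - rv_ent P (\<lambda>s. B s i))"
    by (rule rv_ent_memoryless[OF fin P])
  have BC: "rv_ent P (\<lambda>s. (B s, C s)) - rv_ent P B =
    (\<Sum>i<n. rv_ent P (\<lambda>s. (B s i, C s i)) - rv_ent P (\<lambda>s. B s i))"
    using rv_ent_memoryless[OF fin(1) _ mapP, of fst] fin by simp
  have BU: "rv_ent P (\<lambda>s. (B s, U s)) - rv_ent P B =
    (\<Sum>i<n. rv_ent P (\<lambda>s. (B s i, U s i)) - rv_ent P (\<lambda>s. B s i))"
    using rv_ent_memoryless[OF fin(1) _ mapP, of snd] fin by simp
  note subC = rv_ent_subadditive[OF finP seqC] and subU = rv_ent_subadditive[OF finP seqU]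
  show "rv_mi P B C \<le> (\<Sum>i<n. rv_mi P (\<lambda>s. B s i) (\<lambda>s. C s i))"
    using BC subC unfolding rv_mi_def by (simp add: sum_subtractf sum.distrib)
  have UBC: "rv_ent P (\<lambda>s. (U s, B s, C s)) = rv_ent P (\<lambda>s. (B s, ?Z s))"
    by (rule rv_ent_cong[OF finP]) (auto simp: fun_eq_iff)
  have UBCi: "rv_ent P (\<lambda>s. (U s i, B s i, C s i)) = rv_ent P (\<lambda>s. (B s i, ?Z s i))" for i
    by (rule rv_ent_cong[OF finP]) auto
  show "rv_mi P U (\<lambda>s. (B s, C s)) \<le> (\<Sum>i<n. rv_mi P (\<lambda>s. U s i) (\<lambda>s. (B s i, C s i)))"
    using BC BZ subU unfolding rv_mi_def UBC UBCi by (simp add: sum_subtractf sum.distrib)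
  have UB: "rv_ent P (\<lambda>s. (U s, B s)) = rv_ent P (\<lambda>s. (B s, U s))"
    by (rule rv_ent_cong[OF finP]) auto
  have UBi: "rv_ent P (\<lambda>s. (U s i, B s i)) = rv_ent P (\<lambda>s. (B s i, U s i))" for i
    by (rule rv_ent_cong[OF finP]) auto
  show "rv_mi P U B \<le> (\<Sum>i<n. rv_mi P (\<lambda>s. U s i) (\<lambda>s. B s i))"
    using BU subU unfolding rv_mi_def UB UBi by (simp add: sum_subtractf sum.distrib)
  have ci: "cond_indep P (\<lambda>s. B s i) (\<lambda>s. C s i) (\<lambda>s. U s i)" if "i < n" for i
  proof (rule cond_indep_factor[OF finP])
    fix x c u
    have "map_pmf (\<lambda>s. (B s i, C s i, U s i)) P = joint (map_pmf (\<lambda>b. b i) \<pi>) (K i)"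
      using map_memoryless_component[OF P that] .
    thus "pmf (map_pmf (\<lambda>s. (B s i, C s i, U s i)) P) (x, c, u)
      = (pmf (map_pmf (\<lambda>b. b i) \<pi>) x * f i x u) * g i c u"
      by (simp add: pmf_joint fac)
  qed
  have UCi: "rv_ent P (\<lambda>s. (U s i, C s i)) = rv_ent P (\<lambda>s. (C s i, U s i))" for i
    by (rule rv_ent_cong[OF finP]) auto
  \<comment> \<open>H(C|U) \<ge> H(C|B,U), and the latter is the sum of the H(C_i|B_i,U_i) =
    H(C_i|U_i).\<close>
  have "rv_ent P (\<lambda>s. (B s, ?Z s)) - rv_ent P (\<lambda>s. (B s, U s))
    = (\<Sum>i<n. rv_ent P (\<lambda>s. (B s i, ?Z s i)) - rv_ent P (\<lambda>s. (B s i, U s i)))"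
    using BZ BU by (simp add: sum_subtractf)
  also have "\<dots> = (\<Sum>i<n. rv_ent P (\<lambda>s. (U s i, C s i)) - rv_ent P (\<lambda>s. U s i))"
    using cond_indep_rv_ent[OF finP ci] unfolding UCi by (intro sum.cong refl) (simp add: algebra_simps)
  finally have *: "rv_ent P (\<lambda>s. (B s, ?Z s)) - rv_ent P (\<lambda>s. (B s, U s)) = \<dots>" .
  have BCU: "rv_ent P (\<lambda>s. (B s, C s, U s)) = rv_ent P (\<lambda>s. (B s, ?Z s))"
    by (rule rv_ent_cong[OF finP]) (auto simp: fun_eq_iff)
  have UC: "rv_ent P (\<lambda>s. (U s, C s)) = rv_ent P (\<lambda>s. (C s, U s))"
    by (rule rv_ent_cong[OF finP]) auto
  show "rv_mi P U C \<le> (\<Sum>i<n. rv_mi P (\<lambda>s. U s i) (\<lambda>s. C s i))"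
    using * rv_ent_submodular[OF finP, of B C U] subC
    unfolding rv_mi_def BCU UC by (simp add: sum_subtractf sum.distrib)
qed

section \<open>Continuity of entropy in total variation\<close>

lemma entropy_term_diff_le:
  fixes p q c :: real
  assumes "0 \<le> p" "p \<le> 1" "0 \<le> q" "q \<le> 1" "c > 0"
  shows "- q * log 2 q \<le> - p * log 2 p + max (p - q) 0 / ln 2 + (c - max (q - p) 0) / ln 2
    - max (q - p) 0 * log 2 c"
proof (cases "q \<le> p")
  case True
  have "- q * log 2 q + p * log 2 p \<le> (p - q) / ln 2"
  proof (cases "q = 0")
    case True
    have "p * log 2 p \<le> 0"
      using assms by (cases "p = 0") (auto simp: mult_le_0_iff)
    moreover have "0 \<le> p / ln 2" using assms by auto
    ultimately show ?thesis using True by simp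
  next
    case False
    hence q: "q > 0" "p > 0" using assms True by auto
    have "- q * log 2 q + p * log 2 p = (p - q) * log 2 p + q * log 2 (p / q)"
      using q by (simp add: log_divide_pos algebra_simps)
    also have "(p - q) * log 2 p \<le> 0" using q True assms by (simp add: mult_le_0_iff)
    also have "q * log 2 (p / q) \<le> q * ((p / q - 1) / ln 2)"
      using q by (intro mult_left_mono log2_le_linear) auto
    also have "\<dots> = (p - q) / ln 2" using q by (simp add: field_simps)
    finally show ?thesis by simp
  qed
  moreover have "0 \<le> c / ln 2" using assms by auto
  ultimately show ?thesis using True by (simp add: max_def)
next
  case False
  \<comment> \<open>Gained mass \<open>d\<close> adds at most -d log d, and the tangent at
    \<open>c\<close> turns this into a bound linear in \<open>d\<close>.\<close>
  define d where "d = q - p"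
  have d: "d > 0" "d \<le> q" "q > 0" using False assms by (auto simp: d_def)
  have "p * log 2 p \<le> p * log 2 q"
    using assms False by (cases "p = 0") (auto intro!: mult_left_mono)
  hence "- q * log 2 q + p * log 2 p \<le> - d * log 2 q" by (simp add: d_def algebra_simps)
  also have "\<dots> \<le> - d * log 2 d" using d by (simp add: mult_left_mono)
  also have "\<dots> = d * log 2 (c / d) - d * log 2 c"
    using d assms by (simp add: log_divide_pos algebra_simps)
  also have "d * log 2 (c / d) \<le> d * ((c / d - 1) / ln 2)"
    using d assms by (intro mult_left_mono log2_le_linear) auto
  also have "\<dots> = (c - d) / ln 2" using d by (simp add: field_simps)
  finally show ?thesis using False by (simp add: max_def d_def)
qed

text \<open>Taking \<open>c\<close> = 1 / card S makes the constants add up to 1 / ln 2, whatever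
  \<open>S\<close> is. The bound does not vanish with the distance, but after division by the block
  length only the distance times the log-cardinality per letter matters.\<close>

lemma ent_le_ent_plus_l1:
  assumes S: "finite S" "set_pmf P \<subseteq> S" "set_pmf Q \<subseteq> S"
  shows "ent Q \<le> ent P + (\<Sum>x\<in>S. \<bar>pmf P x - pmf Q x\<bar>) / 2 * log 2 (card S) + 1 / ln 2"
proof -
  define t where "t = (\<Sum>x\<in>S. max (pmf Q x - pmf P x) 0)"
  define c where "c = 1 / real (card S)"
  have "S \<noteq> {}" using S set_pmf_not_empty by fastforce
  hence c: "c > 0" "real (card S) > 0" using S by (auto simp: c_def card_gt_0_iff)
  have one: "(\<Sum>x\<in>S. pmf P x) = 1" "(\<Sum>x\<in>S. pmf Q x) = 1"
    using S by (auto intro: sum_pmf_eq_1)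
  \<comment> \<open>Both laws have mass 1, so gained and lost mass are the same \<open>t\<close>,
    half the l1 distance.\<close>
  have "(\<Sum>x\<in>S. max (pmf P x - pmf Q x) 0) - t = (\<Sum>x\<in>S. pmf P x - pmf Q x)"
    unfolding t_def sum_subtractf[symmetric] by (intro sum.cong) auto
  also have "\<dots> = 0" using one by (simp add: sum_subtractf)
  finally have t': "(\<Sum>x\<in>S. max (pmf P x - pmf Q x) 0) = t" by simp
  have "(\<Sum>x\<in>S. \<bar>pmf P x - pmf Q x\<bar>) = (\<Sum>x\<in>S. max (pmf P x - pmf Q x) 0) + t"
    unfolding t_def sum.distrib[symmetric] by (intro sum.cong) auto
  hence tv: "(\<Sum>x\<in>S. \<bar>pmf P x - pmf Q x\<bar>) / 2 = t" using t' by simp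
  have "ent Q \<le> (\<Sum>x\<in>S. - pmf P x * log 2 (pmf P x) + max (pmf P x - pmf Q x) 0 / ln 2
      + (c - max (pmf Q x - pmf P x) 0) / ln 2 - max (pmf Q x - pmf P x) 0 * log 2 c)"
    unfolding ent_superset[OF S(1,3)]
    by (intro sum_mono entropy_term_diff_le c) (auto simp: pmf_le_1)
  also have "\<dots> = ent P + t / ln 2 + (real (card S) * c - t) / ln 2 - t * log 2 c"
    unfolding ent_superset[OF S(1,2)]
    by (simp add: sum.distrib sum_subtractf sum_divide_distrib[symmetric] sum_distrib_right[symmetric]
        t' t_def[symmetric] diff_divide_distrib sum_negf)
  also have "real (card S) * c = 1" using c by (simp add: c_def)
  also have "log 2 c = - log 2 (card S)" using c by (simp add: c_def log_divide_pos)
  finally show ?thesis unfolding tv by (simp add: diff_divide_distrib)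
qed

subsection \<open>Mutual information and auxiliary variables\<close>

lemma distributed_pmf:
  "distributed (measure_pmf P) (count_space UNIV) A (\<lambda>a. ennreal (pmf (map_pmf A P) a))"
  unfolding distributed_def measure_pmf_eq_density[symmetric] by (auto simp: map_pmf_rep_eq)

text \<open>The bridge from the measure-theoretic quantity of the statement to entropies;
  countability makes the product of the two counting measures a counting measure.\<close>

lemma mutual_info_eq_rv_mi:
  fixes A :: "'o \<Rightarrow> 'a::countable" and B :: "'o \<Rightarrow> 'b::countable"
  assumes fin: "finite (set_pmf P)"
  shows "mutual_info P A B = rv_mi P A B"
proof -
  interpret information_space "measure_pmf P" 2
    by unfold_locales simp
  let ?A = "\<lambda>a. pmf (map_pmf A P) a" and ?B = "\<lambda>b. pmf (map_pmf B P) b"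
  let ?AB = "\<lambda>ab. pmf (map_pmf (\<lambda>s. (A s, B s)) P) ab"
  let ?f = "\<lambda>ab. ?AB ab * log 2 (?AB ab / (?A (fst ab) * ?B (snd ab)))"
  have cs: "count_space UNIV \<Otimes>\<^sub>M count_space UNIV = (count_space UNIV :: ('a \<times> 'b) measure)"
    by (subst pair_measure_countable) auto
  have sf: "sigma_finite_measure (count_space UNIV :: 'a measure)"
    "sigma_finite_measure (count_space UNIV :: 'b measure)"
    by (simp_all add: sigma_finite_measure_count_space)
  have "mutual_info P A B = (\<integral>ab. ?f ab \<partial>(count_space UNIV \<Otimes>\<^sub>M count_space UNIV))"
    unfolding mutual_info_def
    by (rule mutual_information_distr[OF sf distributed_pmf _ distributed_pmf _ _])
      (auto simp: cs distributed_pmf)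
  also have "\<dots> = (\<Sum>ab | ab \<in> UNIV \<and> ?f ab \<noteq> 0. ?f ab)"
    unfolding cs
    by (rule lebesgue_integral_count_space_finite_support, rule finite_subset[of _ "(\<lambda>s. (A s, B s)) ` set_pmf P"])
      (use fin in \<open>auto simp: pmf_eq_0_set_pmf\<close>)
  also have "\<dots> = (\<Sum>ab\<in>(\<lambda>s. (A s, B s)) ` set_pmf P. ?f ab)"
    by (rule sum.mono_neutral_left) (use fin in \<open>auto simp: pmf_eq_0_set_pmf\<close>)
  also have "\<dots> = (\<Sum>s\<in>set_pmf P. pmf P s * log 2 (?AB (A s, B s) / (?A (A s) * ?B (B s))))"
    using sum_group_pmf[OF fin, of "\<lambda>s. (A s, B s)" "\<lambda>ab. log 2 (?AB ab / (?A (fst ab) * ?B (snd ab)))"]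
    by simp
  also have "\<dots> = rv_mi P A B"
    unfolding rv_mi_def rv_ent_expand[OF fin] sum.distrib[symmetric] sum_subtractf[symmetric]
  proof (intro sum.cong refl)
    fix s assume s: "s \<in> set_pmf P"
    show "pmf P s * log 2 (?AB (A s, B s) / (?A (A s) * ?B (B s))) =
        pmf P s * - log 2 (?A (A s)) + pmf P s * - log 2 (?B (B s)) - pmf P s * - log 2 (?AB (A s, B s))"
      using pmf_map_pos[OF s, of A] pmf_map_pos[OF s, of B] pmf_map_pos[OF s, of "\<lambda>s. (A s, B s)"]
      by (simp add: log_mult_pos log_divide_pos algebra_simps)
  qed
  finally show ?thesis .
qed

text \<open>At a null \<open>u\<close> all quotients are 0 by convention and the multiplied-out
  identity reads 0 = 0; elsewhere the denominators cancel.\<close>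

lemma markov_chain_iff_cond_indep:
  assumes fin: "finite (set_pmf P)"
  shows "markov_chain P A U B \<longleftrightarrow> cond_indep P A B U"
proof -
  have cp: "cond_prob (measure_pmf P) (\<lambda>s. F s = x) (\<lambda>s. U s = u)
      = pmf (map_pmf (\<lambda>s. (F s, U s)) P) (x, u) / pmf (map_pmf U P) u" for F :: "_ \<Rightarrow> 'f" and x u
    unfolding cond_prob_def pmf_map by (simp add: vimage_def)
  have cp2: "cond_prob (measure_pmf P) (\<lambda>s. A s = a \<and> B s = b) (\<lambda>s. U s = u)
      = pmf (map_pmf (\<lambda>s. (A s, B s, U s)) P) (a, b, u) / pmf (map_pmf U P) u" for a b u
    unfolding cond_prob_def pmf_map by (simp add: vimage_def conj_assoc)
  have zero: "pmf (map_pmf (\<lambda>s. (F s, U s)) P) (x, u) = 0" if "pmf (map_pmf U P) u = 0"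
    for F :: "_ \<Rightarrow> 'f" and x u
    using that by (auto simp: pmf_eq_0_set_pmf)
  have "(pmf (map_pmf (\<lambda>s. (A s, B s, U s)) P) (a, b, u) / pmf (map_pmf U P) u =
     pmf (map_pmf (\<lambda>s. (A s, U s)) P) (a, u) / pmf (map_pmf U P) u *
     (pmf (map_pmf (\<lambda>s. (B s, U s)) P) (b, u) / pmf (map_pmf U P) u)) \<longleftrightarrow>
     pmf (map_pmf (\<lambda>s. (A s, B s, U s)) P) (a, b, u) * pmf (map_pmf U P) u =
     pmf (map_pmf (\<lambda>s. (A s, U s)) P) (a, u) * pmf (map_pmf (\<lambda>s. (B s, U s)) P) (b, u)" for a b u
    using zero[of u A a] by (cases "pmf (map_pmf U P) u = 0") (auto simp: field_simps)
  thus ?thesis unfolding markov_chain_def cond_indep_def cp cp2 by simp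
qed

text \<open>Serves to code an auxiliary variable of any type by natural numbers: an injective
  relabelling keeps the conditioning events.\<close>

lemma cond_indep_map_given:
  assumes fin: "finite (set_pmf P)" and ci: "cond_indep P A B C" and inj: "inj_on e (C ` set_pmf P)"
  shows "cond_indep P A B (\<lambda>s. e (C s))"
  unfolding cond_indep_def
proof (intro allI)
  fix a b c
  show "pmf (map_pmf (\<lambda>s. (A s, B s, e (C s))) P) (a, b, c) * pmf (map_pmf (\<lambda>s. e (C s)) P) c =
    pmf (map_pmf (\<lambda>s. (A s, e (C s))) P) (a, c) * pmf (map_pmf (\<lambda>s. (B s, e (C s))) P) (b, c)"
  proof (cases "c \<in> (\<lambda>s. e (C s)) ` set_pmf P")
    case True
    then obtain s where s: "s \<in> set_pmf P" "c = e (C s)" by auto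
    have *: "e (C t) = c \<longleftrightarrow> C t = C s" if "t \<in> set_pmf P" for t
      using inj that s by (auto simp: inj_on_def)
    have "pmf (map_pmf (\<lambda>s. (A s, B s, e (C s))) P) (a, b, c) = pmf (map_pmf (\<lambda>s. (A s, B s, C s)) P) (a, b, C s)"
      "pmf (map_pmf (\<lambda>s. e (C s)) P) c = pmf (map_pmf C P) (C s)"
      "pmf (map_pmf (\<lambda>s. (A s, e (C s))) P) (a, c) = pmf (map_pmf (\<lambda>s. (A s, C s)) P) (a, C s)"
      "pmf (map_pmf (\<lambda>s. (B s, e (C s))) P) (b, c) = pmf (map_pmf (\<lambda>s. (B s, C s)) P) (b, C s)"
      unfolding pmf_map_sum[OF fin] by (intro sum.cong; use * in auto)+
    thus ?thesis using ci unfolding cond_indep_def by simp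
  next
    case False
    hence "pmf (map_pmf (\<lambda>s. e (C s)) P) c = 0" "pmf (map_pmf (\<lambda>s. (A s, e (C s))) P) (a, c) = 0"
      by (auto simp: pmf_eq_0_set_pmf)
    thus ?thesis by simp
  qed
qed

lemma cond_indep_map_pmf:
  "cond_indep (map_pmf f P) A B C \<longleftrightarrow> cond_indep P (\<lambda>s. A (f s)) (\<lambda>s. B (f s)) (\<lambda>s. C (f s))"
  unfolding cond_indep_def by (simp add: map_pmf_comp)

text \<open>The counterpart of \<open>aux_cost\<close> for variables on an arbitrary space, with
  \<open>U\<close> of any type, so that block variables can be used without encoding them.\<close>

definition rv_cost ::
  "real \<Rightarrow> real \<Rightarrow> real \<Rightarrow> 'o pmf \<Rightarrow> ('o \<Rightarrow> 'a) \<Rightarrow> ('o \<Rightarrow> 'b) \<Rightarrow> ('o \<Rightarrow> 'u) \<Rightarrow> real" where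
  "rv_cost \<beta> \<gamma> \<theta> P X Y U = \<beta> * rv_mi P U (\<lambda>s. (X s, Y s)) + \<gamma> * rv_mi P U X + \<theta> * rv_mi P U Y"

lemma rv_cost_nonneg:
  assumes "finite (set_pmf P)" "\<beta> \<ge> 0" "\<gamma> \<ge> 0" "\<theta> \<ge> 0"
  shows "rv_cost \<beta> \<gamma> \<theta> P X Y U \<ge> 0"
  unfolding rv_cost_def using assms by (auto intro!: add_nonneg_nonneg mult_nonneg_nonneg rv_mi_nonneg)

lemma finite_set_auxiliaries:
  fixes J :: "('a::finite \<times> 'b::finite) pmf"
  assumes "V \<in> auxiliaries J"
  shows "finite (set_pmf V)"
proof (rule finite_subset)
  show "set_pmf V \<subseteq> UNIV \<times> set_pmf (map_pmf snd V)"
    by (intro subsetI) (auto simp: image_iff mem_Times_iff intro: bexI)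
  show "finite (UNIV \<times> set_pmf (map_pmf snd V) :: (('a \<times> 'b) \<times> nat) set)"
    using assms by (auto simp: auxiliaries_def)
qed

lemma auxiliaries_iff:
  fixes J :: "('a::finite \<times> 'b::finite) pmf"
  shows "V \<in> auxiliaries J \<longleftrightarrow> map_pmf fst V = J \<and> finite (set_pmf V) \<and>
    cond_indep V (\<lambda>s. fst (fst s)) (\<lambda>s. snd (fst s)) snd"
proof -
  have "V \<in> auxiliaries J \<longleftrightarrow> V \<in> auxiliaries J \<and> finite (set_pmf V)"
    using finite_set_auxiliaries by blast
  thus ?thesis
    by (auto simp: auxiliaries_def markov_chain_iff_cond_indep comp_def)
qed

lemma aux_cost_eq:
  fixes V :: "(('a::finite \<times> 'b::finite) \<times> nat) pmf"
  assumes "finite (set_pmf V)"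
  shows "aux_cost \<beta> \<gamma> \<theta> V = rv_cost \<beta> \<gamma> \<theta> V (\<lambda>s. fst (fst s)) (\<lambda>s. snd (fst s)) snd"
  unfolding aux_cost_def rv_cost_def using assms by (simp add: mutual_info_eq_rv_mi comp_def)

lemma auxiliaries_rv:
  fixes X :: "'o \<Rightarrow> 'a::finite" and Y :: "'o \<Rightarrow> 'b::finite"
  assumes fin: "finite (set_pmf P)" and ci: "cond_indep P X Y U" and inj: "inj_on e (U ` set_pmf P)"
  shows "map_pmf (\<lambda>s. ((X s, Y s), e (U s))) P \<in> auxiliaries (map_pmf (\<lambda>s. (X s, Y s)) P)"
    and "aux_cost \<beta> \<gamma> \<theta> (map_pmf (\<lambda>s. ((X s, Y s), e (U s))) P) = rv_cost \<beta> \<gamma> \<theta> P X Y U"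
proof -
  show "map_pmf (\<lambda>s. ((X s, Y s), e (U s))) P \<in> auxiliaries (map_pmf (\<lambda>s. (X s, Y s)) P)"
    unfolding auxiliaries_iff using cond_indep_map_given[OF fin ci inj] fin
    by (simp add: map_pmf_comp cond_indep_map_pmf)
  have *: "rv_mi P (\<lambda>s. e (U s)) A = rv_mi P U A" for A :: "'o \<Rightarrow> 'x"
    by (rule rv_mi_cong[OF fin]) (use inj in \<open>auto simp: inj_on_def\<close>)
  have "finite (set_pmf (map_pmf (\<lambda>s. ((X s, Y s), e (U s))) P))" using fin by simp
  from aux_cost_eq[OF this]
  show "aux_cost \<beta> \<gamma> \<theta> (map_pmf (\<lambda>s. ((X s, Y s), e (U s))) P) = rv_cost \<beta> \<gamma> \<theta> P X Y U"
    by (simp add: rv_cost_def rv_mi_map_pmf *)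
qed

lemma auxiliaries_nonempty:
  fixes J :: "('a::finite \<times> 'b::finite) pmf"
  shows "auxiliaries J \<noteq> {}"
proof -
  have fin: "finite (set_pmf J)" by simp
  \<comment> \<open>U = X always separates X from Y, so the infimum runs over a nonempty
    set.\<close>
  have "cond_indep J fst snd fst"
  proof (rule cond_indep_factor[OF fin, where f="\<lambda>a c. of_bool (a = c)"])
    fix a b c
    show "pmf (map_pmf (\<lambda>s. (fst s, snd s, fst s)) J) (a, b, c)
      = of_bool (a = c) * pmf (map_pmf (\<lambda>s. (snd s, fst s)) J) (b, c)"
      unfolding pmf_map_sum[OF fin]
    proof (cases "a = c")
      case False
      thus "(\<Sum>s | s \<in> set_pmf J \<and> (fst s, snd s, fst s) = (a, b, c). pmf J s)
        = of_bool (a = c) * (\<Sum>s | s \<in> set_pmf J \<and> (snd s, fst s) = (b, c). pmf J s)"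
        by (auto intro: sum.neutral)
    qed (auto intro!: sum.cong)
  qed
  moreover have "inj_on (to_nat :: 'a \<Rightarrow> nat) (fst ` set_pmf J)" by (simp add: inj_on_def)
  ultimately show ?thesis using auxiliaries_rv(1)[OF fin] by fastforce
qed

lemma bdd_below_aux_cost:
  fixes J :: "('a::finite \<times> 'b::finite) pmf"
  assumes "\<beta> \<ge> 0" "\<gamma> \<ge> 0" "\<theta> \<ge> 0"
  shows "bdd_below (aux_cost \<beta> \<gamma> \<theta> ` auxiliaries J)"
  using assms by (intro bdd_belowI2[of _ 0]) (auto simp: aux_cost_eq finite_set_auxiliaries intro!: rv_cost_nonneg)

text \<open>Any separating \<open>U\<close> on a finitely supported space is a competitor in the
  infimum, since its finitely many values can be numbered.\<close>

lemma info_functional_le: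
  fixes X :: "'o \<Rightarrow> 'a::finite" and Y :: "'o \<Rightarrow> 'b::finite"
  assumes fin: "finite (set_pmf P)" and ci: "cond_indep P X Y U"
    and nn: "\<beta> \<ge> 0" "\<gamma> \<ge> 0" "\<theta> \<ge> 0"
  shows "info_functional \<beta> \<gamma> \<theta> (map_pmf (\<lambda>s. (X s, Y s)) P) \<le> rv_mi P X Y + rv_cost \<beta> \<gamma> \<theta> P X Y U"
proof -
  let ?J = "map_pmf (\<lambda>s. (X s, Y s)) P"
  obtain e :: "_ \<Rightarrow> nat" where inj: "inj_on e (U ` set_pmf P)"
    using finite_imp_inj_to_nat_seg[of "U ` set_pmf P"] fin by auto
  have "(INF V\<in>auxiliaries ?J. aux_cost \<beta> \<gamma> \<theta> V) \<le> rv_cost \<beta> \<gamma> \<theta> P X Y U"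
    unfolding auxiliaries_rv(2)[OF fin ci inj, symmetric]
    by (rule cINF_lower[OF bdd_below_aux_cost[OF nn] auxiliaries_rv(1)[OF fin ci inj]])
  moreover have "mutual_info ?J fst snd = rv_mi P X Y"
    using fin by (simp add: mutual_info_eq_rv_mi rv_mi_map_pmf)
  ultimately show ?thesis unfolding info_functional_def by simp
qed

subsection \<open>Sequential compactness of finitely supported distributions\<close>

lemma finite_family_convergent_subsequence:
  fixes f :: "nat \<Rightarrow> 'i \<Rightarrow> real"
  assumes "finite F" "\<And>m i. i \<in> F \<Longrightarrow> \<bar>f m i\<bar> \<le> 1"
  shows "\<exists>r l. strict_mono (r :: nat \<Rightarrow> nat) \<and> (\<forall>i\<in>F. (\<lambda>m. f (r m) i) \<longlonglongrightarrow> l i)"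
  using assms
proof (induction F)
  case empty
  show ?case by (auto intro: exI[of _ id] simp: strict_mono_id)
next
  case (insert i F)
  have "\<exists>r l. strict_mono (r :: nat \<Rightarrow> nat) \<and> (\<forall>j\<in>F. (\<lambda>m. f (r m) j) \<longlonglongrightarrow> l j)"
    by (rule insert.IH) (use insert.prems in blast)
  then obtain r l where r: "strict_mono (r :: nat \<Rightarrow> nat)" "\<forall>j\<in>F. (\<lambda>m. f (r m) j) \<longlonglongrightarrow> l j"
    by blast
  have "bounded (range (\<lambda>m. f (r m) i))"
    using insert.prems by (intro boundedI[of _ 1]) auto
  then obtain a r' where r': "strict_mono (r' :: nat \<Rightarrow> nat)" "(\<lambda>m. f (r (r' m)) i) \<longlonglongrightarrow> a"
    using bounded_imp_convergent_subsequence unfolding comp_def by blast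
  have "(\<lambda>m. f (r (r' m)) j) \<longlonglongrightarrow> l j" if "j \<in> F" for j
    using LIMSEQ_subseq_LIMSEQ[OF bspec[OF r(2) that] r'(1)] by (simp add: comp_def)
  moreover have "strict_mono (\<lambda>m. r (r' m))"
    using strict_mono_o[OF r(1) r'(1)] by (simp add: comp_def)
  ultimately show ?case using r'(2) insert.hyps
    by (intro exI[of _ "\<lambda>m. r (r' m)"] exI[of _ "l(i := a)"]) auto
qed

lemma ex_pmf_eq:
  assumes S: "finite S" "\<And>x. x \<notin> S \<Longrightarrow> f x = 0" and nn: "\<And>x. f x \<ge> 0" and one: "(\<Sum>x\<in>S. f x) = 1"
  shows "\<exists>p. \<forall>x. pmf p x = f x"
proof -
  have "(\<integral>\<^sup>+x. ennreal (f x) \<partial>count_space UNIV) = (\<Sum>x\<in>S. ennreal (f x))"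
    by (rule nn_integral_count_space'[OF S(1)]) (use S in auto)
  also have "\<dots> = 1" using nn one by (simp add: sum_ennreal)
  finally show ?thesis using nn pmf_embed_pmf[of f] by blast
qed

text \<open>The common finite set \<open>S\<close> is part of the notion so that entropies and image
  laws pass to the limit as finite sums over \<open>S\<close>.\<close>

definition pmf_tendsto :: "'a set \<Rightarrow> (nat \<Rightarrow> 'a pmf) \<Rightarrow> 'a pmf \<Rightarrow> bool" where
  "pmf_tendsto S P Q \<longleftrightarrow> finite S \<and> (\<forall>m. set_pmf (P m) \<subseteq> S) \<and> set_pmf Q \<subseteq> S \<and>
     (\<forall>x. (\<lambda>m. pmf (P m) x) \<longlonglongrightarrow> pmf Q x)"

lemma pmf_convergent_subsequence:
  assumes S: "finite S" "\<And>m. set_pmf (P m) \<subseteq> S"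
  shows "\<exists>r Q. strict_mono (r :: nat \<Rightarrow> nat) \<and> pmf_tendsto S (\<lambda>m. P (r m)) Q"
proof -
  have "\<bar>pmf (P m) x\<bar> \<le> 1" for m x by (simp add: pmf_le_1)
  then obtain r l where r: "strict_mono (r :: nat \<Rightarrow> nat)" "\<forall>x\<in>S. (\<lambda>m. pmf (P (r m)) x) \<longlonglongrightarrow> l x"
    using finite_family_convergent_subsequence[OF S(1), of "\<lambda>m. pmf (P m)"] by blast
  define f where "f = (\<lambda>x. if x \<in> S then l x else 0)"
  have f: "(\<lambda>m. pmf (P (r m)) x) \<longlonglongrightarrow> f x" for x
  proof (cases "x \<in> S")
    case False
    hence "pmf (P (r m)) x = 0" for m using S by (auto simp: pmf_eq_0_set_pmf)
    thus ?thesis using False by (simp add: f_def)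
  qed (use r in \<open>auto simp: f_def\<close>)
  have "f x \<ge> 0" for x
    using f[of x] by (rule LIMSEQ_le_const) auto
  moreover have "(\<lambda>m. \<Sum>x\<in>S. pmf (P (r m)) x) \<longlonglongrightarrow> (\<Sum>x\<in>S. f x)"
    by (intro tendsto_sum f)
  hence "(\<Sum>x\<in>S. f x) = 1"
    using S by (simp add: sum_pmf_eq_1 LIMSEQ_const_iff)
  ultimately obtain Q where Q: "\<And>x. pmf Q x = f x"
    using ex_pmf_eq[OF S(1), of f] by (auto simp: f_def)
  have "set_pmf Q \<subseteq> S" by (auto simp: set_pmf_iff Q f_def split: if_splits)
  thus ?thesis using r(1) S f unfolding pmf_tendsto_def by (intro exI[of _ r] exI[of _ Q]) (auto simp: Q)
qed

lemma pmf_map_sum_superset: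
  assumes "finite S" "set_pmf P \<subseteq> S"
  shows "pmf (map_pmf A P) a = (\<Sum>s | s \<in> S \<and> A s = a. pmf P s)"
  unfolding pmf_map_sum[OF finite_subset[OF assms(2,1)]]
  by (rule sum.mono_neutral_left) (use assms in \<open>auto simp: pmf_eq_0_set_pmf\<close>)

lemma pmf_tendsto_map:
  assumes "pmf_tendsto S P Q"
  shows "pmf_tendsto (A ` S) (\<lambda>m. map_pmf A (P m)) (map_pmf A Q)"
proof -
  have "(\<lambda>m. pmf (map_pmf A (P m)) a) \<longlonglongrightarrow> pmf (map_pmf A Q) a" for a
    using assms unfolding pmf_tendsto_def
    by (simp add: pmf_map_sum_superset[of S] tendsto_sum)
  thus ?thesis using assms unfolding pmf_tendsto_def by auto
qed

text \<open>At 0 the logarithm is unbounded; there ln (1 / sqrt x) \<le> 1 / sqrt x - 1 gives |x log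
  x| \<le> (2 / ln 2) sqrt x on [0, 1].\<close>

lemma tendsto_xlogx:
  fixes a :: real
  assumes "f \<longlonglongrightarrow> a" "\<And>m. f m \<ge> 0"
  shows "(\<lambda>m. f m * log 2 (f m)) \<longlonglongrightarrow> a * log 2 a"
proof (cases "a = 0")
  case False
  hence "a > 0" using LIMSEQ_le_const[OF assms(1), of 0] assms(2) by fastforce
  thus ?thesis by (intro tendsto_intros assms(1)) auto
next
  case True
  have bound: "\<bar>x * log 2 x\<bar> \<le> 2 / ln 2 * sqrt x" if "0 \<le> x" "x \<le> 1" for x :: real
  proof (cases "x = 0")
    case False
    hence x: "x > 0" using that by simp
    have "- ln x = 2 * ln (1 / sqrt x)"
      using x by (simp add: ln_div ln_sqrt)
    also have "\<dots> \<le> 2 * (1 / sqrt x - 1)"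
      using x by (intro mult_left_mono ln_le_minus_one) auto
    also have "\<dots> \<le> 2 * (1 / sqrt x)" by simp
    finally have "x * (- ln x) \<le> x * (2 * (1 / sqrt x))"
      using x by (intro mult_left_mono) auto
    also have "\<dots> = 2 * sqrt x" using x by (simp add: field_simps)
    finally have "x * (- ln x) / ln 2 \<le> 2 * sqrt x / ln 2" by (intro divide_right_mono) auto
    moreover have "x * log 2 x \<le> 0" using x that by (simp add: mult_le_0_iff)
    ultimately show ?thesis by (simp add: log_def)
  qed auto
  have "(\<lambda>m. 2 / ln 2 * sqrt (f m)) \<longlonglongrightarrow> 2 / ln 2 * sqrt 0"
    using assms(1) True by (intro tendsto_intros) auto
  hence lim: "(\<lambda>m. 2 / ln 2 * sqrt (f m)) \<longlonglongrightarrow> 0" by simp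
  have "eventually (\<lambda>m. f m < 1) sequentially"
    using assms(1) True by (intro order_tendstoD) auto
  hence "eventually (\<lambda>m. norm (f m * log 2 (f m)) \<le> 2 / ln 2 * sqrt (f m)) sequentially"
    by eventually_elim (use bound assms(2) in auto)
  from Lim_null_comparison[OF this lim] show ?thesis using True by simp
qed

lemma ent_tendsto:
  assumes "pmf_tendsto S P Q"
  shows "(\<lambda>m. ent (P m)) \<longlonglongrightarrow> ent Q"
proof -
  have "(\<lambda>m. \<Sum>x\<in>S. - (pmf (P m) x * log 2 (pmf (P m) x))) \<longlonglongrightarrow> (\<Sum>x\<in>S. - (pmf Q x * log 2 (pmf Q x)))"
    using assms unfolding pmf_tendsto_def by (intro tendsto_sum tendsto_minus tendsto_xlogx) auto
  thus ?thesis using assms unfolding pmf_tendsto_def by (simp add: ent_superset[of S])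
qed

lemma rv_mi_tendsto:
  assumes "pmf_tendsto S P Q"
  shows "(\<lambda>m. rv_mi (P m) A B) \<longlonglongrightarrow> rv_mi Q A B"
  unfolding rv_mi_def rv_ent_def by (intro tendsto_intros ent_tendsto[OF pmf_tendsto_map[OF assms]])

lemma rv_cost_tendsto:
  assumes "pmf_tendsto S P Q"
  shows "(\<lambda>m. rv_cost \<beta> \<gamma> \<theta> (P m) X Y U) \<longlonglongrightarrow> rv_cost \<beta> \<gamma> \<theta> Q X Y U"
  unfolding rv_cost_def by (intro tendsto_intros rv_mi_tendsto[OF assms])

lemma cond_indep_tendsto:
  assumes lim: "pmf_tendsto S P Q" and "\<And>m. cond_indep (P m) A B C"
  shows "cond_indep Q A B C"
  unfolding cond_indep_def
proof (intro allI)
  fix a b c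
  have l: "(\<lambda>m. pmf (map_pmf F (P m)) x) \<longlonglongrightarrow> pmf (map_pmf F Q) x" for F :: "_ \<Rightarrow> 'f" and x
    using pmf_tendsto_map[OF lim, of F] unfolding pmf_tendsto_def by blast
  have "(\<lambda>m. pmf (map_pmf (\<lambda>s. (A s, B s, C s)) (P m)) (a, b, c) * pmf (map_pmf C (P m)) c)
     \<longlonglongrightarrow> pmf (map_pmf (\<lambda>s. (A s, B s, C s)) Q) (a, b, c) * pmf (map_pmf C Q) c"
    by (intro tendsto_mult l)
  moreover have "(\<lambda>m. pmf (map_pmf (\<lambda>s. (A s, C s)) (P m)) (a, c) * pmf (map_pmf (\<lambda>s. (B s, C s)) (P m)) (b, c))
     \<longlonglongrightarrow> pmf (map_pmf (\<lambda>s. (A s, C s)) Q) (a, c) * pmf (map_pmf (\<lambda>s. (B s, C s)) Q) (b, c)"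
    by (intro tendsto_mult l)
  ultimately show "pmf (map_pmf (\<lambda>s. (A s, B s, C s)) Q) (a, b, c) * pmf (map_pmf C Q) c =
    pmf (map_pmf (\<lambda>s. (A s, C s)) Q) (a, c) * pmf (map_pmf (\<lambda>s. (B s, C s)) Q) (b, c)"
    using assms(2) unfolding cond_indep_def by (auto intro: LIMSEQ_unique)
qed

subsection \<open>Attainment of the minimum\<close>

text \<open>The family is indexed, so repeated vectors count as dependent; they are settled by the
  coefficients 1 and -1.\<close>

lemma finite_family_dependent:
  fixes v :: "'u \<Rightarrow> real ^ 'n"
  assumes fin: "finite S" and card: "card S > CARD('n)"
  shows "\<exists>c. (\<exists>u\<in>S. c u \<noteq> 0) \<and> (\<Sum>u\<in>S. c u *\<^sub>R v u) = 0"
proof (cases "inj_on v S")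
  case True
  have "dependent (v ` S)"
    by (rule dependent_biggerset) (use card card_image[OF True] in simp)
  then obtain d where d: "\<exists>x\<in>v ` S. d x \<noteq> 0" "(\<Sum>x\<in>v ` S. d x *\<^sub>R x) = 0"
    using fin by (auto simp: dependent_finite)
  show ?thesis
    using d sum.reindex[OF True, of "\<lambda>x. d x *\<^sub>R x"] by (intro exI[of _ "\<lambda>u. d (v u)"]) auto
next
  case False
  then obtain a b where ab: "a \<in> S" "b \<in> S" "a \<noteq> b" "v a = v b" by (auto simp: inj_on_def)
  let ?c = "\<lambda>u. if u = a then 1 else if u = b then - 1 else 0 :: real"
  have "(\<Sum>u\<in>S. ?c u *\<^sub>R v u) = (\<Sum>u\<in>{a, b}. ?c u *\<^sub>R v u)"
    using ab fin by (intro sum.mono_neutral_right) auto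
  also have "\<dots> = 0" using ab by simp
  finally show ?thesis using ab(1) by (intro exI[of _ ?c]) auto
qed

lemma pmf_map_fst_eq_sum:
  assumes T: "finite T" "snd ` set_pmf V \<subseteq> T" and fin: "finite (set_pmf V)"
  shows "pmf (map_pmf fst V) z = (\<Sum>u\<in>T. pmf V (z, u))"
proof -
  have "pmf (map_pmf fst V) z = (\<Sum>s | s \<in> set_pmf V \<and> fst s = z. pmf V s)"
    by (rule pmf_map_sum[OF fin])
  also have "\<dots> = (\<Sum>s\<in>Pair z ` T. pmf V s)"
    by (rule sum.mono_neutral_left) (use T in \<open>force simp: pmf_eq_0_set_pmf\<close>)+
  also have "\<dots> = (\<Sum>u\<in>T. pmf V (z, u))"
    by (subst sum.reindex) (auto simp: inj_on_def)
  finally show ?thesis .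
qed

section \<open>Reweighting the values of the auxiliary variable\<close>

lemma pmf_map_reweighted:
  assumes fin: "finite (set_pmf V)" and m: "\<And>s. pmf V' s = m (snd s) * pmf V s"
    and G: "\<And>s. G s = y \<Longrightarrow> snd s = u"
  shows "pmf (map_pmf G V') y = m u * pmf (map_pmf G V) y"
proof -
  have "set_pmf V' \<subseteq> set_pmf V" by (auto simp: set_pmf_iff m)
  hence "pmf (map_pmf G V') y = (\<Sum>s | s \<in> set_pmf V \<and> G s = y. pmf V' s)"
    by (rule pmf_map_sum_superset[OF fin])
  also have "\<dots> = (\<Sum>s | s \<in> set_pmf V \<and> G s = y. m u * pmf V s)"
    by (rule sum.cong) (simp_all add: m G)
  also have "\<dots> = m u * pmf (map_pmf G V) y"
    by (simp add: sum_distrib_left pmf_map_sum[OF fin])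
  finally show ?thesis .
qed

text \<open>H(A|U) is linear in the weights \<open>m\<close>: reweighting by a function of
  \<open>U\<close> multiplies numerator and denominator of P(u, a) / P(u) alike, so the logarithms
  remain those of \<open>V\<close>.\<close>

lemma rv_ent_reweighted:
  assumes fin: "finite (set_pmf V)" and m: "\<And>s. pmf V' s = m (snd s) * pmf V s"
  shows "rv_ent V' (\<lambda>s. (snd s, A (fst s))) - rv_ent V' snd =
    (\<Sum>s\<in>set_pmf V. m (snd s) * (pmf V s * (log 2 (pmf (map_pmf snd V) (snd s))
      - log 2 (pmf (map_pmf (\<lambda>s. (snd s, A (fst s))) V) (snd s, A (fst s))))))"
proof -
  let ?G = "\<lambda>s. (snd s, A (fst s))"
  have sub: "set_pmf V' \<subseteq> set_pmf V" by (auto simp: set_pmf_iff m)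
  have fin': "finite (set_pmf V')" by (rule finite_subset[OF sub fin])
  have "rv_ent V' ?G - rv_ent V' snd = (\<Sum>s\<in>set_pmf V'. m (snd s) * (pmf V s *
      (log 2 (pmf (map_pmf snd V) (snd s)) - log 2 (pmf (map_pmf ?G V) (?G s)))))"
    unfolding rv_ent_expand[OF fin'] sum_subtractf[symmetric]
  proof (intro sum.cong refl)
    fix s assume s: "s \<in> set_pmf V'"
    hence "pmf V' s > 0" by (rule pmf_positive)
    hence m0: "m (snd s) > 0" unfolding m by (simp add: zero_less_mult_iff)
    have s': "s \<in> set_pmf V" using s sub by auto
    have 1: "pmf (map_pmf snd V') (snd s) = m (snd s) * pmf (map_pmf snd V) (snd s)"
      by (rule pmf_map_reweighted[OF fin m]) auto
    have 2: "pmf (map_pmf ?G V') (?G s) = m (snd s) * pmf (map_pmf ?G V) (?G s)"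
      by (rule pmf_map_reweighted[OF fin m]) auto
    show "pmf V' s * - log 2 (pmf (map_pmf ?G V') (?G s)) - pmf V' s * - log 2 (pmf (map_pmf snd V') (snd s)) =
      m (snd s) * (pmf V s * (log 2 (pmf (map_pmf snd V) (snd s)) - log 2 (pmf (map_pmf ?G V) (?G s))))"
      unfolding 1 2 m using m0 pmf_map_pos[OF s', of snd] pmf_map_pos[OF s', of ?G]
      by (simp add: log_mult_pos algebra_simps)
  qed
  also have "\<dots> = (\<Sum>s\<in>set_pmf V. m (snd s) * (pmf V s *
      (log 2 (pmf (map_pmf snd V) (snd s)) - log 2 (pmf (map_pmf ?G V) (?G s)))))"
    by (rule sum.mono_neutral_left) (use fin sub m in \<open>auto simp: set_pmf_iff\<close>)
  finally show ?thesis .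
qed

text \<open>The unconditional entropies are fixed by the joint law and form \<open>C\<close>; the
  conditional ones are linear in \<open>m\<close> with coefficients \<open>h\<close>. Both are
  chosen before \<open>V'\<close> and \<open>m\<close>, as one affine function must serve
  \<open>V\<close> and its modification.\<close>

lemma aux_cost_reweighted:
  fixes V :: "(('a::finite \<times> 'b::finite) \<times> nat) pmf"
  assumes fin: "finite (set_pmf V)"
  shows "\<exists>C h. \<forall>V' m. (\<forall>s. pmf V' s = m (snd s) * pmf V s) \<longrightarrow> map_pmf fst V' = map_pmf fst V \<longrightarrow>
    aux_cost \<beta> \<gamma> \<theta> V' = C - (\<Sum>s\<in>set_pmf V. m (snd s) * h s)"
proof -
  have mi: "rv_mi V' snd (\<lambda>s. A (fst s))
      = ent (map_pmf A (map_pmf fst V)) - (\<Sum>s\<in>set_pmf V. m (snd s) * (pmf V s * (log 2 (pmf (map_pmf snd V) (snd s))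
      - log 2 (pmf (map_pmf (\<lambda>s. (snd s, A (fst s))) V) (snd s, A (fst s))))))"
    if "\<forall>s. pmf V' s = m (snd s) * pmf V s" "map_pmf fst V' = map_pmf fst V"
    for V' m and A :: "'a \<times> 'b \<Rightarrow> 'c"
  proof -
    have "rv_ent V' (\<lambda>s. A (fst s)) = ent (map_pmf A (map_pmf fst V))"
      unfolding that(2)[symmetric] by (simp add: rv_ent_def map_pmf_comp)
    thus ?thesis using rv_ent_reweighted[OF fin, of V' m A] that(1) unfolding rv_mi_def by simp
  qed
  define h where "h = (\<lambda>s. pmf V s * (
      \<beta> * (log 2 (pmf (map_pmf snd V) (snd s)) - log 2 (pmf (map_pmf (\<lambda>s. (snd s, fst s)) V) (snd s, fst s)))
    + \<gamma> * (log 2 (pmf (map_pmf snd V) (snd s)) - log 2 (pmf (map_pmf (\<lambda>s. (snd s, fst (fst s))) V) (snd s, fst (fst s))))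
    + \<theta> * (log 2 (pmf (map_pmf snd V) (snd s)) - log 2 (pmf (map_pmf (\<lambda>s. (snd s, snd (fst s))) V) (snd s, snd (fst s))))))"
  define C where "C = \<beta> * ent (map_pmf fst V) + \<gamma> * ent (map_pmf fst (map_pmf fst V))
    + \<theta> * ent (map_pmf snd (map_pmf fst V))"
  have "aux_cost \<beta> \<gamma> \<theta> V' = C - (\<Sum>s\<in>set_pmf V. m (snd s) * h s)"
    if a: "\<forall>s. pmf V' s = m (snd s) * pmf V s" "map_pmf fst V' = map_pmf fst V" for V' m
  proof -
    have "set_pmf V' \<subseteq> set_pmf V" using a by (auto simp: set_pmf_iff)
    hence fin': "finite (set_pmf V')" using fin finite_subset by blast
    define S1 where "S1 = (\<Sum>s\<in>set_pmf V. m (snd s) * (pmf V s * (log 2 (pmf (map_pmf snd V) (snd s))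
      - log 2 (pmf (map_pmf (\<lambda>s. (snd s, fst s)) V) (snd s, fst s)))))"
    define S2 where "S2 = (\<Sum>s\<in>set_pmf V. m (snd s) * (pmf V s * (log 2 (pmf (map_pmf snd V) (snd s))
      - log 2 (pmf (map_pmf (\<lambda>s. (snd s, fst (fst s))) V) (snd s, fst (fst s))))))"
    define S3 where "S3 = (\<Sum>s\<in>set_pmf V. m (snd s) * (pmf V s * (log 2 (pmf (map_pmf snd V) (snd s))
      - log 2 (pmf (map_pmf (\<lambda>s. (snd s, snd (fst s))) V) (snd s, snd (fst s))))))"
    have "(\<Sum>s\<in>set_pmf V. m (snd s) * h s) = \<beta> * S1 + \<gamma> * S2 + \<theta> * S3"
      unfolding sum_distrib_left sum.distrib[symmetric] h_def S1_def S2_def S3_def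
      by (intro sum.cong refl) (simp only: algebra_simps)
    moreover have "rv_mi V' snd fst = ent (map_pmf fst V) - S1"
      using mi[OF a, of "\<lambda>x. x"] unfolding S1_def map_pmf_ident .
    moreover have "rv_mi V' snd (\<lambda>s. fst (fst s)) = ent (map_pmf fst (map_pmf fst V)) - S2"
      using mi[OF a, of fst] unfolding S2_def .
    moreover have "rv_mi V' snd (\<lambda>s. snd (fst s)) = ent (map_pmf snd (map_pmf fst V)) - S3"
      using mi[OF a, of snd] unfolding S3_def .
    ultimately show ?thesis
      by (simp add: aux_cost_eq[OF fin'] rv_cost_def C_def right_diff_distrib)
  qed
  thus ?thesis by blast
qed

text \<open>
  For a fixed pair of conditional laws given \<open>U\<close>, the cost is affine in the weights of the values
  of \<open>U\<close>, and the constraint on the joint law of \<open>(X, Y)\<close> is linear in them. More than \<open>|X||Y|\<close>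
  values therefore leave a direction along which the weights can move until one of them vanishes.
\<close>

lemma auxiliaries_drop_value:
  fixes J :: "('a::finite \<times> 'b::finite) pmf"
  assumes V: "V \<in> auxiliaries J" and card: "card (snd ` set_pmf V) > CARD('a) * CARD('b)"
  shows "\<exists>V'\<in>auxiliaries J. aux_cost \<beta> \<gamma> \<theta> V' \<le> aux_cost \<beta> \<gamma> \<theta> V \<and> snd ` set_pmf V' \<subset> snd ` set_pmf V"
proof -
  let ?S = "snd ` set_pmf V"
  have fin: "finite (set_pmf V)" and J: "map_pmf fst V = J"
    and ci: "cond_indep V (\<lambda>s. fst (fst s)) (\<lambda>s. snd (fst s)) snd"
    using V by (auto simp: auxiliaries_iff)
  obtain c where c: "\<exists>u\<in>?S. c u \<noteq> 0" "(\<Sum>u\<in>?S. c u *\<^sub>R (\<chi> z. pmf V (z, u))) = (0 :: real ^ ('a \<times> 'b))"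
    using finite_family_dependent[of ?S "\<lambda>u. \<chi> z. pmf V (z, u)"] fin card by auto
  have c0: "(\<Sum>u\<in>?S. c u * pmf V (z, u)) = 0" for z
    using arg_cong[OF c(2), of "\<lambda>w. w $ z"] by simp
  from aux_cost_reweighted[OF fin, of \<beta> \<gamma> \<theta>] obtain C h where
    "\<forall>V' m. (\<forall>s. pmf V' s = m (snd s) * pmf V s) \<longrightarrow> map_pmf fst V' = map_pmf fst V \<longrightarrow>
      aux_cost \<beta> \<gamma> \<theta> V' = C - (\<Sum>s\<in>set_pmf V. m (snd s) * h s)"
    by (elim exE)
  note Ch = this[rule_format]
  \<comment> \<open>A dependency may be negated, so its sign can be chosen to make the cost
    non-increasing in the direction \<open>d\<close>.\<close>
  define \<sigma> :: real where "\<sigma> = (if (\<Sum>s\<in>set_pmf V. c (snd s) * h s) \<ge> 0 then 1 else - 1)"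
  define d where "d u = \<sigma> * c u" for u
  have d0: "(\<Sum>u\<in>?S. d u * pmf V (z, u)) = 0" for z
    using c0[of z] by (simp add: d_def mult.assoc sum_distrib_left[symmetric])
  have dh: "(\<Sum>s\<in>set_pmf V. d (snd s) * h s) \<ge> 0"
    by (simp add: d_def mult.assoc sum_distrib_left[symmetric] \<sigma>_def)
  \<comment> \<open>1 / M is the largest step for which all weights 1 + d u / M stay non-negative;
    the weight at a maximiser \<open>u0\<close> is then 0.\<close>
  define M where "M = Max ((\<lambda>u. - d u) ` ?S)"
  have finS: "finite ?S" using fin by simp
  have neS: "?S \<noteq> {}" using set_pmf_not_empty by fastforce
  have M_ge: "- d u \<le> M" if "u \<in> ?S" for u
    unfolding M_def using that finS by (intro Max_ge) auto
  have "M \<in> (\<lambda>u. - d u) ` ?S"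
    unfolding M_def by (rule Max_in) (use finS neS in blast)+
  then obtain u0 where u0: "u0 \<in> ?S" "- d u0 = M" by blast
  have "M > 0"
  proof (rule ccontr)
    assume "\<not> M > 0"
    hence nn: "d u \<ge> 0" if "u \<in> ?S" for u using M_ge[OF that] by linarith
    obtain u where u: "u \<in> ?S" "c u \<noteq> 0" using c(1) by blast
    then obtain s where "s \<in> set_pmf V" "u = snd s" by blast
    then obtain z where z: "(z, u) \<in> set_pmf V" by (cases s) simp
    \<comment> \<open>With a non-negative \<open>d\<close> a vanishing sum has non-negative terms,
      so each is 0; this contradicts c u \<noteq> 0 at a value \<open>u\<close> of positive
      probability.\<close>
    have "d u * pmf V (z, u) = 0"
      using d0[of z] nn u(1) by (subst (asm) sum_nonneg_eq_0_iff[OF finS]) auto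
    thus False using u(2) z by (simp add: pmf_eq_0_set_pmf d_def \<sigma>_def split: if_splits)
  qed
  define m where "m u = 1 + d u / M" for u
  have m_nn: "m u \<ge> 0" if "u \<in> ?S" for u
    using M_ge[OF that] \<open>M > 0\<close> by (simp add: m_def field_simps)
  have marg: "(\<Sum>u\<in>?S. m u * pmf V (z, u)) = pmf J z" for z
  proof -
    have "(\<Sum>u\<in>?S. m u * pmf V (z, u)) = (\<Sum>u\<in>?S. pmf V (z, u)) + (\<Sum>u\<in>?S. d u * pmf V (z, u)) / M"
      by (simp add: m_def sum.distrib algebra_simps sum_divide_distrib)
    thus ?thesis using d0[of z] pmf_map_fst_eq_sum[OF finS subset_refl fin, of z] J by simp
  qed
  have "\<exists>V'. \<forall>s. pmf V' s = m (snd s) * pmf V s"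
  proof (rule ex_pmf_eq[of "UNIV \<times> ?S"])
    show "finite (UNIV \<times> ?S :: (('a \<times> 'b) \<times> nat) set)" using finS by simp
    show "m (snd s) * pmf V s = 0" if "s \<notin> UNIV \<times> ?S" for s
      using that by (auto simp: pmf_eq_0_set_pmf mem_Times_iff)
    show "0 \<le> m (snd s) * pmf V s" for s
      using m_nn[of "snd s"] by (cases "s \<in> set_pmf V") (auto simp: set_pmf_iff)
    have "(\<Sum>s\<in>UNIV \<times> ?S. m (snd s) * pmf V s) = (\<Sum>z\<in>UNIV. \<Sum>u\<in>?S. m u * pmf V (z, u))"
      by (simp add: sum.cartesian_product case_prod_unfold)
    thus "(\<Sum>s\<in>UNIV \<times> ?S. m (snd s) * pmf V s) = 1"
      by (simp add: marg sum_pmf_eq_1)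
  qed
  then obtain V' where V': "\<And>s. pmf V' s = m (snd s) * pmf V s" by blast
  have sub: "set_pmf V' \<subseteq> set_pmf V" by (auto simp: set_pmf_iff V')
  have fin': "finite (set_pmf V')" by (rule finite_subset[OF sub fin])
  have J': "map_pmf fst V' = J"
  proof (rule pmf_eqI)
    fix z
    have "pmf (map_pmf fst V') z = (\<Sum>u\<in>?S. pmf V' (z, u))"
      by (rule pmf_map_fst_eq_sum[OF finS _ fin']) (use sub in auto)
    thus "pmf (map_pmf fst V') z = pmf J z" by (simp add: V' marg)
  qed
  have "cond_indep V' (\<lambda>s. fst (fst s)) (\<lambda>s. snd (fst s)) snd"
    unfolding cond_indep_def
  proof (intro allI)
    fix a b u
    have eqs: "pmf (map_pmf (\<lambda>s. (fst (fst s), snd (fst s), snd s)) V') (a, b, u) = m u * pmf (map_pmf (\<lambda>s. (fst (fst s), snd (fst s), snd s)) V) (a, b, u)"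
      "pmf (map_pmf snd V') u = m u * pmf (map_pmf snd V) u"
      "pmf (map_pmf (\<lambda>s. (fst (fst s), snd s)) V') (a, u) = m u * pmf (map_pmf (\<lambda>s. (fst (fst s), snd s)) V) (a, u)"
      "pmf (map_pmf (\<lambda>s. (snd (fst s), snd s)) V') (b, u) = m u * pmf (map_pmf (\<lambda>s. (snd (fst s), snd s)) V) (b, u)"
      by (rule pmf_map_reweighted[OF fin V']; simp)+
    show "pmf (map_pmf (\<lambda>s. (fst (fst s), snd (fst s), snd s)) V') (a, b, u) * pmf (map_pmf snd V') u =
      pmf (map_pmf (\<lambda>s. (fst (fst s), snd s)) V') (a, u) * pmf (map_pmf (\<lambda>s. (snd (fst s), snd s)) V') (b, u)"
      unfolding eqs using ci[unfolded cond_indep_def, rule_format, of a b u]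
      by (simp add: mult.assoc mult.left_commute)
  qed
  hence aux: "V' \<in> auxiliaries J" using fin' J' by (simp add: auxiliaries_iff)
  have "aux_cost \<beta> \<gamma> \<theta> V' = C - (\<Sum>s\<in>set_pmf V. m (snd s) * h s)"
    by (rule Ch[OF V']) (use J J' in simp)
  also have "\<dots> = C - (\<Sum>s\<in>set_pmf V. 1 * h s) - (\<Sum>s\<in>set_pmf V. d (snd s) * h s) / M"
    by (simp add: m_def sum.distrib algebra_simps sum_divide_distrib)
  also have "C - (\<Sum>s\<in>set_pmf V. 1 * h s) = aux_cost \<beta> \<gamma> \<theta> V"
    using Ch[of V "\<lambda>_. 1"] by simp
  finally have cost: "aux_cost \<beta> \<gamma> \<theta> V' \<le> aux_cost \<beta> \<gamma> \<theta> V"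
    using dh \<open>M > 0\<close> by simp
  have "m u0 = 0" using u0(2) \<open>M > 0\<close> by (simp add: m_def field_simps)
  hence "u0 \<notin> snd ` set_pmf V'" by (auto simp: set_pmf_iff V')
  hence "snd ` set_pmf V' \<subset> ?S" using sub u0(1) by blast
  thus ?thesis using aux cost by blast
qed

lemma auxiliaries_reduce_card:
  fixes J :: "('a::finite \<times> 'b::finite) pmf"
  assumes "V \<in> auxiliaries J"
  shows "\<exists>V'\<in>auxiliaries J. aux_cost \<beta> \<gamma> \<theta> V' \<le> aux_cost \<beta> \<gamma> \<theta> V \<and>
    card (snd ` set_pmf V') \<le> CARD('a) * CARD('b)"
  using assms
proof (induction "card (snd ` set_pmf V)" arbitrary: V rule: less_induct)
  case less
  show ?case
  proof (cases "card (snd ` set_pmf V) \<le> CARD('a) * CARD('b)")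
    case False
    hence "card (snd ` set_pmf V) > CARD('a) * CARD('b)" by simp
    from auxiliaries_drop_value[OF less.prems this, of \<beta> \<gamma> \<theta>]
    obtain V' where V': "V' \<in> auxiliaries J" "aux_cost \<beta> \<gamma> \<theta> V' \<le> aux_cost \<beta> \<gamma> \<theta> V"
      "snd ` set_pmf V' \<subset> snd ` set_pmf V"
      by blast
    have "card (snd ` set_pmf V') < card (snd ` set_pmf V)"
      using V'(3) finite_set_auxiliaries[OF less.prems] by (intro psubset_card_mono) auto
    from less.hyps[OF this V'(1)] show ?thesis using V'(2) order_trans by blast
  qed (use less.prems in blast)
qed

text \<open>Renumbering puts all reduced variables on one fixed alphabet, so that a sequence of them
  lives on a common finite set and has a convergent subsequence.\<close>

lemma auxiliaries_reduce:
  fixes J :: "('a::finite \<times> 'b::finite) pmf"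
  assumes "V \<in> auxiliaries J"
  shows "\<exists>V'\<in>auxiliaries J. aux_cost \<beta> \<gamma> \<theta> V' \<le> aux_cost \<beta> \<gamma> \<theta> V \<and>
    snd ` set_pmf V' \<subseteq> {..<CARD('a) * CARD('b)}"
proof -
  obtain V' where V': "V' \<in> auxiliaries J" "aux_cost \<beta> \<gamma> \<theta> V' \<le> aux_cost \<beta> \<gamma> \<theta> V"
    "card (snd ` set_pmf V') \<le> CARD('a) * CARD('b)"
    using auxiliaries_reduce_card[OF assms] by blast
  have fin: "finite (set_pmf V')" and J: "map_pmf fst V' = J"
    and ci: "cond_indep V' (\<lambda>s. fst (fst s)) (\<lambda>s. snd (fst s)) snd"
    using V'(1) by (auto simp: auxiliaries_iff)
  obtain e :: "nat \<Rightarrow> nat" where e: "bij_betw e (snd ` set_pmf V') {0..<card (snd ` set_pmf V')}"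
    using ex_bij_betw_finite_nat[of "snd ` set_pmf V'"] fin by blast
  hence inj: "inj_on e (snd ` set_pmf V')" by (simp add: bij_betw_def)
  let ?V = "map_pmf (\<lambda>s. ((fst (fst s), snd (fst s)), e (snd s))) V'"
  have "snd ` set_pmf ?V = e ` (snd ` set_pmf V')" by (simp add: image_image)
  hence "snd ` set_pmf ?V \<subseteq> {..<CARD('a) * CARD('b)}"
    using e V'(3) by (auto simp: bij_betw_def)
  moreover have "?V \<in> auxiliaries J"
    using auxiliaries_rv(1)[OF fin ci inj] J by simp
  moreover have "aux_cost \<beta> \<gamma> \<theta> ?V = aux_cost \<beta> \<gamma> \<theta> V'"
    using auxiliaries_rv(2)[OF fin ci inj] aux_cost_eq[OF fin] by simp
  ultimately show ?thesis using V'(2) by (intro bexI[of _ ?V] conjI) simp_all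
qed

text \<open>With constant \<open>Js\<close> this yields attainment of the minimum, with varying
  \<open>Js\<close> lower semicontinuity in the joint law.\<close>

lemma auxiliaries_limit:
  fixes J :: "('a::finite \<times> 'b::finite) pmf"
  assumes lim: "pmf_tendsto UNIV Js J" and V: "\<And>m. V m \<in> auxiliaries (Js m)"
    and c: "\<And>m. aux_cost \<beta> \<gamma> \<theta> (V m) \<le> c m" "c \<longlonglongrightarrow> c0"
  shows "\<exists>Q\<in>auxiliaries J. aux_cost \<beta> \<gamma> \<theta> Q \<le> c0 \<and> snd ` set_pmf Q \<subseteq> {..<CARD('a) * CARD('b)}"
proof -
  let ?k = "CARD('a) * CARD('b)"
  have "\<exists>V'. V' \<in> auxiliaries (Js m) \<and> aux_cost \<beta> \<gamma> \<theta> V' \<le> c m \<and> snd ` set_pmf V' \<subseteq> {..<?k}" for m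
    using auxiliaries_reduce[OF V[of m], of \<beta> \<gamma> \<theta>] c(1)[of m] by (meson order_trans)
  then obtain V' where V': "\<And>m. V' m \<in> auxiliaries (Js m)" "\<And>m. aux_cost \<beta> \<gamma> \<theta> (V' m) \<le> c m"
    "\<And>m. snd ` set_pmf (V' m) \<subseteq> {..<?k}" by metis
  have "set_pmf (V' m) \<subseteq> UNIV \<times> {..<?k}" for m using V'(3)[of m] by auto
  then obtain r Q where r: "strict_mono (r :: nat \<Rightarrow> nat)"
    and Q: "pmf_tendsto (UNIV \<times> {..<?k}) (\<lambda>m. V' (r m)) Q"
    using pmf_convergent_subsequence[of "UNIV \<times> {..<?k}" V'] by auto
  have sub: "set_pmf Q \<subseteq> UNIV \<times> {..<?k}" using Q by (simp add: pmf_tendsto_def)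
  have finQ: "finite (set_pmf Q)" by (rule finite_subset[OF sub]) simp
  have fin: "finite (set_pmf (V' m))" and fst: "map_pmf fst (V' m) = Js m"
    and ci: "cond_indep (V' m) (\<lambda>s. fst (fst s)) (\<lambda>s. snd (fst s)) snd" for m
    using V'(1)[of m] by (auto simp: auxiliaries_iff)
  have "map_pmf fst Q = J"
  proof (rule pmf_eqI)
    fix z
    have "(\<lambda>m. pmf (map_pmf fst (V' (r m))) z) \<longlonglongrightarrow> pmf (map_pmf fst Q) z"
      using pmf_tendsto_map[OF Q, of fst] unfolding pmf_tendsto_def by blast
    moreover have "(\<lambda>m. pmf (Js m) z) \<longlonglongrightarrow> pmf J z"
      using lim unfolding pmf_tendsto_def by blast
    from LIMSEQ_subseq_LIMSEQ[OF this r] have "(\<lambda>m. pmf (Js (r m)) z) \<longlonglongrightarrow> pmf J z"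
      by (simp add: comp_def)
    ultimately show "pmf (map_pmf fst Q) z = pmf J z"
      unfolding fst by (rule LIMSEQ_unique)
  qed
  hence aux: "Q \<in> auxiliaries J"
    using cond_indep_tendsto[OF Q ci] finQ by (simp add: auxiliaries_iff)
  have "(\<lambda>m. aux_cost \<beta> \<gamma> \<theta> (V' (r m))) \<longlonglongrightarrow> aux_cost \<beta> \<gamma> \<theta> Q"
    using rv_cost_tendsto[OF Q] by (simp add: aux_cost_eq fin finQ)
  moreover have "(\<lambda>m. c (r m)) \<longlonglongrightarrow> c0"
    using LIMSEQ_subseq_LIMSEQ[OF c(2) r] by (simp add: comp_def)
  ultimately have "aux_cost \<beta> \<gamma> \<theta> Q \<le> c0"
    by (rule LIMSEQ_le) (use V'(2) in blast)
  moreover have "snd ` set_pmf Q \<subseteq> {..<?k}" using sub by auto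
  ultimately show ?thesis using aux by blast
qed

lemma aux_cost_min_attained:
  fixes J :: "('a::finite \<times> 'b::finite) pmf"
  assumes nn: "\<beta> \<ge> 0" "\<gamma> \<ge> 0" "\<theta> \<ge> 0"
  shows "\<exists>V\<in>auxiliaries J. aux_cost \<beta> \<gamma> \<theta> V = (INF V\<in>auxiliaries J. aux_cost \<beta> \<gamma> \<theta> V) \<and>
    snd ` set_pmf V \<subseteq> {..<CARD('a) * CARD('b)}"
proof -
  let ?I = "INF V\<in>auxiliaries J. aux_cost \<beta> \<gamma> \<theta> V"
  have "\<exists>V\<in>auxiliaries J. aux_cost \<beta> \<gamma> \<theta> V < ?I + 1 / real (Suc m)" for m
    using cINF_less_iff[OF auxiliaries_nonempty bdd_below_aux_cost[OF nn], of J "?I + 1 / real (Suc m)"] by simp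
  then obtain V where V: "\<And>m. V m \<in> auxiliaries J" "\<And>m. aux_cost \<beta> \<gamma> \<theta> (V m) < ?I + 1 / real (Suc m)"
    by metis
  have "(\<lambda>m. ?I + 1 / real (Suc m)) \<longlonglongrightarrow> ?I + 0"
    by (intro tendsto_intros LIMSEQ_Suc[OF lim_1_over_n])
  hence lim: "(\<lambda>m. ?I + 1 / real (Suc m)) \<longlonglongrightarrow> ?I" by simp
  have "pmf_tendsto UNIV (\<lambda>_. J) J" by (simp add: pmf_tendsto_def)
  from auxiliaries_limit[OF this V(1) less_imp_le[OF V(2)] lim]
  obtain Q where Q: "Q \<in> auxiliaries J" "aux_cost \<beta> \<gamma> \<theta> Q \<le> ?I" "snd ` set_pmf Q \<subseteq> {..<CARD('a) * CARD('b)}"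
    by blast
  have "?I \<le> aux_cost \<beta> \<gamma> \<theta> Q" by (rule cINF_lower[OF bdd_below_aux_cost[OF nn] Q(1)])
  thus ?thesis using Q by (intro bexI[OF _ Q(1)]) simp
qed

lemma min_attained_within_card:
  fixes J :: "('a::finite \<times> 'b::finite) pmf"
  assumes nn: "\<beta> \<ge> 0" "\<gamma> \<ge> 0" "\<theta> \<ge> 0"
  shows "min_attained_within (CARD('a) * CARD('b)) \<beta> \<gamma> \<theta> J"
proof -
  obtain V where V: "V \<in> auxiliaries J" "aux_cost \<beta> \<gamma> \<theta> V = (INF V\<in>auxiliaries J. aux_cost \<beta> \<gamma> \<theta> V)"
    "snd ` set_pmf V \<subseteq> {..<CARD('a) * CARD('b)}"
    using aux_cost_min_attained[OF nn] by blast
  have "is_arg_min (aux_cost \<beta> \<gamma> \<theta>) (\<lambda>V. V \<in> auxiliaries J) V"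
    unfolding is_arg_min_def
    using V(1,2) cINF_lower[OF bdd_below_aux_cost[OF nn]] by (metis not_less)
  moreover have "card (set_pmf (map_pmf snd V)) \<le> CARD('a) * CARD('b)"
    using card_mono[OF _ V(3)] by simp
  ultimately show ?thesis unfolding min_attained_within_def by blast
qed

section \<open>Lower semicontinuity of the functional\<close>

lemma info_functional_eq:
  fixes J :: "('a::finite \<times> 'b::finite) pmf"
  shows "info_functional \<beta> \<gamma> \<theta> J = rv_mi J fst snd + (INF V\<in>auxiliaries J. aux_cost \<beta> \<gamma> \<theta> V)"
  by (simp add: info_functional_def mutual_info_eq_rv_mi)

text \<open>Lower semicontinuity in the form that sublevel sets are closed: a limit of minimisers
  for the \<open>Js\<close>, on a common alphabet, competes for \<open>J\<close>.\<close>

lemma info_functional_limit: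
  fixes J :: "('a::finite \<times> 'b::finite) pmf"
  assumes nn: "\<beta> \<ge> 0" "\<gamma> \<ge> 0" "\<theta> \<ge> 0" and lim: "pmf_tendsto UNIV Js J"
    and le: "\<And>m. info_functional \<beta> \<gamma> \<theta> (Js m) \<le> c"
  shows "info_functional \<beta> \<gamma> \<theta> J \<le> c"
proof -
  have "\<exists>V. V \<in> auxiliaries (Js m) \<and> aux_cost \<beta> \<gamma> \<theta> V = (INF V\<in>auxiliaries (Js m). aux_cost \<beta> \<gamma> \<theta> V)" for m
    using aux_cost_min_attained[OF nn, of "Js m"] by blast
  then obtain V where V: "\<And>m. V m \<in> auxiliaries (Js m)"
    "\<And>m. aux_cost \<beta> \<gamma> \<theta> (V m) = (INF V\<in>auxiliaries (Js m). aux_cost \<beta> \<gamma> \<theta> V)"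
    by metis
  have "aux_cost \<beta> \<gamma> \<theta> (V m) \<le> c - rv_mi (Js m) fst snd" for m
    using le[of m] V(2)[of m] by (simp add: info_functional_eq)
  moreover have "(\<lambda>m. c - rv_mi (Js m) fst snd) \<longlonglongrightarrow> c - rv_mi J fst snd"
    by (intro tendsto_intros rv_mi_tendsto[OF lim])
  ultimately have "\<exists>Q\<in>auxiliaries J. aux_cost \<beta> \<gamma> \<theta> Q \<le> c - rv_mi J fst snd \<and>
      snd ` set_pmf Q \<subseteq> {..<CARD('a) * CARD('b)}"
    by (rule auxiliaries_limit[OF lim V(1)])
  then obtain Q where "Q \<in> auxiliaries J" "aux_cost \<beta> \<gamma> \<theta> Q \<le> c - rv_mi J fst snd"
    by blast
  thus ?thesis
    using cINF_lower[OF bdd_below_aux_cost[OF nn], of Q J] by (simp add: info_functional_eq)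
qed

text \<open>A neighbourhood form, meant for the letter laws of a code: the first estimate keeps
  their functional from dropping, the second caps their entropies in the deficit. Each follows by
  contradiction from a sequence tending to \<open>J\<close>.\<close>

lemma info_functional_ent_semicontinuous:
  fixes J :: "('a::finite \<times> 'b::finite) pmf"
  assumes nn: "\<beta> \<ge> 0" "\<gamma> \<ge> 0" "\<theta> \<ge> 0" and \<delta>: "\<delta> > 0"
  shows "\<exists>e>0. \<forall>J'. (\<forall>z. \<bar>pmf J' z - pmf J z\<bar> \<le> e) \<longrightarrow>
    info_functional \<beta> \<gamma> \<theta> J - \<delta> \<le> info_functional \<beta> \<gamma> \<theta> J' \<and> ent J' \<le> ent J + \<delta>"
proof -
  have conv: "pmf_tendsto UNIV Js J" if "\<And>m z. \<bar>pmf (Js m) z - pmf J z\<bar> \<le> 1 / real (Suc m)" for Js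
  proof -
    have "(\<lambda>m. pmf (Js m) z - pmf J z) \<longlonglongrightarrow> 0" for z
      by (rule Lim_null_comparison[OF _ LIMSEQ_Suc[OF lim_1_over_n]]) (use that in auto)
    thus ?thesis by (simp add: pmf_tendsto_def LIM_zero_iff)
  qed
  have "\<exists>e>0. \<forall>J'. (\<forall>z. \<bar>pmf J' z - pmf J z\<bar> \<le> e) \<longrightarrow> info_functional \<beta> \<gamma> \<theta> J - \<delta> \<le> info_functional \<beta> \<gamma> \<theta> J'"
  proof (rule ccontr)
    assume "\<not> ?thesis"
    hence "\<exists>J'. (\<forall>z. \<bar>pmf J' z - pmf J z\<bar> \<le> 1 / real (Suc m)) \<and>
      info_functional \<beta> \<gamma> \<theta> J' < info_functional \<beta> \<gamma> \<theta> J - \<delta>" for m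
      by (metis not_le of_nat_0_less_iff zero_less_Suc zero_less_divide_1_iff)
    then obtain Js where Js: "\<And>m z. \<bar>pmf (Js m) z - pmf J z\<bar> \<le> 1 / real (Suc m)"
      "\<And>m. info_functional \<beta> \<gamma> \<theta> (Js m) < info_functional \<beta> \<gamma> \<theta> J - \<delta>" by metis
    from info_functional_limit[OF nn conv[OF Js(1)] less_imp_le[OF Js(2)]] \<delta> show False by simp
  qed
  then obtain e1 where e1: "e1 > 0" "\<And>J'. (\<forall>z. \<bar>pmf J' z - pmf J z\<bar> \<le> e1) \<Longrightarrow>
    info_functional \<beta> \<gamma> \<theta> J - \<delta> \<le> info_functional \<beta> \<gamma> \<theta> J'" by blast
  have "\<exists>e>0. \<forall>J'. (\<forall>z. \<bar>pmf J' z - pmf J z\<bar> \<le> e) \<longrightarrow> ent J' \<le> ent J + \<delta>"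
  proof (rule ccontr)
    assume "\<not> ?thesis"
    hence "\<exists>J'. (\<forall>z. \<bar>pmf J' z - pmf J z\<bar> \<le> 1 / real (Suc m)) \<and> ent J + \<delta> < ent J'" for m
      by (metis not_le of_nat_0_less_iff zero_less_Suc zero_less_divide_1_iff)
    then obtain Js where Js: "\<And>m z. \<bar>pmf (Js m) z - pmf J z\<bar> \<le> 1 / real (Suc m)"
      "\<And>m. ent J + \<delta> < ent (Js m)" by metis
    have "ent J + \<delta> \<le> ent J"
      by (rule LIMSEQ_le_const[OF ent_tendsto[OF conv[OF Js(1)]]]) (use Js(2) less_imp_le in blast)
    thus False using \<delta> by simp
  qed
  then obtain e2 where e2: "e2 > 0" "\<And>J'. (\<forall>z. \<bar>pmf J' z - pmf J z\<bar> \<le> e2) \<Longrightarrow> ent J' \<le> ent J + \<delta>" by blast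
  show ?thesis
  proof (intro exI[of _ "min e1 e2"] conjI allI impI)
    fix J' assume "\<forall>z. \<bar>pmf J' z - pmf J z\<bar> \<le> min e1 e2"
    thus "info_functional \<beta> \<gamma> \<theta> J - \<delta> \<le> info_functional \<beta> \<gamma> \<theta> J'" "ent J' \<le> ent J + \<delta>"
      using e1(2) e2(2) by auto
  qed (use e1 e2 in auto)
qed

subsection \<open>Auxiliary variables as channel extensions\<close>

text \<open>
  An auxiliary variable of a channel is represented by an extension \<open>K\<close> of the channel with output
  \<open>(y, u)\<close>, for which the Markov chain \<open>X - U - Y\<close> is a factorization of the transition
  probabilities. This does not refer to the input distribution.
\<close>

definition splits :: "('a, 'b) channel \<Rightarrow> ('a, 'b \<times> 'u) channel \<Rightarrow> bool" where
  "splits W K \<longleftrightarrow> (\<forall>x. map_pmf fst (K x) = W x) \<and> (\<forall>x. finite (set_pmf (K x))) \<and>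
     (\<exists>f g. \<forall>x y u. pmf (K x) (y, u) = f x u * g y u)"

text \<open>The functional with the auxiliary prescribed by an extension instead of minimised over;
  for a fixed extension it is continuous in the input law.\<close>

definition split_functional ::
  "real \<Rightarrow> real \<Rightarrow> real \<Rightarrow> ('a \<times> 'b \<times> 'u) pmf \<Rightarrow> real" where
  "split_functional \<beta> \<gamma> \<theta> P = rv_mi P fst (\<lambda>s. fst (snd s))
     + rv_cost \<beta> \<gamma> \<theta> P fst (\<lambda>s. fst (snd s)) (\<lambda>s. snd (snd s))"

lemma map_joint_splits:
  assumes "splits W K"
  shows "map_pmf (\<lambda>s. (fst s, fst (snd s))) (joint q K) = joint q W"
proof -
  have "W = (\<lambda>x. map_pmf fst (K x))" using assms by (simp add: splits_def)
  thus ?thesis by (simp add: joint_def map_pmf_def bind_assoc_pmf bind_return_pmf)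
qed

lemma info_functional_le_split:
  fixes W :: "('a::finite, 'b::finite) channel"
  assumes nn: "\<beta> \<ge> 0" "\<gamma> \<ge> 0" "\<theta> \<ge> 0" and K: "splits W K"
  shows "info_functional \<beta> \<gamma> \<theta> (joint q W) \<le> split_functional \<beta> \<gamma> \<theta> (joint q K)"
proof -
  obtain f g where fg: "\<And>x y u. pmf (K x) (y, u) = f x u * g y u"
    using K unfolding splits_def by blast
  have fin: "finite (set_pmf (joint q K))"
    using K by (intro finite_set_joint) (simp_all add: splits_def)
  have "cond_indep (joint q K) fst (\<lambda>s. fst (snd s)) (\<lambda>s. snd (snd s))"
    by (rule cond_indep_factor[OF fin, where f="\<lambda>x u. pmf q x * f x u" and g=g])
      (simp add: pmf_joint fg)
  from info_functional_le[OF fin this nn] show ?thesis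
    by (simp add: map_joint_splits[OF K] split_functional_def)
qed

text \<open>An optimal \<open>V\<close> provides the conditional law of (Y, U) given X = x, but only
  for \<open>x\<close> in the support of \<open>q\<close>. The extension has to be valid at all
  inputs, so every other \<open>x\<close> gets an auxiliary value of its own.\<close>

lemma optimal_split:
  fixes W :: "('a::finite, 'b::finite) channel"
  assumes nn: "\<beta> \<ge> 0" "\<gamma> \<ge> 0" "\<theta> \<ge> 0"
  shows "\<exists>K :: ('a, 'b \<times> nat) channel. splits W K \<and>
    split_functional \<beta> \<gamma> \<theta> (joint q K) = info_functional \<beta> \<gamma> \<theta> (joint q W)"
proof -
  obtain V where V: "V \<in> auxiliaries (joint q W)"
    "aux_cost \<beta> \<gamma> \<theta> V = (INF V\<in>auxiliaries (joint q W). aux_cost \<beta> \<gamma> \<theta> V)"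
    "snd ` set_pmf V \<subseteq> {..<CARD('a) * CARD('b)}"
    using aux_cost_min_attained[OF nn, of "joint q W"] by blast
  define N where "N = CARD('a) * CARD('b)"
  have finV: "finite (set_pmf V)" and marg: "map_pmf fst V = joint q W"
    and ci: "cond_indep V (\<lambda>s. fst (fst s)) (\<lambda>s. snd (fst s)) snd"
    using V(1) by (auto simp: auxiliaries_iff)
  have V0: "pmf V (z, u) = 0" if "u \<ge> N" for z u
    using V(3) that by (force simp: pmf_eq_0_set_pmf N_def)
  have Vsum: "(\<Sum>u<N. pmf V ((x, y), u)) = pmf q x * pmf (W x) y" for x y
    using pmf_map_fst_eq_sum[of "{..<N}" V "(x, y)"] V(3) finV unfolding marg pmf_joint N_def by simp
  have "\<exists>p. \<forall>yu. pmf p yu = pmf V ((x, fst yu), snd yu) / pmf q x" if x: "x \<in> set_pmf q" for x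
  proof (rule ex_pmf_eq[of "UNIV \<times> {..<N}"])
    have "(\<Sum>yu\<in>UNIV \<times> {..<N}. pmf V ((x, fst yu), snd yu) / pmf q x)
       = (\<Sum>y\<in>UNIV. \<Sum>u<N. pmf V ((x, y), u)) / pmf q x"
      by (simp add: sum.cartesian_product case_prod_unfold sum_divide_distrib)
    also have "\<dots> = 1"
      using x by (simp add: Vsum sum_distrib_left[symmetric] sum_pmf_eq_1 set_pmf_iff)
    finally show "(\<Sum>yu\<in>UNIV \<times> {..<N}. pmf V ((x, fst yu), snd yu) / pmf q x) = 1" .
    show "pmf V ((x, fst yu), snd yu) / pmf q x = 0" if "yu \<notin> UNIV \<times> {..<N}" for yu :: "'b \<times> nat"
      using that V0 by (auto simp: mem_Times_iff)
  qed auto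
  then obtain L where L: "\<And>x yu. x \<in> set_pmf q \<Longrightarrow> pmf (L x) yu = pmf V ((x, fst yu), snd yu) / pmf q x"
    by metis
  \<comment> \<open>\<open>V\<close> takes no label from \<open>N\<close> on; the label
    \<open>N + to_nat x\<close> determines \<open>x\<close>, which makes the Markov chain trivial
    there.\<close>
  define K :: "('a, 'b \<times> nat) channel" where
    "K x = (if x \<in> set_pmf q then L x else map_pmf (\<lambda>y. (y, N + to_nat x)) (W x))" for x
  have finK: "finite (set_pmf (K x))" for x
  proof (cases "x \<in> set_pmf q")
    case True
    have "set_pmf (K x) \<subseteq> UNIV \<times> {..<N}"
    proof
      fix yu assume "yu \<in> set_pmf (K x)"
      hence "pmf V ((x, fst yu), snd yu) \<noteq> 0" using True by (auto simp: K_def set_pmf_iff L)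
      hence "\<not> snd yu \<ge> N" using V0 by blast
      thus "yu \<in> UNIV \<times> {..<N}" by (cases yu) auto
    qed
    thus ?thesis by (rule finite_subset) simp
  qed (simp add: K_def)
  have "map_pmf fst (K x) = W x" for x
  proof (cases "x \<in> set_pmf q")
    case True
    show ?thesis
    proof (rule pmf_eqI)
      fix y
      have "pmf (map_pmf fst (K x)) y = (\<Sum>u<N. pmf (K x) (y, u))"
      proof (rule pmf_map_fst_eq_sum)
        show "snd ` set_pmf (K x) \<subseteq> {..<N}"
        proof
          fix u assume "u \<in> snd ` set_pmf (K x)"
          then obtain yu where yu: "yu \<in> set_pmf (K x)" "u = snd yu" by blast
          hence "pmf V ((x, fst yu), snd yu) \<noteq> 0" using True by (auto simp: K_def set_pmf_iff L)
          hence "\<not> u \<ge> N" using V0 yu by blast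
          thus "u \<in> {..<N}" by auto
        qed
      qed (use finK in auto)
      also have "\<dots> = (\<Sum>u<N. pmf V ((x, y), u)) / pmf q x"
        using True by (simp add: K_def L sum_divide_distrib)
      also have "\<dots> = pmf (W x) y"
        using True by (simp add: Vsum set_pmf_iff)
      finally show "pmf (map_pmf fst (K x)) y = pmf (W x) y" .
    qed
  qed (simp add: K_def map_pmf_comp)
  moreover have "\<exists>f g. \<forall>x y u. pmf (K x) (y, u) = f x u * g y u"
  proof (intro exI allI)
    \<comment> \<open>On the support of \<open>q\<close> the factors are P(x, u) / (P(u) q(x)) and
      P(y, u), with the quotient 0 at null \<open>u\<close>. From \<open>N\<close> on,
      \<open>?g\<close> recovers \<open>x\<close> from the label, since it may not depend on
      \<open>x\<close> directly.\<close>
    let ?f = "\<lambda>x u. if x \<in> set_pmf q then pmf (map_pmf (\<lambda>s. (fst (fst s), snd s)) V) (x, u)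
      / pmf (map_pmf snd V) u / pmf q x else of_bool (u = N + to_nat x)"
    let ?g = "\<lambda>y u. if u < N then pmf (map_pmf (\<lambda>s. (snd (fst s), snd s)) V) (y, u)
      else pmf (W (from_nat (u - N))) y"
    fix x y u
    have VG: "pmf V ((x, y), u) = pmf (map_pmf (\<lambda>s. (fst (fst s), snd (fst s), snd s)) V) (x, y, u)"
    proof -
      have "inj (\<lambda>s :: ('a \<times> 'b) \<times> nat. (fst (fst s), snd (fst s), snd s))"
        by (auto simp: inj_def)
      from pmf_map_inj'[OF this, of V "((x, y), u)"] show ?thesis by simp
    qed
    have z: "pmf (map_pmf (\<lambda>s. (fst (fst s), snd s)) V) (x, u) = 0" if "u \<ge> N" for x
      using V(3) that by (force simp: pmf_eq_0_set_pmf N_def)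
    show "pmf (K x) (y, u) = ?f x u * ?g y u"
    proof (cases "x \<in> set_pmf q")
      case True
      show ?thesis
      proof (cases "u < N")
        case u: True
        have "pmf (map_pmf (\<lambda>s. (fst (fst s), snd (fst s), snd s)) V) (x, y, u)
          = pmf (map_pmf (\<lambda>s. (fst (fst s), snd s)) V) (x, u) / pmf (map_pmf snd V) u *
            pmf (map_pmf (\<lambda>s. (snd (fst s), snd s)) V) (y, u)"
        proof (cases "pmf (map_pmf snd V) u = 0")
          case True
          hence "pmf (map_pmf (\<lambda>s. (fst (fst s), snd (fst s), snd s)) V) (x, y, u) = 0"
            by (auto simp: pmf_eq_0_set_pmf)
          thus ?thesis using True by simp
        next
          case False
          thus ?thesis using ci[unfolded cond_indep_def, rule_format, of x y u] by (simp add: field_simps)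
        qed
        thus ?thesis using True u by (simp add: K_def L VG)
      next
        case False
        thus ?thesis using True z[of x] V0 by (simp add: K_def L)
      qed
    next
      case False
      show ?thesis
      proof (cases "u = N + to_nat x")
        case True
        have "inj (\<lambda>y :: 'b. (y, N + to_nat x))" by (auto simp: inj_def)
        from pmf_map_inj'[OF this, of "W x" y] show ?thesis using False True by (simp add: K_def)
      next
        case u: False
        hence "pmf (map_pmf (\<lambda>y. (y, N + to_nat x)) (W x)) (y, u) = 0"
          by (auto simp: pmf_eq_0_set_pmf)
        thus ?thesis using False u by (simp add: K_def)
      qed
    qed
  qed
  ultimately have split: "splits W K" using finK by (simp add: splits_def)
  let ?h = "\<lambda>s :: ('a \<times> 'b) \<times> nat. (fst (fst s), snd (fst s), snd s)"
  have JK: "joint q K = map_pmf ?h V"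
  proof (rule pmf_eqI)
    fix t :: "'a \<times> 'b \<times> nat"
    obtain x y u where t: "t = (x, y, u)" by (cases t) auto
    have "inj ?h" by (auto simp: inj_def)
    from pmf_map_inj'[OF this, of V "((x, y), u)"]
    have 1: "pmf (map_pmf ?h V) t = pmf V ((x, y), u)" by (simp add: t)
    show "pmf (joint q K) t = pmf (map_pmf ?h V) t"
    proof (cases "x \<in> set_pmf q")
      case True
      thus ?thesis unfolding 1 unfolding t by (simp add: pmf_joint K_def L set_pmf_iff)
    next
      case False
      have "pmf V ((x, y), u) = 0"
      proof (rule ccontr)
        assume "pmf V ((x, y), u) \<noteq> 0"
        hence "(x, y) \<in> set_pmf (map_pmf fst V)" by (force simp: set_pmf_iff[symmetric])
        thus False using False unfolding marg set_joint by auto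
      qed
      thus ?thesis using False unfolding 1 unfolding t by (simp add: pmf_joint set_pmf_iff)
    qed
  qed
  have "rv_mi V (\<lambda>s. fst (fst s)) (\<lambda>s. snd (fst s)) = rv_mi (joint q W) fst snd"
    unfolding marg[symmetric] by (simp add: rv_mi_map_pmf)
  hence "split_functional \<beta> \<gamma> \<theta> (joint q K) = info_functional \<beta> \<gamma> \<theta> (joint q W)"
    unfolding JK split_functional_def rv_cost_def rv_mi_map_pmf info_functional_eq V(2)[symmetric]
      aux_cost_eq[OF finV] by simp
  thus ?thesis using split by blast
qed

section \<open>Upper semicontinuity and the maximum over input laws\<close>

lemma info_functional_channel_usc:
  fixes W :: "('a::finite, 'b::finite) channel"
  assumes nn: "\<beta> \<ge> 0" "\<gamma> \<ge> 0" "\<theta> \<ge> 0"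
  shows "\<exists>r q. strict_mono (r :: nat \<Rightarrow> nat) \<and> (\<forall>\<delta>>0. eventually (\<lambda>m.
    info_functional \<beta> \<gamma> \<theta> (joint (qs (r m)) W) \<le> info_functional \<beta> \<gamma> \<theta> (joint q W) + \<delta>) sequentially)"
proof -
  obtain r q where r: "strict_mono (r :: nat \<Rightarrow> nat)" and q: "pmf_tendsto UNIV (\<lambda>m. qs (r m)) q"
    using pmf_convergent_subsequence[of UNIV qs] by auto
  \<comment> \<open>The extension is optimal at the limit \<open>q\<close>; at
    \<open>qs (r m)\<close> it is merely a competitor, which is the direction wanted.\<close>
  obtain K :: "('a, 'b \<times> nat) channel" where K: "splits W K"
    "split_functional \<beta> \<gamma> \<theta> (joint q K) = info_functional \<beta> \<gamma> \<theta> (joint q W)"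
    using optimal_split[OF nn, of W q] by blast
  have "pmf_tendsto (UNIV \<times> (\<Union>x. set_pmf (K x))) (\<lambda>m. joint (qs (r m)) K) (joint q K)"
    unfolding pmf_tendsto_def
  proof (intro conjI allI)
    show "finite (UNIV \<times> (\<Union>x. set_pmf (K x)) :: ('a \<times> 'b \<times> nat) set)"
      using K(1) by (auto simp: splits_def)
    fix t :: "'a \<times> 'b \<times> nat"
    show "(\<lambda>m. pmf (joint (qs (r m)) K) t) \<longlonglongrightarrow> pmf (joint q K) t"
      using q unfolding pmf_tendsto_def by (cases t) (simp only: pmf_joint tendsto_mult tendsto_const)
  qed (auto simp: set_joint)
  hence "(\<lambda>m. split_functional \<beta> \<gamma> \<theta> (joint (qs (r m)) K)) \<longlonglongrightarrow> split_functional \<beta> \<gamma> \<theta> (joint q K)"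
    unfolding split_functional_def by (intro tendsto_add rv_mi_tendsto rv_cost_tendsto)
  hence ev: "eventually (\<lambda>m. split_functional \<beta> \<gamma> \<theta> (joint (qs (r m)) K) <
      info_functional \<beta> \<gamma> \<theta> (joint q W) + \<delta>) sequentially" if "\<delta> > 0" for \<delta>
    unfolding K(2) by (rule order_tendstoD(2)) (use that in simp)
  have "eventually (\<lambda>m. info_functional \<beta> \<gamma> \<theta> (joint (qs (r m)) W) \<le>
      info_functional \<beta> \<gamma> \<theta> (joint q W) + \<delta>) sequentially" if "\<delta> > 0" for \<delta>
  proof (rule eventually_mono[OF ev[OF that]])
    fix m
    assume "split_functional \<beta> \<gamma> \<theta> (joint (qs (r m)) K) < info_functional \<beta> \<gamma> \<theta> (joint q W) + \<delta>"
    thus "info_functional \<beta> \<gamma> \<theta> (joint (qs (r m)) W) \<le> info_functional \<beta> \<gamma> \<theta> (joint q W) + \<delta>"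
      using info_functional_le_split[OF nn K(1), of "qs (r m)"] by linarith
  qed
  thus ?thesis using r by blast
qed

text \<open>A supremum of reals is meaningful only for a set bounded above, so this precedes any use
  of \<open>SUP\<close>.\<close>

lemma info_functional_channel_bdd:
  fixes W :: "('a::finite, 'b::finite) channel"
  assumes nn: "\<beta> \<ge> 0" "\<gamma> \<ge> 0" "\<theta> \<ge> 0"
  shows "bdd_above (range (\<lambda>q. info_functional \<beta> \<gamma> \<theta> (joint q W)))"
proof (rule ccontr)
  let ?G = "\<lambda>q. info_functional \<beta> \<gamma> \<theta> (joint q W)"
  assume "\<not> ?thesis"
  hence "\<exists>q. ?G q > real m" for m by (auto simp: bdd_above_def not_le)
  then obtain qs where qs: "\<And>m. ?G (qs m) > real m" by metis
  obtain r q where r: "strict_mono (r :: nat \<Rightarrow> nat)"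
    and q: "eventually (\<lambda>m. ?G (qs (r m)) \<le> ?G q + 1) sequentially"
    using info_functional_channel_usc[OF nn, of qs W] zero_less_one by blast
  obtain n :: nat where n: "?G q + 1 < real n" using reals_Archimedean2 by blast
  have "eventually (\<lambda>m. False) sequentially"
    using q eventually_ge_at_top[of n]
  proof eventually_elim
    case (elim m)
    have "real n \<le> real (r m)" using elim(2) seq_suble[OF r, of m] by simp
    thus False using elim(1) qs[of "r m"] n by linarith
  qed
  thus False by simp
qed

lemma info_functional_channel_max:
  fixes W :: "('a::finite, 'b::finite) channel"
  assumes nn: "\<beta> \<ge> 0" "\<gamma> \<ge> 0" "\<theta> \<ge> 0"
  shows "\<exists>q. is_arg_max (\<lambda>q. info_functional \<beta> \<gamma> \<theta> (joint q W)) (\<lambda>_. True) q"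
proof -
  let ?G = "\<lambda>q. info_functional \<beta> \<gamma> \<theta> (joint q W)"
  let ?s = "SUP q. ?G q"
  note bdd = info_functional_channel_bdd[OF nn, of W]
  have "\<exists>q. ?s - 1 / real (Suc m) < ?G q" for m
    using less_cSUP_iff[OF _ bdd, of "?s - 1 / real (Suc m)"] by simp
  then obtain qs where qs: "\<And>m. ?s - 1 / real (Suc m) < ?G (qs m)" by metis
  obtain r q where r: "strict_mono (r :: nat \<Rightarrow> nat)"
    and q: "\<And>\<delta>. \<delta> > 0 \<Longrightarrow> eventually (\<lambda>m. ?G (qs (r m)) \<le> ?G q + \<delta>) sequentially"
    using info_functional_channel_usc[OF nn, of qs W] by blast
  have "?s \<le> ?G q + \<delta>" if "\<delta> > 0" for \<delta>
  proof (rule tendsto_upperbound)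
    have "(\<lambda>m. ?s - 1 / real (Suc m)) \<longlonglongrightarrow> ?s - 0"
      by (intro tendsto_intros LIMSEQ_Suc[OF lim_1_over_n])
    thus "(\<lambda>m. ?s - 1 / real (Suc (r m))) \<longlonglongrightarrow> ?s"
      using LIMSEQ_subseq_LIMSEQ[OF _ r, of "\<lambda>m. ?s - 1 / real (Suc m)"] by (simp add: comp_def)
    show "eventually (\<lambda>m. ?s - 1 / real (Suc (r m)) \<le> ?G q + \<delta>) sequentially"
      using q[OF that] by (rule eventually_mono) (use qs less_imp_le less_le_trans in blast)
  qed simp
  hence "?s \<le> ?G q" by (rule field_le_epsilon)
  hence "?G q' \<le> ?G q" for q'
    using cSUP_upper[OF UNIV_I bdd, of q'] by linarith
  thus ?thesis unfolding is_arg_max_def by (auto simp: not_less)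
qed

subsection \<open>The one-shot converse\<close>

lemma rv_ent_pair_le_add:
  assumes fin: "finite (set_pmf P)"
  shows "rv_ent P (\<lambda>s. (A s, B s)) \<le> rv_ent P A + rv_ent P B"
  using rv_mi_nonneg[OF fin, of A B] by (simp add: rv_mi_def)

lemma rv_mi_le_rv_ent:
  assumes fin: "finite (set_pmf P)"
  shows "rv_mi P A B \<le> rv_ent P A"
proof -
  have "rv_ent P (\<lambda>s. (A s, B s)) = rv_ent P (\<lambda>s. (B s, A s))"
    by (rule rv_ent_cong[OF fin]) auto
  thus ?thesis using rv_ent_le_pair[OF fin, of B A] by (simp add: rv_mi_def)
qed

text \<open>The chain rule I(AB;C) = I(B;C) + I(A;C|B), with I(A;C|B) enlarged to I(A;CB).\<close>

lemma rv_mi_pair_le: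
  assumes fin: "finite (set_pmf P)"
  shows "rv_mi P (\<lambda>s. (A s, B s)) C \<le> rv_mi P B C + rv_mi P A (\<lambda>s. (C s, B s))"
proof -
  have "rv_ent P (\<lambda>s. ((A s, B s), C s)) = rv_ent P (\<lambda>s. (A s, (C s, B s)))"
    "rv_ent P (\<lambda>s. (C s, B s)) = rv_ent P (\<lambda>s. (B s, C s))"
    by (rule rv_ent_cong[OF fin]; auto)+
  thus ?thesis using rv_ent_pair_le_add[OF fin, of A B] by (simp add: rv_mi_def)
qed

text \<open>\<open>W\<close> is the shared randomness, \<open>B\<close> and \<open>C\<close> are
  channel input and output, \<open>U\<close> is the auxiliary of the channel. Every Markov chain is
  read off from a factorization by grouping the factors around the conditioning variables;
  \<open>noY\<close> and \<open>XW\<close> record normalisation, which the bare factors in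
  \<open>full\<close> do not show.\<close>

lemma one_shot_bounds:
  assumes fin: "finite (set_pmf P)"
    and full: "\<And>x w b c u y. pmf (map_pmf (\<lambda>s. (X s, W s, B s, C s, U s, Y s)) P) (x, w, b, c, u, y)
      = a x w b * f b u * g c u * d c w y"
    and noY: "\<And>x w b c u. pmf (map_pmf (\<lambda>s. (X s, W s, B s, C s, U s)) P) (x, w, b, c, u)
      = a x w b * f b u * g c u"
    and XW: "\<And>x w. pmf (map_pmf (\<lambda>s. (X s, W s)) P) (x, w) = p x * r w"
  shows "rv_mi P X Y \<le> rv_mi P B C"
    and "rv_mi P (\<lambda>s. (U s, W s)) (\<lambda>s. (X s, Y s)) \<le> rv_ent P W + rv_mi P U (\<lambda>s. (B s, C s))"
    and "rv_mi P (\<lambda>s. (U s, W s)) X \<le> rv_mi P U B"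
    and "rv_mi P (\<lambda>s. (U s, W s)) Y \<le> rv_ent P W + rv_mi P U C"
    and "cond_indep P X Y (\<lambda>s. (U s, W s))"
proof -
  have ci_U: "cond_indep P U (\<lambda>s. (X s, W s, Y s)) (\<lambda>s. (B s, C s))"
  proof (rule cond_indep_factor[OF fin])
    fix u xwy bc
    have "pmf (map_pmf (\<lambda>s. (U s, (X s, W s, Y s), (B s, C s))) P) (u, xwy, bc) =
      pmf (map_pmf (\<lambda>s. (X s, W s, B s, C s, U s, Y s)) P)
        (fst xwy, fst (snd xwy), fst bc, snd bc, u, snd (snd xwy))"
      unfolding pmf_map by (rule arg_cong[where f="measure (measure_pmf P)"]) auto
    also have "\<dots> = (\<lambda>u bc. f (fst bc) u * g (snd bc) u) u bc *
      (\<lambda>xwy bc. a (fst xwy) (fst (snd xwy)) (fst bc) * d (snd bc) (fst (snd xwy)) (snd (snd xwy))) xwy bc"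
      unfolding full by simp
    finally show "pmf (map_pmf (\<lambda>s. (U s, (X s, W s, Y s), (B s, C s))) P) (u, xwy, bc) = \<dots>" .
  qed
  have ci_XY: "cond_indep P (\<lambda>s. (X s, B s)) (\<lambda>s. (C s, Y s)) (\<lambda>s. (U s, W s))"
  proof (rule cond_indep_factor[OF fin])
    fix xb cy uw
    have "pmf (map_pmf (\<lambda>s. ((X s, B s), (C s, Y s), (U s, W s))) P) (xb, cy, uw) =
      pmf (map_pmf (\<lambda>s. (X s, W s, B s, C s, U s, Y s)) P)
        (fst xb, snd uw, snd xb, fst cy, fst uw, snd cy)"
      unfolding pmf_map by (rule arg_cong[where f="measure (measure_pmf P)"]) auto
    also have "\<dots> = (\<lambda>xb uw. a (fst xb) (snd uw) (snd xb) * f (snd xb) (fst uw)) xb uw *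
      (\<lambda>cy uw. g (fst cy) (fst uw) * d (fst cy) (snd uw) (snd cy)) cy uw"
      unfolding full by simp
    finally show "pmf (map_pmf (\<lambda>s. ((X s, B s), (C s, Y s), (U s, W s))) P) (xb, cy, uw) = \<dots>" .
  qed
  have ci_Y: "cond_indep P (\<lambda>s. (X s, B s, U s)) Y (\<lambda>s. (C s, W s))"
  proof (rule cond_indep_factor[OF fin])
    fix xbu y cw
    have "pmf (map_pmf (\<lambda>s. ((X s, B s, U s), Y s, (C s, W s))) P) (xbu, y, cw) =
      pmf (map_pmf (\<lambda>s. (X s, W s, B s, C s, U s, Y s)) P)
        (fst xbu, snd cw, fst (snd xbu), fst cw, snd (snd xbu), y)"
      unfolding pmf_map by (rule arg_cong[where f="measure (measure_pmf P)"]) auto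
    also have "\<dots> = (\<lambda>xbu cw. a (fst xbu) (snd cw) (fst (snd xbu)) * f (fst (snd xbu)) (snd (snd xbu)) *
      g (fst cw) (snd (snd xbu))) xbu cw * (\<lambda>y cw. d (fst cw) (snd cw) y) y cw"
      unfolding full by simp
    finally show "pmf (map_pmf (\<lambda>s. ((X s, B s, U s), Y s, (C s, W s))) P) (xbu, y, cw) = \<dots>" .
  qed
  have ci_B: "cond_indep P (\<lambda>s. (X s, W s)) (\<lambda>s. (C s, U s)) B"
  proof (rule cond_indep_factor[OF fin])
    fix xw cu b
    have "pmf (map_pmf (\<lambda>s. ((X s, W s), (C s, U s), B s)) P) (xw, cu, b) =
      pmf (map_pmf (\<lambda>s. (X s, W s, B s, C s, U s)) P) (fst xw, snd xw, b, fst cu, snd cu)"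
      unfolding pmf_map by (rule arg_cong[where f="measure (measure_pmf P)"]) auto
    also have "\<dots> = (\<lambda>xw b. a (fst xw) (snd xw) b) xw b * (\<lambda>cu b. f b (snd cu) * g (fst cu) (snd cu)) cu b"
      unfolding noY by simp
    finally show "pmf (map_pmf (\<lambda>s. ((X s, W s), (C s, U s), B s)) P) (xw, cu, b) = \<dots>" .
  qed
  have ci_W: "cond_indep P (\<lambda>s. (X s, W s, B s)) C U"
  proof (rule cond_indep_factor[OF fin])
    fix xwb c u
    have "pmf (map_pmf (\<lambda>s. ((X s, W s, B s), C s, U s)) P) (xwb, c, u) =
      pmf (map_pmf (\<lambda>s. (X s, W s, B s, C s, U s)) P) (fst xwb, fst (snd xwb), snd (snd xwb), c, u)"
      unfolding pmf_map by (rule arg_cong[where f="measure (measure_pmf P)"]) auto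
    also have "\<dots> = (\<lambda>xwb u. a (fst xwb) (fst (snd xwb)) (snd (snd xwb)) * f (snd (snd xwb)) u) xwb u * g c u"
      unfolding noY by simp
    finally show "pmf (map_pmf (\<lambda>s. ((X s, W s, B s), C s, U s)) P) (xwb, c, u) = \<dots>" .
  qed
  have ci_XW: "cond_indep P X W (\<lambda>_. ())"
  proof (rule cond_indep_factor[OF fin])
    fix x w and e :: unit
    have "pmf (map_pmf (\<lambda>s. (X s, W s, ())) P) (x, w, e) = pmf (map_pmf (\<lambda>s. (X s, W s)) P) (x, w)"
      unfolding pmf_map by (rule arg_cong[where f="measure (measure_pmf P)"]) auto
    thus "pmf (map_pmf (\<lambda>s. (X s, W s, ())) P) (x, w, e) = (\<lambda>x _. p x) x e * (\<lambda>w _. r w) w e"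
      unfolding XW .
  qed
  have HXW: "rv_ent P (\<lambda>s. (X s, W s)) = rv_ent P X + rv_ent P W"
  proof -
    have "rv_ent P (\<lambda>s. (X s, W s, ())) = rv_ent P (\<lambda>s. (X s, W s))"
      "rv_ent P (\<lambda>s. (X s, ())) = rv_ent P X" "rv_ent P (\<lambda>s. (W s, ())) = rv_ent P W"
      by (rule rv_ent_cong[OF fin]; auto)+
    thus ?thesis using cond_indep_rv_ent[OF fin ci_XW] by (simp add: rv_ent_const)
  qed
  show "cond_indep P X Y (\<lambda>s. (U s, W s))"
    using cond_indep_map[OF fin ci_XY, of fst snd] by simp

  \<comment> \<open>Independence of \<open>X\<close> and \<open>W\<close> moves \<open>W\<close>
    across, I(X;CW) \<le> I(C;XW), and then the chain (X,W) - B - C applies.\<close>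
  have "rv_mi P X Y \<le> rv_mi P X (\<lambda>s. (C s, W s))"
    using rv_mi_data_processing[OF fin cond_indep_map_left[OF fin ci_Y, of fst]] by simp
  also have "\<dots> \<le> rv_mi P C (\<lambda>s. (X s, W s))"
  proof -
    have "rv_ent P (\<lambda>s. (X s, (C s, W s))) = rv_ent P (\<lambda>s. (C s, (X s, W s)))"
      by (rule rv_ent_cong[OF fin]) auto
    thus ?thesis using HXW rv_ent_pair_le_add[OF fin, of C W] by (simp add: rv_mi_def)
  qed
  also have "\<dots> \<le> rv_mi P C B"
    using rv_mi_data_processing[OF fin cond_indep_commute[OF cond_indep_map[OF fin ci_B, of "\<lambda>x. x" fst]]]
    by simp
  also have "\<dots> = rv_mi P B C" by (rule rv_mi_commute[OF fin])
  finally show "rv_mi P X Y \<le> rv_mi P B C" .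

  \<comment> \<open>\<open>W\<close> is split off the auxiliary at the cost I(W;XY) \<le> H(W); the
    rest is data processing from (B, C).\<close>
  have "rv_mi P U (\<lambda>s. ((X s, Y s), W s)) \<le> rv_mi P U (\<lambda>s. (B s, C s))"
    using rv_mi_data_processing[OF fin cond_indep_map[OF fin ci_U, of "\<lambda>u. u" "\<lambda>(x, w, y). ((x, y), w)"]]
    by simp
  thus "rv_mi P (\<lambda>s. (U s, W s)) (\<lambda>s. (X s, Y s)) \<le> rv_ent P W + rv_mi P U (\<lambda>s. (B s, C s))"
    using rv_mi_pair_le[OF fin, of U W "\<lambda>s. (X s, Y s)"] rv_mi_le_rv_ent[OF fin, of W "\<lambda>s. (X s, Y s)"]
    by linarith

  \<comment> \<open>Here splitting off \<open>W\<close> is free, as I(W;X) = 0.\<close>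
  have "rv_mi P U (\<lambda>s. (X s, W s)) \<le> rv_mi P U B"
    using rv_mi_data_processing[OF fin cond_indep_commute[OF cond_indep_map[OF fin ci_B, of "\<lambda>x. x" snd]]]
    by simp
  moreover have "rv_mi P X W = 0" using HXW by (simp add: rv_mi_def)
  ultimately show "rv_mi P (\<lambda>s. (U s, W s)) X \<le> rv_mi P U B"
    using rv_mi_pair_le[OF fin, of U W X] rv_mi_commute[OF fin, of W X] by linarith

  \<comment> \<open>I(UW;Y) \<le> H(W) + I(U;Y|W) \<le> H(W) + I(U;C|W) \<le> H(W) + I(U;C), the
    last by W - U - C. Splitting off \<open>W\<close> as before would leave I(U;YW), which pays
    I(U;W) in addition.\<close>
  have "cond_indep P U Y (\<lambda>s. (C s, W s))"
    using cond_indep_map_left[OF fin ci_Y, of "\<lambda>t. snd (snd t)"] by simp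
  note 1 = cond_indep_rv_ent[OF fin this]
  have "cond_indep P W C U"
    using cond_indep_map_left[OF fin ci_W, of "\<lambda>t. fst (snd t)"] by simp
  note 2 = cond_indep_rv_ent[OF fin this]
  note 3 = rv_ent_submodular[OF fin, of U C "\<lambda>s. (Y s, W s)"]
  note 4 = rv_ent_pair_le_add[OF fin, of C W] rv_ent_le_pair[OF fin, of Y W]
  have 5: "rv_ent P (\<lambda>s. (U s, C s, Y s, W s)) = rv_ent P (\<lambda>s. (U s, Y s, C s, W s))"
    "rv_ent P (\<lambda>s. (C s, Y s, W s)) = rv_ent P (\<lambda>s. (Y s, C s, W s))"
    "rv_ent P (\<lambda>s. ((U s, W s), Y s)) = rv_ent P (\<lambda>s. (U s, Y s, W s))"
    "rv_ent P (\<lambda>s. (W s, C s, U s)) = rv_ent P (\<lambda>s. (U s, C s, W s))"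
    "rv_ent P (\<lambda>s. (W s, U s)) = rv_ent P (\<lambda>s. (U s, W s))"
    "rv_ent P (\<lambda>s. (C s, U s)) = rv_ent P (\<lambda>s. (U s, C s))"
    by (rule rv_ent_cong[OF fin]; auto)+
  show "rv_mi P (\<lambda>s. (U s, W s)) Y \<le> rv_ent P W + rv_mi P U C"
    using 1 2 3 4 unfolding rv_mi_def 5 by linarith
qed

section \<open>The law of a code extended by an auxiliary variable\<close>

type_synonym ('x, 'w, 'b, 'c, 'u, 'y) simulation_space =
  "((('x \<times> 'w) \<times> 'b) \<times> ('c \<times> 'u)) \<times> 'y"

text \<open>The nesting follows the order of generation, so that \<open>fst\<close> undoes the last
  stage. \<open>K\<close> emits the auxiliary together with the channel output, but
  \<open>dec\<close> sees only the output and \<open>w\<close>, so the code itself is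
  undisturbed.\<close>

definition simulation_law ::
  "'x pmf \<Rightarrow> 'w pmf \<Rightarrow> ('x \<Rightarrow> 'w \<Rightarrow> 'b pmf) \<Rightarrow> ('b \<Rightarrow> ('c \<times> 'u) pmf) \<Rightarrow> ('c \<Rightarrow> 'w \<Rightarrow> 'y pmf)
    \<Rightarrow> ('x, 'w, 'b, 'c, 'u, 'y) simulation_space pmf" where
  "simulation_law p r enc K dec = joint (joint (joint (joint p (\<lambda>_. r)) (\<lambda>(x, w). enc x w)) (\<lambda>(_, b). K b))
     (\<lambda>(((_, w), _), (c, _)). dec c w)"

lemma simulation_law_bounds:
  fixes p :: "'x pmf" and r :: "'w pmf" and K :: "'b \<Rightarrow> ('c \<times> 'u) pmf" and dec :: "'c \<Rightarrow> 'w \<Rightarrow> 'y pmf"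
  assumes fins: "finite (set_pmf p)" "finite (set_pmf r)" "\<And>x w. finite (set_pmf (enc x w))"
      "\<And>b. finite (set_pmf (K b))" "\<And>c w. finite (set_pmf (dec c w))"
    and K: "\<And>b c u. pmf (K b) (c, u) = f b u * g c u"
  defines "P \<equiv> simulation_law p r enc K dec"
    and "X \<equiv> \<lambda>s. fst (fst (fst (fst s)))" and "W \<equiv> \<lambda>s. snd (fst (fst (fst s)))"
    and "B \<equiv> \<lambda>s. snd (fst (fst s))" and "C \<equiv> \<lambda>s. fst (snd (fst s))" and "U \<equiv> \<lambda>s. snd (snd (fst s))"
    and "Y \<equiv> snd"
  shows "finite (set_pmf P)"
    and "rv_mi P X Y \<le> rv_mi P B C"
    and "rv_mi P (\<lambda>s. (U s, W s)) (\<lambda>s. (X s, Y s)) \<le> rv_ent P W + rv_mi P U (\<lambda>s. (B s, C s))"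
    and "rv_mi P (\<lambda>s. (U s, W s)) X \<le> rv_mi P U B"
    and "rv_mi P (\<lambda>s. (U s, W s)) Y \<le> rv_ent P W + rv_mi P U C"
    and "cond_indep P X Y (\<lambda>s. (U s, W s))"
proof -
  let ?P1 = "joint p (\<lambda>_. r)"
  let ?P2 = "joint ?P1 (\<lambda>(x, w). enc x w)"
  let ?P3 = "joint ?P2 (\<lambda>(_, b). K b)"
  have P: "P = joint ?P3 (\<lambda>(((_, w), _), (c, _)). dec c w)"
    by (simp add: P_def simulation_law_def)
  have fin: "finite (set_pmf P)"
    unfolding P using fins by (intro finite_set_joint) (auto split: prod.splits)
  have full: "pmf (map_pmf (\<lambda>s. (X s, W s, B s, C s, U s, Y s)) P) (x, w, b, c, u, y)
      = (pmf p x * pmf r w * pmf (enc x w) b) * f b u * g c u * pmf (dec c w) y" for x w b c u y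
  proof -
    have "inj (\<lambda>s. (X s, W s, B s, C s, U s, Y s))"
      by (auto simp: inj_def X_def W_def B_def C_def U_def Y_def)
    from pmf_map_inj'[OF this, of P "((((x, w), b), (c, u)), y)"]
    have "pmf (map_pmf (\<lambda>s. (X s, W s, B s, C s, U s, Y s)) P) (x, w, b, c, u, y)
      = pmf P ((((x, w), b), (c, u)), y)"
      by (simp add: X_def W_def B_def C_def U_def Y_def)
    thus ?thesis by (simp add: P pmf_joint K)
  qed
  have noY: "pmf (map_pmf (\<lambda>s. (X s, W s, B s, C s, U s)) P) (x, w, b, c, u)
      = (pmf p x * pmf r w * pmf (enc x w) b) * f b u * g c u" for x w b c u
  proof -
    let ?h = "\<lambda>s :: (('x \<times> 'w) \<times> 'b) \<times> ('c \<times> 'u).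
      (fst (fst (fst s)), snd (fst (fst s)), snd (fst s), fst (snd s), snd (snd s))"
    have "map_pmf (\<lambda>s. (X s, W s, B s, C s, U s)) P = map_pmf ?h (map_pmf fst P)"
      by (simp add: map_pmf_comp X_def W_def B_def C_def U_def)
    also have "map_pmf fst P = ?P3" by (simp add: P map_fst_joint)
    finally have *: "map_pmf (\<lambda>s. (X s, W s, B s, C s, U s)) P = map_pmf ?h ?P3" .
    have "inj ?h" by (auto simp: inj_def)
    from pmf_map_inj'[OF this, of ?P3 "(((x, w), b), (c, u))"]
    show ?thesis unfolding * by (simp add: pmf_joint K)
  qed
  have XW: "pmf (map_pmf (\<lambda>s. (X s, W s)) P) (x, w) = pmf p x * pmf r w" for x w
  proof -
    have "map_pmf (\<lambda>s. (X s, W s)) P = map_pmf fst (map_pmf fst (map_pmf fst P))"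
      by (simp add: map_pmf_comp X_def W_def)
    also have "\<dots> = ?P1" by (simp only: P map_fst_joint)
    finally show ?thesis by (simp add: pmf_joint)
  qed
  show "finite (set_pmf P)" by (rule fin)
  note bounds = one_shot_bounds[of P X W B C U Y "\<lambda>x w b. pmf p x * pmf r w * pmf (enc x w) b" f g
      "\<lambda>c w y. pmf (dec c w) y" "pmf p" "pmf r", OF fin full noY XW]
  show "rv_mi P X Y \<le> rv_mi P B C"
    "rv_mi P (\<lambda>s. (U s, W s)) (\<lambda>s. (X s, Y s)) \<le> rv_ent P W + rv_mi P U (\<lambda>s. (B s, C s))"
    "rv_mi P (\<lambda>s. (U s, W s)) X \<le> rv_mi P U B"
    "rv_mi P (\<lambda>s. (U s, W s)) Y \<le> rv_ent P W + rv_mi P U C"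
    "cond_indep P X Y (\<lambda>s. (U s, W s))"
    by (fact bounds)+
qed

subsection \<open>Single-letterization\<close>

lemma rv_mi_map_le:
  assumes fin: "finite (set_pmf P)"
  shows "rv_mi P A (\<lambda>s. f (B s)) \<le> rv_mi P A B"
proof -
  have "rv_ent P (\<lambda>s. (A s, B s, f (B s))) = rv_ent P (\<lambda>s. (A s, B s))"
    "rv_ent P (\<lambda>s. (B s, f (B s))) = rv_ent P B"
    by (rule rv_ent_cong[OF fin]; auto)+
  thus ?thesis using rv_ent_submodular[OF fin, of A B "\<lambda>s. f (B s)"] by (simp add: rv_mi_def)
qed

lemma ent_pmf_of_set:
  assumes "finite A" "A \<noteq> {}"
  shows "ent (pmf_of_set A) = log 2 (card A)"
  using assms by (simp add: ent_def log_divide_pos card_gt_0_iff)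

lemma shared_randomness_facts:
  assumes "R \<ge> 0"
  shows "finite (set_pmf (shared_randomness n R))" and "ent (shared_randomness n R) \<le> real n * R"
proof -
  define N where "N = nat \<lfloor>2 powr (real n * R)\<rfloor>"
  \<comment> \<open>\<open>R \<ge> 0\<close> keeps the index set nonempty after rounding
    down.\<close>
  have ge1: "2 powr (real n * R) \<ge> 1" using assms by (intro ge_one_powr_ge_zero) auto
  hence N1: "N \<ge> 1" unfolding N_def by linarith
  have N: "real N \<le> 2 powr (real n * R)" unfolding N_def using ge1 by linarith
  have ne: "{1..N} \<noteq> {}" using N1 by simp
  have r: "shared_randomness n R = pmf_of_set {1..N}" by (simp add: shared_randomness_def N_def)
  show "finite (set_pmf (shared_randomness n R))" using ne by (simp add: r)
  have "ent (shared_randomness n R) = log 2 N"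
    unfolding r using ne by (subst ent_pmf_of_set) auto
  also have "\<dots> \<le> log 2 (2 powr (real n * R))"
    using N N1 by (subst log_le_cancel_iff) auto
  finally show "ent (shared_randomness n R) \<le> real n * R" by simp
qed

lemma finite_seqs: "finite (seqs n :: (nat \<Rightarrow> 'a::finite) set)"
  unfolding seqs_def by (intro finite_PiE) auto

lemma card_seqs: "card (seqs n :: (nat \<Rightarrow> 'a::finite) set) = CARD('a) ^ n"
  unfolding seqs_def by (simp add: card_PiE)

lemma seqs_outside: "x \<in> seqs n \<Longrightarrow> i \<ge> n \<Longrightarrow> x i = undefined"
  unfolding seqs_def by (erule PiE_arb) simp

lemma set_Pi_pmf_seqs: "set_pmf (Pi_pmf {..<n} undefined K) \<subseteq> seqs n"
proof
  fix x assume "x \<in> set_pmf (Pi_pmf {..<n} undefined K)"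
  hence "\<forall>i. i \<notin> {..<n} \<longrightarrow> x i = undefined"
    using set_Pi_pmf_subset[of "{..<n}" undefined K] by auto
  thus "x \<in> seqs n" unfolding seqs_def by (auto simp: PiE_def extensional_def)
qed

lemma set_iid_seqs: "set_pmf (iid n p) \<subseteq> seqs n"
  unfolding iid_def by (rule set_Pi_pmf_seqs)

lemma set_memoryless_seqs: "set_pmf (memoryless n W x) \<subseteq> seqs n"
  unfolding memoryless_def by (rule set_Pi_pmf_seqs)

lemma map_iid_component: "i < n \<Longrightarrow> map_pmf (\<lambda>x. x i) (iid n p) = p"
  unfolding iid_def by (subst Pi_pmf_component) auto

lemma ent_iid:
  fixes p :: "'a::finite pmf"
  shows "ent (iid n p) = real n * ent p"
  unfolding iid_def by (subst ent_Pi_pmf) auto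

lemma ent_joint_iid:
  fixes p :: "'a::finite pmf" and W :: "('a, 'b::finite) channel"
  shows "ent (joint (iid n p) (memoryless n W)) = real n * ent (joint p W)"
proof -
  let ?D = "joint (iid n p) (memoryless n W)"
  have D: "map_pmf (\<lambda>s. (fst s, snd s)) ?D = joint (iid n p) (\<lambda>b. Pi_pmf {..<n} undefined (\<lambda>i. W (b i)))"
    by (simp add: memoryless_def[abs_def])
  have fin: "finite (set_pmf (iid n p))" by (rule finite_subset[OF set_iid_seqs finite_seqs])
  have i: "map_pmf (\<lambda>s. (fst s i, snd s i)) ?D = joint p W" if "i < n" for i
    using map_memoryless_component[OF D that] that by (simp add: map_iid_component)
  hence i': "map_pmf (\<lambda>s. fst s i) ?D = p" if "i < n" for i
    using arg_cong[OF i[OF that], of "map_pmf fst"] by (simp add: map_pmf_comp map_fst_joint)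
  have "rv_ent ?D (\<lambda>s. (fst s, snd s)) - rv_ent ?D fst =
    (\<Sum>i<n. rv_ent ?D (\<lambda>s. (fst s i, snd s i)) - rv_ent ?D (\<lambda>s. fst s i))"
    by (rule rv_ent_memoryless[OF fin _ D]) simp
  thus ?thesis
    by (simp add: rv_ent_def i i' map_fst_joint ent_iid algebra_simps)
qed

type_synonym ('x, 'xt, 'yt, 'y) code_space =
  "(nat \<Rightarrow> 'x, nat, nat \<Rightarrow> 'xt, nat \<Rightarrow> 'yt, nat \<Rightarrow> nat, nat \<Rightarrow> 'y) simulation_space"

text \<open>The simulation error enters only through the last bracket, the amount by which the
  entropies of the letter pairs together exceed that of the block.\<close>

lemma simulation_code_bound:
  fixes p :: "'x::finite pmf" and Wt :: "('xt::finite, 'yt::finite) channel"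
    and dec :: "(nat \<Rightarrow> 'yt) \<Rightarrow> nat \<Rightarrow> (nat \<Rightarrow> 'y::finite) pmf"
  assumes nn: "\<beta> \<ge> 0" "\<gamma> \<ge> 0" "\<theta> \<ge> 0" and R: "R \<ge> 0"
    and enc: "\<And>x w. set_pmf (enc x w) \<subseteq> seqs n" and dec: "\<And>yt w. set_pmf (dec yt w) \<subseteq> seqs n"
    and s: "\<And>q. info_functional \<beta> \<gamma> \<theta> (joint q Wt) \<le> s"
  defines "S \<equiv> simulated n R p Wt enc dec"
  shows "(\<Sum>i<n. info_functional \<beta> \<gamma> \<theta> (map_pmf (\<lambda>(x, y). (x i, y i)) S))
    \<le> real n * s + (\<beta> + \<theta>) * (real n * R)
      + (\<beta> + \<theta>) * ((\<Sum>i<n. ent (map_pmf (\<lambda>(x, y). (x i, y i)) S)) - ent S)"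
proof -
  define r where "r = shared_randomness n R"
  define P0 where "P0 = joint (joint (iid n p) (\<lambda>_. r)) (\<lambda>(x, w). enc x w)"
  define \<pi> where "\<pi> = map_pmf snd P0"
  \<comment> \<open>The input laws are fixed by source and encoder, before any auxiliary is
    attached, so each extension may be chosen optimal for its own place \<open>i\<close>.\<close>
  define q where "q i = map_pmf (\<lambda>b. b i) \<pi>" for i
  have "\<exists>K :: ('xt, 'yt \<times> nat) channel. splits Wt K \<and>
      split_functional \<beta> \<gamma> \<theta> (joint (q i) K) = info_functional \<beta> \<gamma> \<theta> (joint (q i) Wt)" for i
    by (rule optimal_split[OF nn])
  then obtain K :: "nat \<Rightarrow> ('xt, 'yt \<times> nat) channel" where K: "\<And>i. splits Wt (K i)"
    "\<And>i. split_functional \<beta> \<gamma> \<theta> (joint (q i) (K i)) = info_functional \<beta> \<gamma> \<theta> (joint (q i) Wt)"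
    by metis
  have "\<exists>f g. \<forall>x y u. pmf (K i x) (y, u) = f x u * g y u" for i
    using K(1)[of i] by (simp add: splits_def)
  then obtain f g where fg: "\<And>i x y u. pmf (K i x) (y, u) = f i x u * g i y u" by metis
  have finK: "finite (set_pmf (K i x))" and fstK: "map_pmf fst (K i x) = Wt x" for i x
    using K(1)[of i] by (auto simp: splits_def)
  define Pn where "Pn b = Pi_pmf {..<n} (undefined, 0) (\<lambda>i. K i (b i))" for b
  \<comment> \<open>A sequence of pairs becomes a pair of sequences; the default (undefined, 0)
    leaves the output sequence in the form that \<open>memoryless\<close> produces.\<close>
  define Kn where "Kn b = map_pmf (\<lambda>z. (\<lambda>i. fst (z i), \<lambda>i. snd (z i))) (Pn b)" for b
  define P where "P = simulation_law (iid n p) r enc Kn dec"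
  define X where "X = (\<lambda>s :: ('x, 'xt, 'yt, 'y) code_space. fst (fst (fst (fst s))))"
  define A where "A = (\<lambda>s :: ('x, 'xt, 'yt, 'y) code_space. snd (fst (fst (fst s))))"
  define B where "B = (\<lambda>s :: ('x, 'xt, 'yt, 'y) code_space. snd (fst (fst s)))"
  define C where "C = (\<lambda>s :: ('x, 'xt, 'yt, 'y) code_space. fst (snd (fst s)))"
  define U where "U = (\<lambda>s :: ('x, 'xt, 'yt, 'y) code_space. snd (snd (fst s)))"
  define Y where "Y = (snd :: ('x, 'xt, 'yt, 'y) code_space \<Rightarrow> _)"
  note rvs = X_def A_def B_def C_def U_def Y_def

  \<comment> \<open>The indicators of the default tails are distributed over the two factors as
    well.\<close>
  have Kn: "pmf (Kn b) (c, u) =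
      (\<lambda>b u. of_bool (\<forall>i\<ge>n. u i = 0) * (\<Prod>i<n. f i (b i) (u i))) b u *
      (\<lambda>c u. of_bool (\<forall>i\<ge>n. c i = undefined) * (\<Prod>i<n. g i (c i) (u i))) c u" for b c u
  proof -
    have "inj (\<lambda>z :: nat \<Rightarrow> 'yt \<times> nat. (\<lambda>i. fst (z i), \<lambda>i. snd (z i)))"
      by (auto simp: inj_def fun_eq_iff prod_eq_iff)
    from pmf_map_inj'[OF this, of "Pn b" "\<lambda>i. (c i, u i)"]
    have "pmf (Kn b) (c, u) = pmf (Pn b) (\<lambda>i. (c i, u i))" by (simp add: Kn_def)
    also have "\<dots> = (if \<forall>i. i \<notin> {..<n} \<longrightarrow> (c i, u i) = (undefined, 0) then \<Prod>i<n. pmf (K i (b i)) (c i, u i) else 0)"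
      unfolding Pn_def by (rule pmf_Pi) simp
    finally show ?thesis by (auto simp: fg prod.distrib not_less)
  qed
  have finPn: "finite (set_pmf (Pn b))" for b
    unfolding Pn_def by (rule finite_set_Pi_pmf) (auto simp: finK)
  have finX: "finite (set_pmf (iid n p))" by (rule finite_subset[OF set_iid_seqs finite_seqs])
  have finr: "finite (set_pmf r)" unfolding r_def by (rule shared_randomness_facts(1)[OF R])
  have finenc: "finite (set_pmf (enc x w))" for x w by (rule finite_subset[OF enc finite_seqs])
  have findec: "finite (set_pmf (dec c w))" for c w by (rule finite_subset[OF dec finite_seqs])
  have finKn: "finite (set_pmf (Kn b))" for b by (simp add: Kn_def finPn)
  note law = simulation_law_bounds[of "iid n p" r enc Kn dec, OF finX finr finenc finKn findec Kn,
      folded P_def]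
  note fin = law(1)
  let ?UA = "\<lambda>s. (U s, A s)"
  have S1: "rv_mi P X Y \<le> rv_mi P B C"
    and S2: "rv_mi P ?UA (\<lambda>s. (X s, Y s)) \<le> rv_ent P A + rv_mi P U (\<lambda>s. (B s, C s))"
    and S3: "rv_mi P ?UA X \<le> rv_mi P U B"
    and S4: "rv_mi P ?UA Y \<le> rv_ent P A + rv_mi P U C"
    and S5: "cond_indep P X Y ?UA"
    unfolding rvs by (fact law(2-6))+

  have P1: "map_pmf fst P = joint P0 (\<lambda>s. Kn (snd s))"
    by (simp add: P_def simulation_law_def map_fst_joint P0_def case_prod_unfold)
  have P00: "map_pmf fst P0 = joint (iid n p) (\<lambda>_. r)" by (simp add: P0_def map_fst_joint)
  have mapX: "map_pmf X P = iid n p"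
  proof -
    have "map_pmf X P = map_pmf fst (map_pmf fst (map_pmf fst (map_pmf fst P)))"
      by (simp add: map_pmf_comp X_def)
    thus ?thesis by (simp add: P1 map_fst_joint P00)
  qed
  have mapA: "map_pmf A P = r"
  proof -
    have "map_pmf A P = map_pmf snd (map_pmf fst (map_pmf fst (map_pmf fst P)))"
      by (simp add: map_pmf_comp A_def)
    also have "\<dots> = map_pmf snd (joint (iid n p) (\<lambda>_. r))" by (simp add: P1 map_fst_joint P00)
    also have "\<dots> = r" by (simp add: joint_def map_pmf_def bind_assoc_pmf bind_return_pmf bind_return_pmf')
    finally show ?thesis .
  qed
  have fstKn: "map_pmf fst (Kn b) = memoryless n Wt b" for b
  proof -
    have "map_pmf fst (Kn b) = map_pmf (\<lambda>z. fst \<circ> z) (Pn b)" by (simp add: Kn_def map_pmf_comp comp_def)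
    also have "\<dots> = Pi_pmf {..<n} undefined (\<lambda>i. map_pmf fst (K i (b i)))"
      unfolding Pn_def by (subst Pi_pmf_map[of "{..<n}" fst "(undefined, 0)" undefined]) simp_all
    finally show ?thesis by (simp add: fstK memoryless_def)
  qed
  have mapXY: "map_pmf (\<lambda>s. (X s, Y s)) P = S"
  proof -
    have "map_pmf (\<lambda>s. (X s, Y s)) P = do {
       x \<leftarrow> iid n p; w \<leftarrow> r; b \<leftarrow> enc x w; c \<leftarrow> map_pmf fst (Kn b); y \<leftarrow> dec c w; return_pmf (x, y) }"
      by (simp add: P_def simulation_law_def joint_def X_def Y_def map_pmf_def bind_assoc_pmf
          bind_return_pmf case_prod_unfold)
    thus ?thesis by (simp add: fstKn S_def simulated_def r_def)
  qed
  have BCU: "map_pmf (\<lambda>s. (B s, \<lambda>i. (C s i, U s i))) P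
      = joint \<pi> (\<lambda>b. Pi_pmf {..<n} (undefined, 0) (\<lambda>i. K i (b i)))"
  proof -
    let ?g = "\<lambda>t :: (nat \<Rightarrow> 'yt) \<times> (nat \<Rightarrow> nat). \<lambda>i. (fst t i, snd t i)"
    have "map_pmf (\<lambda>s. (B s, \<lambda>i. (C s i, U s i))) P = map_pmf (\<lambda>(s, t). (snd s, ?g t)) (map_pmf fst P)"
      by (simp add: map_pmf_comp rvs case_prod_unfold)
    also have "\<dots> = joint \<pi> (\<lambda>b. map_pmf ?g (Kn b))"
      unfolding P1 \<pi>_def by (rule map_joint)
    also have "(\<lambda>b. map_pmf ?g (Kn b)) = Pn" by (simp add: Kn_def map_pmf_comp fun_eq_iff)
    finally show ?thesis by (simp add: Pn_def[abs_def])
  qed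
  have fin\<pi>: "finite (set_pmf \<pi>)"
    unfolding \<pi>_def P0_def using finX finr finenc by (auto simp: set_joint intro!: finite_SigmaI)
  note T = rv_mi_memoryless[OF fin fin\<pi> finK BCU fg]
  have comp: "map_pmf (\<lambda>s. (B s i, C s i, U s i)) P = joint (q i) (K i)" if "i < n" for i
    using map_memoryless_component[OF BCU that] by (simp add: q_def)
  \<comment> \<open>Optimality of \<open>K i\<close> at \<open>q i\<close> converts the cost of the
    attached auxiliary into the functional, hence into \<open>s\<close>.\<close>
  have channel: "rv_mi P (\<lambda>s. B s i) (\<lambda>s. C s i) + rv_cost \<beta> \<gamma> \<theta> P (\<lambda>s. B s i) (\<lambda>s. C s i) (\<lambda>s. U s i) \<le> s"
    if "i < n" for i
    using s[of "q i"] unfolding K(2)[symmetric] comp[OF that, symmetric] split_functional_def rv_cost_def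
      rv_mi_map_pmf by simp
  have "rv_mi P B C + rv_cost \<beta> \<gamma> \<theta> P B C U
    \<le> (\<Sum>i<n. rv_mi P (\<lambda>s. B s i) (\<lambda>s. C s i)) + (\<beta> * (\<Sum>i<n. rv_mi P (\<lambda>s. U s i) (\<lambda>s. (B s i, C s i)))
      + \<gamma> * (\<Sum>i<n. rv_mi P (\<lambda>s. U s i) (\<lambda>s. B s i)) + \<theta> * (\<Sum>i<n. rv_mi P (\<lambda>s. U s i) (\<lambda>s. C s i)))"
    unfolding rv_cost_def using T nn by (intro add_mono mult_left_mono) auto
  also have "\<dots> = (\<Sum>i<n. rv_mi P (\<lambda>s. B s i) (\<lambda>s. C s i)
      + rv_cost \<beta> \<gamma> \<theta> P (\<lambda>s. B s i) (\<lambda>s. C s i) (\<lambda>s. U s i))"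
    unfolding rv_cost_def by (simp only: sum.distrib sum_distrib_left)
  also have "\<dots> \<le> (\<Sum>i<n. s)" by (intro sum_mono channel) auto
  finally have inner: "rv_mi P B C + rv_cost \<beta> \<gamma> \<theta> P B C U \<le> real n * s" by simp

  have "rv_ent P A \<le> real n * R"
    unfolding rv_ent_def mapA r_def by (rule shared_randomness_facts(2)[OF R])
  hence HA: "(\<beta> + \<theta>) * rv_ent P A \<le> (\<beta> + \<theta>) * (real n * R)"
    using nn by (intro mult_left_mono) auto
  let ?Z = "\<lambda>s i. (X s i, Y s i)"
  have "rv_mi P X Y + rv_cost \<beta> \<gamma> \<theta> P X Y ?UA \<le> rv_mi P B C + (\<beta> * (rv_ent P A + rv_mi P U (\<lambda>s. (B s, C s)))
      + \<gamma> * rv_mi P U B + \<theta> * (rv_ent P A + rv_mi P U C))"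
    unfolding rv_cost_def using S1 S2 S3 S4 nn by (intro add_mono mult_left_mono) auto
  also have "\<dots> = rv_mi P B C + rv_cost \<beta> \<gamma> \<theta> P B C U + (\<beta> + \<theta>) * rv_ent P A"
    by (simp add: rv_cost_def algebra_simps)
  finally have outer: "rv_mi P X Y + rv_cost \<beta> \<gamma> \<theta> P X Y ?UA \<le> real n * s + (\<beta> + \<theta>) * (real n * R)"
    using inner HA by linarith

  have inseqs: "X t \<in> seqs n" "Y t \<in> seqs n" if "t \<in> set_pmf P" for t
  proof -
    have "X t \<in> set_pmf (map_pmf X P)" using that by simp
    thus "X t \<in> seqs n" unfolding mapX using set_iid_seqs by blast
    show "Y t \<in> seqs n"
      using that by (auto simp: P_def simulation_law_def set_joint Y_def intro: subsetD[OF dec])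
  qed
  have dflt: "X t i = undefined" "Y t i = undefined" if "t \<in> set_pmf P" "i \<ge> n" for t i
    using inseqs[OF that(1)] that(2) by (auto intro: seqs_outside)
  hence seqX: "seq_rv P n X" and seqY: "seq_rv P n Y" and seqZ: "seq_rv P n ?Z"
    unfolding seq_rv_def by (intro exI ballI allI impI; simp)+
  have mapXi: "map_pmf (\<lambda>s. X s i) P = p" if "i < n" for i
    using map_iid_component[OF that, of p] unfolding mapX[symmetric] by (simp add: map_pmf_comp)
  \<comment> \<open>The source is i.i.d. by construction, so \<open>X\<close> alone has no
    deficit.\<close>
  have DX: "(\<Sum>i<n. rv_ent P (\<lambda>s. X s i)) - rv_ent P X = 0"
    by (simp add: rv_ent_def mapX mapXi ent_iid)
  define D where "D = (\<Sum>i<n. rv_ent P (\<lambda>s. ?Z s i)) - rv_ent P ?Z"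
  have HZ: "rv_ent P ?Z = rv_ent P (\<lambda>s. (X s, Y s))"
    by (rule rv_ent_cong[OF fin]) (auto simp: fun_eq_iff)
  \<comment> \<open>The deficit of \<open>Y\<close> is at most that of the pairs, since H(X|Y) is at
    most the sum of the H(X_i|Y), hence of the H(X_i|Y_i).\<close>
  have DY: "(\<Sum>i<n. rv_ent P (\<lambda>s. Y s i)) - rv_ent P Y \<le> D"
  proof -
    have "rv_ent P (\<lambda>s. (X s i, Y s)) - rv_ent P Y \<le> rv_ent P (\<lambda>s. ?Z s i) - rv_ent P (\<lambda>s. Y s i)" for i
    proof -
      have "rv_ent P (\<lambda>s. (X s i, Y s, Y s i)) = rv_ent P (\<lambda>s. (X s i, Y s))"
        "rv_ent P (\<lambda>s. (Y s, Y s i)) = rv_ent P Y"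
        by (rule rv_ent_cong[OF fin]; auto)+
      thus ?thesis using rv_ent_submodular[OF fin, of "\<lambda>s. X s i" Y "\<lambda>s. Y s i"] by simp
    qed
    hence "(\<Sum>i<n. rv_ent P (\<lambda>s. (X s i, Y s)) - rv_ent P Y)
      \<le> (\<Sum>i<n. rv_ent P (\<lambda>s. ?Z s i) - rv_ent P (\<lambda>s. Y s i))" by (intro sum_mono)
    thus ?thesis using rv_ent_cond_subadditive[OF fin seqX, of Y] HZ
      by (simp add: D_def sum_subtractf)
  qed
  \<comment> \<open>Independent source letters make I(X;Y) at least the sum of the I(X_i;Y), and
    each term dominates I(X_i;Y_i).\<close>
  have mono: "(\<Sum>i<n. rv_mi P (\<lambda>s. X s i) (\<lambda>s. Y s i)) \<le> rv_mi P X Y"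
  proof -
    have "(\<Sum>i<n. rv_mi P (\<lambda>s. X s i) (\<lambda>s. Y s i)) \<le> (\<Sum>i<n. rv_mi P Y (\<lambda>s. X s i))"
    proof (intro sum_mono)
      fix i
      show "rv_mi P (\<lambda>s. X s i) (\<lambda>s. Y s i) \<le> rv_mi P Y (\<lambda>s. X s i)"
        using rv_mi_map_le[OF fin, of "\<lambda>s. X s i" "\<lambda>y. y i" Y] rv_mi_commute[OF fin, of Y "\<lambda>s. X s i"]
        by simp
    qed
    also have "\<dots> \<le> rv_mi P Y X" using rv_mi_seq_ge[OF fin seqX, of Y] DX by linarith
    finally show ?thesis using rv_mi_commute[OF fin, of X Y] by linarith
  qed
  have "rv_mi P ?UA ?Z = rv_mi P ?UA (\<lambda>s. (X s, Y s))"
    by (rule rv_mi_cong[OF fin]) (auto simp: fun_eq_iff)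
  hence miZ: "(\<Sum>i<n. rv_mi P ?UA (\<lambda>s. ?Z s i)) \<le> rv_mi P ?UA (\<lambda>s. (X s, Y s)) + D"
    using rv_mi_seq_ge[OF fin seqZ, of ?UA] by (simp add: D_def)
  have miX: "(\<Sum>i<n. rv_mi P ?UA (\<lambda>s. X s i)) \<le> rv_mi P ?UA X"
    using rv_mi_seq_ge[OF fin seqX, of ?UA] DX by linarith
  have miY: "(\<Sum>i<n. rv_mi P ?UA (\<lambda>s. Y s i)) \<le> rv_mi P ?UA Y + D"
    using rv_mi_seq_ge[OF fin seqY, of ?UA] DY by linarith
  have mapXYi: "map_pmf (\<lambda>s. (X s i, Y s i)) P = map_pmf (\<lambda>(x, y). (x i, y i)) S" for i
    unfolding mapXY[symmetric] by (simp add: map_pmf_comp)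
  have "(\<Sum>i<n. info_functional \<beta> \<gamma> \<theta> (map_pmf (\<lambda>(x, y). (x i, y i)) S))
    \<le> (\<Sum>i<n. rv_mi P (\<lambda>s. X s i) (\<lambda>s. Y s i) + rv_cost \<beta> \<gamma> \<theta> P (\<lambda>s. X s i) (\<lambda>s. Y s i) ?UA)"
    unfolding mapXYi[symmetric]
  proof (intro sum_mono info_functional_le[OF fin _ nn])
    fix i
    show "cond_indep P (\<lambda>s. X s i) (\<lambda>s. Y s i) ?UA"
      using cond_indep_map[OF fin S5, of "\<lambda>x. x i" "\<lambda>y. y i"] .
  qed
  also have "\<dots> = (\<Sum>i<n. rv_mi P (\<lambda>s. X s i) (\<lambda>s. Y s i)) + (\<beta> * (\<Sum>i<n. rv_mi P ?UA (\<lambda>s. ?Z s i))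
      + \<gamma> * (\<Sum>i<n. rv_mi P ?UA (\<lambda>s. X s i)) + \<theta> * (\<Sum>i<n. rv_mi P ?UA (\<lambda>s. Y s i)))"
    unfolding rv_cost_def by (simp only: sum.distrib sum_distrib_left)
  also have "\<dots> \<le> rv_mi P X Y + (\<beta> * (rv_mi P ?UA (\<lambda>s. (X s, Y s)) + D) + \<gamma> * rv_mi P ?UA X
      + \<theta> * (rv_mi P ?UA Y + D))"
    using mono miZ miX miY nn by (intro add_mono mult_left_mono) auto
  also have "\<dots> = rv_mi P X Y + rv_cost \<beta> \<gamma> \<theta> P X Y ?UA + (\<beta> + \<theta>) * D"
    by (simp add: rv_cost_def algebra_simps)
  also have "\<dots> \<le> real n * s + (\<beta> + \<theta>) * (real n * R) + (\<beta> + \<theta>) * D"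
    using outer by simp
  also have "D = (\<Sum>i<n. ent (map_pmf (\<lambda>(x, y). (x i, y i)) S)) - ent S"
    unfolding D_def HZ by (simp add: rv_ent_def mapXY mapXYi)
  finally show ?thesis .
qed

section \<open>From block error to single letters\<close>

lemma tv_dist_eq_sum:
  assumes S: "finite S" "set_pmf P \<subseteq> S" "set_pmf Q \<subseteq> S"
  shows "tv_dist P Q = (\<Sum>x\<in>S. \<bar>pmf P x - pmf Q x\<bar>) / 2"
proof -
  have "(\<Sum>\<^sub>\<infinity>x. \<bar>pmf P x - pmf Q x\<bar>) = (\<Sum>\<^sub>\<infinity>x\<in>S. \<bar>pmf P x - pmf Q x\<bar>)"
  proof (rule infsum_cong_neutral)
    fix x assume "x \<in> UNIV - S"
    hence "x \<notin> set_pmf P" "x \<notin> set_pmf Q" using S by auto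
    thus "\<bar>pmf P x - pmf Q x\<bar> = 0" by (simp add: set_pmf_iff)
  qed auto
  thus ?thesis using S by (simp add: tv_dist_def)
qed

lemma pmf_map_diff_le_tv_dist:
  assumes S: "finite S" "set_pmf P \<subseteq> S" "set_pmf Q \<subseteq> S"
  shows "\<bar>pmf (map_pmf A P) a - pmf (map_pmf A Q) a\<bar> \<le> 2 * tv_dist P Q"
proof -
  have "\<bar>pmf (map_pmf A P) a - pmf (map_pmf A Q) a\<bar>
      = \<bar>\<Sum>x | x \<in> S \<and> A x = a. pmf P x - pmf Q x\<bar>"
    by (simp add: pmf_map_sum_superset[OF S(1,2)] pmf_map_sum_superset[OF S(1,3)] sum_subtractf)
  also have "\<dots> \<le> (\<Sum>x | x \<in> S \<and> A x = a. \<bar>pmf P x - pmf Q x\<bar>)" by (rule sum_abs)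
  also have "\<dots> \<le> (\<Sum>x\<in>S. \<bar>pmf P x - pmf Q x\<bar>)" by (rule sum_mono2) (use S in auto)
  also have "\<dots> = 2 * tv_dist P Q" by (simp add: tv_dist_eq_sum[OF S])
  finally show ?thesis .
qed

text \<open>The deficit is at most n \<delta> from the letter entropies plus \<epsilon> n log
  (|X||Y|) + 1 / ln 2 from the block entropy, and everything is divided by \<open>n\<close>. The
  factor 2 in \<open>2 * \<epsilon> \<le> e\<close> appears because letter probabilities are
  compared through the l1 distance, twice the total variation.\<close>

lemma simulation_code_single_letter:
  fixes p :: "'x::finite pmf" and W :: "('x, 'y::finite) channel"
    and Wt :: "('xt::finite, 'yt::finite) channel"
  assumes nn: "\<beta> \<ge> 0" "\<gamma> \<ge> 0" "\<theta> \<ge> 0" and R: "R \<ge> 0"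
    and s: "\<And>q. info_functional \<beta> \<gamma> \<theta> (joint q Wt) \<le> s"
    and code: "simulation_code n R \<epsilon> p W Wt enc dec" and \<epsilon>: "2 * \<epsilon> \<le> e" and n: "n \<ge> 1"
    and near: "\<And>J'. (\<forall>z. \<bar>pmf J' z - pmf (joint p W) z\<bar> \<le> e) \<Longrightarrow>
      info_functional \<beta> \<gamma> \<theta> (joint p W) - \<delta> \<le> info_functional \<beta> \<gamma> \<theta> J' \<and> ent J' \<le> ent (joint p W) + \<delta>"
  shows "info_functional \<beta> \<gamma> \<theta> (joint p W) \<le> s + (\<beta> + \<theta>) * R + \<delta>
    + (\<beta> + \<theta>) * (\<delta> + \<epsilon> * log 2 (CARD('x) * CARD('y)) + 1 / (real n * ln 2))"
proof -
  let ?J = "joint p W" and ?G = "info_functional \<beta> \<gamma> \<theta>"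
  define S where "S = simulated n R p Wt enc dec"
  define D where "D = joint (iid n p) (memoryless n W)"
  define L where "L = log 2 (CARD('x) * CARD('y))"
  let ?T = "seqs n \<times> seqs n :: ((nat \<Rightarrow> 'x) \<times> (nat \<Rightarrow> 'y)) set"
  let ?i = "\<lambda>i. map_pmf (\<lambda>(x, y). (x i, y i))"
  have enc: "\<And>x w. set_pmf (enc x w) \<subseteq> seqs n" and dec: "\<And>yt w. set_pmf (dec yt w) \<subseteq> seqs n"
    and tv: "tv_dist S D \<le> \<epsilon>"
    using code by (auto simp: simulation_code_def S_def D_def)
  have finT: "finite ?T" by (simp add: finite_seqs)
  have subS: "set_pmf S \<subseteq> ?T"
    unfolding S_def simulated_def using dec set_iid_seqs by fastforce
  have subD: "set_pmf D \<subseteq> ?T"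
    unfolding D_def set_joint using set_iid_seqs set_memoryless_seqs by fastforce
  have tv_eq: "(\<Sum>t\<in>?T. \<bar>pmf S t - pmf D t\<bar>) / 2 = tv_dist S D"
    by (simp add: tv_dist_eq_sum[OF finT subS subD])
  \<comment> \<open>The support grows exponentially, so its log-cardinality is linear in
    \<open>n\<close> and contributes \<epsilon> times a constant per letter.\<close>
  have "real (card ?T) = (real (CARD('x) * CARD('y))) ^ n"
    by (simp add: card_cartesian_product card_seqs power_mult_distrib)
  hence logT: "log 2 (real (card ?T)) = real n * L"
    unfolding L_def by (simp add: log_nat_power)
  have L0: "L \<ge> 0"
  proof -
    have "1 \<le> CARD('x) * CARD('y)" by (simp add: Suc_leI)
    hence "1 \<le> real (CARD('x) * CARD('y))" by linarith
    thus ?thesis unfolding L_def by simp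
  qed
  have entS: "ent S \<ge> real n * ent ?J - \<epsilon> * (real n * L) - 1 / ln 2"
  proof -
    have "ent D \<le> ent S + tv_dist S D * (real n * L) + 1 / ln 2"
      using ent_le_ent_plus_l1[OF finT subS subD] unfolding tv_eq logT .
    moreover have "tv_dist S D * (real n * L) \<le> \<epsilon> * (real n * L)"
      using tv L0 by (intro mult_right_mono) auto
    ultimately show ?thesis by (simp add: D_def ent_joint_iid)
  qed
  have iD: "?i i D = ?J" if "i < n" for i
  proof -
    have D: "map_pmf (\<lambda>s. (fst s, snd s)) D = joint (iid n p) (\<lambda>b. Pi_pmf {..<n} undefined (\<lambda>i. W (b i)))"
      by (simp add: D_def memoryless_def[abs_def])
    show ?thesis using map_memoryless_component[OF D that] that
      by (simp add: map_iid_component case_prod_unfold)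
  qed
  have letter: "?G ?J - \<delta> \<le> ?G (?i i S)" "ent (?i i S) \<le> ent ?J + \<delta>" if "i < n" for i
  proof -
    have "\<bar>pmf (?i i S) z - pmf ?J z\<bar> \<le> e" for z
      using pmf_map_diff_le_tv_dist[OF finT subS subD, of "\<lambda>(x, y). (x i, y i)" z] tv \<epsilon>
      unfolding iD[OF that] by linarith
    thus "?G ?J - \<delta> \<le> ?G (?i i S)" "ent (?i i S) \<le> ent ?J + \<delta>" using near by auto
  qed
  have "(\<Sum>i<n. ent (?i i S)) \<le> (\<Sum>i<n. ent ?J + \<delta>)" by (intro sum_mono letter) auto
  hence sumE: "(\<Sum>i<n. ent (?i i S)) - ent S \<le> real n * \<delta> + \<epsilon> * (real n * L) + 1 / ln 2"
    using entS by (simp add: algebra_simps)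
  have "real n * (?G ?J - \<delta>) = (\<Sum>i<n. ?G ?J - \<delta>)" by simp
  also have "\<dots> \<le> (\<Sum>i<n. ?G (?i i S))" by (intro sum_mono letter) auto
  also have "\<dots> \<le> real n * s + (\<beta> + \<theta>) * (real n * R) + (\<beta> + \<theta>) * ((\<Sum>i<n. ent (?i i S)) - ent S)"
    unfolding S_def by (rule simulation_code_bound[OF nn R enc dec s])
  also have "\<dots> \<le> real n * s + (\<beta> + \<theta>) * (real n * R)
      + (\<beta> + \<theta>) * (real n * \<delta> + \<epsilon> * (real n * L) + 1 / ln 2)"
    using sumE nn by (intro add_left_mono mult_left_mono) auto
  also have "\<dots> = real n * (s + (\<beta> + \<theta>) * R + (\<beta> + \<theta>) * (\<delta> + \<epsilon> * L + 1 / (real n * ln 2)))"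
    using n by (simp add: field_simps)
  finally have "?G ?J - \<delta> \<le> s + (\<beta> + \<theta>) * R + (\<beta> + \<theta>) * (\<delta> + \<epsilon> * L + 1 / (real n * ln 2))"
    using n by (subst (asm) mult_le_cancel_left_pos) auto
  thus ?thesis unfolding L_def by linarith
qed

text \<open>Order of the limits: \<delta> is fixed first and determines the neighbourhood
  \<open>e\<close>, then the block length grows until the error falls below e / 2 and beyond, and
  only then does \<delta> tend to 0.\<close>

lemma admissible_info_functional_le:
  fixes p :: "'x::finite pmf" and W :: "('x, 'y::finite) channel"
    and Wt :: "('xt::finite, 'yt::finite) channel"
  assumes nn: "\<beta> \<ge> 0" "\<gamma> \<ge> 0" "\<theta> \<ge> 0" and R: "R \<ge> 0" and adm: "admissible p W Wt R"
  shows "info_functional \<beta> \<gamma> \<theta> (joint p W)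
    \<le> (SUP q. info_functional \<beta> \<gamma> \<theta> (joint q Wt)) + (\<beta> + \<theta>) * R"
proof -
  let ?G = "info_functional \<beta> \<gamma> \<theta>" and ?L = "log 2 (CARD('x) * CARD('y))"
  let ?s = "SUP q. ?G (joint q Wt)"
  have s: "?G (joint q Wt) \<le> ?s" for q
    by (rule cSUP_upper[OF UNIV_I info_functional_channel_bdd[OF nn]])
  obtain \<epsilon> where \<epsilon>: "\<epsilon> \<longlonglongrightarrow> 0" and code: "\<forall>n\<ge>1. \<exists>enc dec. simulation_code n R (\<epsilon> n) p W Wt enc dec"
    using adm by (auto simp: admissible_def)
  have bound: "?G (joint p W) \<le> ?s + (\<beta> + \<theta>) * R + \<delta> * (1 + \<beta> + \<theta>)" if \<delta>: "\<delta> > 0" for \<delta>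
  proof -
    obtain e where e: "e > 0" "\<And>J'. (\<forall>z. \<bar>pmf J' z - pmf (joint p W) z\<bar> \<le> e) \<Longrightarrow>
      ?G (joint p W) - \<delta> \<le> ?G J' \<and> ent J' \<le> ent (joint p W) + \<delta>"
      using info_functional_ent_semicontinuous[OF nn \<delta>, of "joint p W"] by blast
    have "eventually (\<lambda>n. \<epsilon> n < e / 2) sequentially"
      using \<epsilon> e(1) by (intro order_tendstoD) auto
    hence ev: "eventually (\<lambda>n. ?G (joint p W) \<le> ?s + (\<beta> + \<theta>) * R + \<delta>
        + (\<beta> + \<theta>) * (\<delta> + \<epsilon> n * ?L + 1 / (real n * ln 2))) sequentially"
      using eventually_ge_at_top[of 1]
    proof eventually_elim
      case (elim n)
      obtain enc dec where c: "simulation_code n R (\<epsilon> n) p W Wt enc dec" using code elim(2) by blast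
      have "2 * \<epsilon> n \<le> e" using elim(1) by simp
      from simulation_code_single_letter[OF nn R s c this elim(2) e(2)] show ?case .
    qed
    have "(\<lambda>n. 1 / ln 2 * (1 / real n)) \<longlonglongrightarrow> 1 / ln 2 * 0"
      by (intro tendsto_intros lim_1_over_n)
    hence "(\<lambda>n. 1 / (real n * ln 2)) \<longlonglongrightarrow> 0" by (simp add: mult.commute)
    hence "(\<lambda>n. ?s + (\<beta> + \<theta>) * R + \<delta> + (\<beta> + \<theta>) * (\<delta> + \<epsilon> n * ?L + 1 / (real n * ln 2)))
      \<longlonglongrightarrow> ?s + (\<beta> + \<theta>) * R + \<delta> + (\<beta> + \<theta>) * (\<delta> + 0 * ?L + 0)"
      by (intro tendsto_intros \<epsilon>)
    from tendsto_lowerbound[OF this ev] show ?thesis by (simp add: algebra_simps)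
  qed
  show ?thesis
  proof (rule field_le_epsilon)
    fix \<eta> :: real assume \<eta>: "\<eta> > 0"
    have "1 + \<beta> + \<theta> > 0" using nn by simp
    thus "?G (joint p W) \<le> ?s + (\<beta> + \<theta>) * R + \<eta>"
      using bound[of "\<eta> / (1 + \<beta> + \<theta>)"] \<eta> by simp
  qed
qed

theorem theorem6:
  fixes p :: "'x::finite pmf"
    and W :: "('x, 'y::finite) channel"
    and Wt :: "('xt::finite, 'yt::finite) channel"
    and R \<beta> \<gamma> \<theta> :: real
  assumes "R \<ge> 0"
    and "admissible p W Wt R"
    and "\<beta> \<ge> 0" and "\<gamma> \<ge> 0" and "\<theta> \<ge> 0"
  shows "info_functional \<beta> \<gamma> \<theta> (joint p W)
           \<le> (SUP q. info_functional \<beta> \<gamma> \<theta> (joint q Wt)) + (\<beta> + \<gamma> + 2 * \<theta>) * R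
       \<and> (\<exists>q. is_arg_max (\<lambda>q. info_functional \<beta> \<gamma> \<theta> (joint q Wt)) (\<lambda>_. True) q)
       \<and> min_attained_within (CARD('x) * CARD('y)) \<beta> \<gamma> \<theta> (joint p W)
       \<and> (\<forall>q. min_attained_within (CARD('xt) * CARD('yt)) \<beta> \<gamma> \<theta> (joint q Wt))"
proof (intro conjI allI)
  note nn = assms(3-5)
  \<comment> \<open>The coefficient obtained is \<beta> + \<theta>; since \<gamma>, \<theta> and
    \<open>R\<close> are non-negative, the claimed one is at least as large.\<close>
  have "(\<beta> + \<theta>) * R \<le> (\<beta> + \<gamma> + 2 * \<theta>) * R"
    using assms by (intro mult_right_mono) auto
  thus "info_functional \<beta> \<gamma> \<theta> (joint p W)
      \<le> (SUP q. info_functional \<beta> \<gamma> \<theta> (joint q Wt)) + (\<beta> + \<gamma> + 2 * \<theta>) * R"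
    using admissible_info_functional_le[OF nn assms(1,2)] by linarith
  show "\<exists>q. is_arg_max (\<lambda>q. info_functional \<beta> \<gamma> \<theta> (joint q Wt)) (\<lambda>_. True) q"
    by (rule info_functional_channel_max[OF nn])
qed (rule min_attained_within_card[OF assms(3-5)])+


end
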